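(* Assume (A1)–(A5). Then the blow-up time function $x\mapsto T(x)$ is of class $\mathcal{C}^1$ in $B_{R^*}$.
   Context: Let $p>1$ and $\mu>0$ with $p<1+2/\mu$, and let $R^*,T^*>0$. Write $B_R=\{x\in\mathbb{R}:|x|<R\}$ and $D_\pm=\partial_t\pm\partial_x$. Consider the system $D_-\phi=2^{-p}|\phi+\psi|^p-\frac{\mu}{1+t}\frac{\phi+\psi}{2}$, $D_+\psi=2^{-p}|\phi+\psi|^p-\frac{\mu}{1+t}\frac{\phi+\psi}{2}$, $\phi(x,0)=f(x)$, $\psi(x,0)=g(x)$. Fix $\gamma_1,\gamma_2>0$ with $\gamma_1+\gamma_2>\max\big(1,(\mu p 2^p)^{1/(p-1)}\big)$ and let $T_1=\frac{1}{(p-1)\mu}\ln\Big(\frac{2^{1-p}/\mu}{2^{1-p}/\mu-(\gamma_1+\gamma_2)^{1-p}}\Big)$. Assumptions: (A1) $T_1<T^*$. (A2) $f\ge\gamma_1$, $g\ge\gamma_2$ on $B_{R^*+T^*}$. (A3) $f,g\in\mathcal{C}^4(\overline{B_{R^*+T^*}})$. (A4) There is $\varepsilon_0>0$ with $2^{-p}(\gamma_1+\gamma_2)^p-\frac{\mu}{2}(\gamma_1+\gamma_2)\ge(2+\varepsilon_0)\max_{x\in B_{R^*+T^*}}(|f'(x)|+|g'(x)|)$. (A5) There is $\varepsilon_1\neq-1$ with $2^{-p}(2p-1)\big(1+\frac{\varepsilon_1}{2(1+\varepsilon_1)}\big)\big(1-\frac{1}{2p}\big)-2^{-p+1}p-\mu>0$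 such that $2^{-p}(\gamma_1+\gamma_2)^p-\frac{\mu}{2}(\gamma_1+\gamma_2)\ge(2+\varepsilon_1)\max_{x\in B_{R^*+T^*}}(|f'(x)|+|g'(x)|)$. Let $K_{R^*,T^*}=\{(x,t):t>0,\ |x-x_0|<T^*-t\ \text{for some } x_0\in B_{R^*}\}$. Define iterates $\phi_0\equiv\gamma_1$, $\psi_0\equiv\gamma_2$ and, with $\mathcal{N}_n(x,s)=2^{-p}|\phi_n+\psi_n|^p(x,s)-\frac{\mu}{1+s}\frac{(\phi_n+\psi_n)(x,s)}{2}$, $\phi_{n+1}(x,t)=f(x+t)+\int_0^t\mathcal{N}_n(x+t-s,s)\,ds$, $\psi_{n+1}(x,t)=g(x-t)+\int_0^t\mathcal{N}_n(x-t+s,s)\,ds$. Set $\phi=\sup_n\phi_n$, $\psi=\sup_n\psi_n$ and $T(x)=\sup\{t\in(0,T^* ):(\phi+\psi)(x,t)<\infty\}$ for $x\in B_{R^*}$. *)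

theory Defs
  imports "HOL-Analysis.Analysis"
begin

definition Ck_on :: "nat \<Rightarrow> (real \<Rightarrow> real) \<Rightarrow> real set \<Rightarrow> bool" where
  "Ck_on k f S \<longleftrightarrow> (\<exists>D :: nat \<Rightarrow> real \<Rightarrow> real.
      (\<forall>x\<in>S. D 0 x = f x) \<and>
      (\<forall>j\<le>k. continuous_on S (D j)) \<and>
      (\<forall>j<k. \<forall>x\<in>S. (D j has_real_derivative D (Suc j) x) (at x within S)))"

definition Nl :: "real \<Rightarrow> real \<Rightarrow> real \<Rightarrow> real \<Rightarrow> real" where
  "Nl p \<mu> u s = 2 powr (-p) * \<bar>u\<bar> powr p - \<mu> / (1 + s) * (u / 2)"

fun iter :: "real \<Rightarrow> real \<Rightarrow> (real \<Rightarrow> real) \<Rightarrow> (real \<Rightarrow> real) \<Rightarrow> real \<Rightarrow> real \<Rightarrow> nat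
              \<Rightarrow> (real \<Rightarrow> real \<Rightarrow> real) \<times> (real \<Rightarrow> real \<Rightarrow> real)" where
  "iter p \<mu> f g \<gamma>1 \<gamma>2 0 = ((\<lambda>x t. \<gamma>1), (\<lambda>x t. \<gamma>2))"
| "iter p \<mu> f g \<gamma>1 \<gamma>2 (Suc n) =
     (let \<phi>n = fst (iter p \<mu> f g \<gamma>1 \<gamma>2 n); \<psi>n = snd (iter p \<mu> f g \<gamma>1 \<gamma>2 n);
          N = (\<lambda>y s. Nl p \<mu> (\<phi>n y s + \<psi>n y s) s)
      in ((\<lambda>x t. f (x + t) + integral {0..t} (\<lambda>s. N (x + t - s) s)),
          (\<lambda>x t. g (x - t) + integral {0..t} (\<lambda>s. N (x - t + s) s))))"

definition phi_sup :: "real \<Rightarrow> real \<Rightarrow> (real \<Rightarrow> real) \<Rightarrow> (real \<Rightarrow> real) \<Rightarrow> real \<Rightarrow> real \<Rightarrow> real \<Rightarrow> real \<Rightarrow> ereal" where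
  "phi_sup p \<mu> f g \<gamma>1 \<gamma>2 x t = (SUP n. ereal (fst (iter p \<mu> f g \<gamma>1 \<gamma>2 n) x t))"

definition psi_sup :: "real \<Rightarrow> real \<Rightarrow> (real \<Rightarrow> real) \<Rightarrow> (real \<Rightarrow> real) \<Rightarrow> real \<Rightarrow> real \<Rightarrow> real \<Rightarrow> real \<Rightarrow> ereal" where
  "psi_sup p \<mu> f g \<gamma>1 \<gamma>2 x t = (SUP n. ereal (snd (iter p \<mu> f g \<gamma>1 \<gamma>2 n) x t))"

definition blowup_time :: "real \<Rightarrow> real \<Rightarrow> (real \<Rightarrow> real) \<Rightarrow> (real \<Rightarrow> real) \<Rightarrow> real \<Rightarrow> real \<Rightarrow> real \<Rightarrow> real \<Rightarrow> real" where
  "blowup_time p \<mu> f g \<gamma>1 \<gamma>2 Ts x =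
     Sup {t. 0 < t \<and> t < Ts \<and> phi_sup p \<mu> f g \<gamma>1 \<gamma>2 x t + psi_sup p \<mu> f g \<gamma>1 \<gamma>2 x t < \<infinity>}"

end

theory Submission
  imports Defs
begin

text \<open>
  Write \<open>v 1\<close>, \<open>v (-1)\<close> for \<open>\<phi>\<close>, \<open>\<psi>\<close>, so that \<open>v \<sigma>\<close> satisfies
  \<open>\<partial>\<^sub>t v - \<sigma> \<partial>\<^sub>x v = W\<close> with \<open>W = Nl p \<mu> u t\<close> and \<open>u = v 1 + v (-1)\<close>; \<open>a \<sigma>\<close> is the space derivative and
  \<open>vt \<sigma> = \<sigma> * a \<sigma> + W\<close> the time derivative of \<open>v \<sigma>\<close>.

  By (A4) every iterate increases in all directions \<open>(h, k)\<close> with \<open>\<theta> * \<bar>h\<bar> \<le> k\<close>, where \<open>\<theta> < 1\<close>.  Hence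
  \<open>T\<close> is \<open>\<theta>\<close>-Lipschitz, \<open>\<bar>a\<bar> \<le> \<theta> * vt\<close>, the limit is \<open>C\<^sup>1\<close> below the graph of \<open>T\<close>, and on vertical lines
  \<open>u\<close> behaves like a solution of \<open>u' = u\<^sup>p\<close>, i.e. \<open>u\<close> is comparable to \<open>(T x - t)\<close> to the power
  \<open>-1 / (p - 1)\<close>.

  The slopes of the level sets are governed by \<open>- a \<sigma> / vt \<sigma>\<close>.  Bounds \<open>m \<le> - a \<sigma> / vt \<sigma> \<le> M\<close> at the base
  of a backward light cone persist inside it, because \<open>a + M * vt\<close> and \<open>- a - m * vt\<close> solve the
  linearised system with nonnegative coupling (up to the time dependence of the damping, which costs
  \<open>O(r)\<close> at scale \<open>r\<close>).  The coupling moreover spreads positive mass of either quantity over the whole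
  cone, so passing from scale \<open>r\<close> to \<open>r / 10\<close> shrinks \<open>M - m\<close> by a fixed factor, up to \<open>O(r)\<close>.  Thus the
  difference quotients of \<open>T\<close> near each point have oscillation tending to \<open>0\<close>, and \<open>T\<close> is \<open>C\<^sup>1\<close>.
\<close>

section \<open>Positivity along characteristics and a criterion for \<open>C\<^sup>1\<close>\<close>

text \<open>No asymptotic profile of the blow-up is needed, only two-sided bounds. In a trapezoid of
  size \<open>r\<close> under the blow-up curve the coupling is at least of order
  \<open>1 / r\<close>, while characteristics have length of order \<open>r\<close>; the mass
  exchanged does not depend on \<open>r\<close>, which is why one contraction factor serves all
  scales. The number \<theta> is \<open>1 / (1 + \<epsilon>)\<close> with the constant \<epsilon> of
  (A4): the factor \<open>2 + \<epsilon>\<close> there is \<open>1 + 1 / \<theta>\<close>, just what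
  lets the nonlinearity pay for the variation of the data in spacelike directions. That \<theta> < 1
  strictly matters twice: backward light cones of points below the graph of \<open>T\<close> stay
  below it, and a bound on one vertical line spreads to an interval wider than the light cone that
  has to be continued. (A1) enters through comparison with a spatially constant solution. It gives
  \<open>T x < Ts\<close>, so the supremum defining \<open>T\<close> marks genuine blow-up and not
  the cut-off at \<open>Ts\<close>. The lower bound on \<gamma>1 + \<gamma>2 keeps the damping below
  the power term, so that the nonlinearity is positive and increasing in \<phi> + \<psi>.\<close>

text \<open>Minimum principle: if the weighted minimum of both components over the compact backward
  cone were negative, follow the characteristic of the smaller component back to the base. The
  coupling can account only for the fraction \<open>2 * L / K < 1\<close> of the negative value, and
  the value at the base is nonnegative. The form \<open>L * min 0 ...\<close> is what a coefficient
  between 0 and \<open>L\<close> guarantees whatever the sign of the sum.\<close>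

lemma characteristic_positivity:
  fixes E :: "real \<Rightarrow> real \<Rightarrow> real \<Rightarrow> real" and x1 t0 t1 L :: real
  defines "C \<equiv> {(x, t). t0 \<le> t \<and> t \<le> t1 \<and> \<bar>x - x1\<bar> \<le> t1 - t}"
  assumes t01: "t0 \<le> t1" and L: "0 \<le> L"
    and cont: "\<And>\<sigma>. \<sigma> \<in> {1, -1} \<Longrightarrow> continuous_on C (\<lambda>(x, t). E \<sigma> x t)"
    and base: "\<And>\<sigma> x. \<sigma> \<in> {1, -1} \<Longrightarrow> \<bar>x - x1\<bar> \<le> t1 - t0 \<Longrightarrow> 0 \<le> E \<sigma> x t0"
    and deriv: "\<And>\<sigma> x t. \<sigma> \<in> {1, -1} \<Longrightarrow> (x, t) \<in> C \<Longrightarrow> t0 < t \<Longrightarrow>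
      \<exists>D. ((\<lambda>s. E \<sigma> (x + \<sigma> * (t - s)) s) has_real_derivative D) (at t)
          \<and> L * min 0 (E 1 x t + E (-1) x t) \<le> D"
    and \<sigma>: "\<sigma> \<in> {1, -1}"
  shows "0 \<le> E \<sigma> x1 t1"
proof -
  define K where "K = 2 * L + 1"
  have K: "K > 0" "K > 2 * L" using L by (auto simp: K_def)
  define w where "w = (\<lambda>(x, t). exp (- K * t) * min (E 1 x t) (E (-1) x t))"
  have comp: "compact C"
  proof (rule compact_eq_bounded_closed[THEN iffD2], rule conjI)
    have "C \<subseteq> {x1 - (t1 - t0)..x1 + (t1 - t0)} \<times> {t0..t1}"
      by (auto simp: C_def)
    then show "bounded C"
      using bounded_subset[OF bounded_Times[OF bounded_closed_interval bounded_closed_interval]] by blast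
    have "C = {z. t0 \<le> snd z \<and> snd z \<le> t1 \<and> \<bar>fst z - x1\<bar> \<le> t1 - snd z}"
      by (auto simp: C_def)
    then show "closed C"
      by (auto intro!: closed_Collect_conj closed_Collect_le continuous_intros)
  qed
  have w: "continuous_on C w"
    using cont[of 1] cont[of "-1"]
    unfolding w_def by (auto simp: case_prod_unfold intro!: continuous_intros)
  have ne: "(x1, t1) \<in> C" using t01 by (auto simp: C_def)
  obtain z where z: "z \<in> C" "\<And>y. y \<in> C \<Longrightarrow> w z \<le> w y"
    using continuous_attains_inf[OF comp _ w] ne by blast
  obtain x t where xt: "z = (x, t)" by (cases z)
  have xtC: "(x, t) \<in> C" using z xt by simp
  define m where "m = w z"
  have low: "m * exp (K * t') \<le> E \<sigma>' x' t'" if "(x', t') \<in> C" "\<sigma>' \<in> {1, -1}" for x' t' \<sigma>'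
  proof -
    have "m \<le> exp (- K * t') * min (E 1 x' t') (E (-1) x' t')"
      using z(2)[OF that(1)] by (simp add: m_def w_def)
    then have "m * exp (K * t') \<le> exp (- K * t') * min (E 1 x' t') (E (-1) x' t') * exp (K * t')"
      by (rule mult_right_mono) simp
    also have "\<dots> = min (E 1 x' t') (E (-1) x' t')"
      by (simp add: exp_minus field_simps)
    finally show ?thesis using that(2) by auto
  qed
  have "m \<ge> 0"
  proof (rule ccontr)
    assume "\<not> m \<ge> 0"
    then have m: "m < 0" by simp
    obtain \<rho> where \<rho>: "\<rho> \<in> {1, -1}" "E \<rho> x t = min (E 1 x t) (E (-1) x t)"
      by (metis insertCI min_def)
    have Em: "E \<rho> x t = m * exp (K * t)"
      unfolding m_def xt w_def \<rho>(2) by (simp add: exp_minus field_simps)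
    have tt: "t0 < t"
    proof (rule ccontr)
      assume "\<not> t0 < t"
      then have "t = t0" using xtC by (auto simp: C_def)
      then have "0 \<le> E \<rho> x t" using base[OF \<rho>(1), of x] xtC by (auto simp: C_def)
      then show False using Em m by (simp add: zero_le_mult_iff)
    qed
    \<comment> \<open>Subtracted is a primitive of the worst case
      \<open>2 * L * m * exp (K * s)\<close>, so \<open>h\<close> increases from a nonnegative value
      and yet would end at \<open>m * exp (K * t) * (1 - 2 * L / K) < 0\<close>.\<close>
    define h where "h = (\<lambda>s. E \<rho> (x + \<rho> * (t - s)) s - m * (2 * L / K) * exp (K * s))"
    have chC: "(x + \<rho> * (t - s), s) \<in> C" if "t0 \<le> s" "s \<le> t" for s
    proof -
      have "\<bar>\<rho> * (t - s)\<bar> = t - s" using \<rho>(1) that by (auto simp: abs_mult)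
      then show ?thesis using xtC that by (auto simp: C_def)
    qed
    have "h t0 \<le> h t"
    proof (rule DERIV_nonneg_imp_increasing_open[of t0 t h])
      show "t0 \<le> t" using tt by simp
      show "continuous_on {t0..t} h"
      proof -
        have "continuous_on {t0..t} (\<lambda>s. (\<lambda>(x, t). E \<rho> x t) (x + \<rho> * (t - s), s))"
          by (rule continuous_on_compose2[OF cont[OF \<rho>(1)]]) (use chC in \<open>auto intro!: continuous_intros\<close>)
        then show ?thesis unfolding h_def using K by (auto intro!: continuous_intros)
      qed
      fix s assume s: "t0 < s" "s < t"
      obtain D where D: "((\<lambda>s'. E \<rho> (x + \<rho> * (t - s) + \<rho> * (s - s')) s') has_real_derivative D) (at s)"
        "L * min 0 (E 1 (x + \<rho> * (t - s)) s + E (-1) (x + \<rho> * (t - s)) s) \<le> D"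
        using deriv[OF \<rho>(1) chC, of s] s by auto
      have eq: "x + \<rho> * (t - s) + \<rho> * (s - s') = x + \<rho> * (t - s')" for s'
        by (simp add: algebra_simps)
      have "(h has_real_derivative D - m * (2 * L / K) * (K * exp (K * s))) (at s)"
        unfolding h_def using D(1)[unfolded eq]
        by (auto intro!: derivative_eq_intros)
      moreover have "D - m * (2 * L / K) * (K * exp (K * s)) \<ge> 0"
      proof -
        have "2 * (m * exp (K * s)) \<le> min 0 (E 1 (x + \<rho> * (t - s)) s + E (-1) (x + \<rho> * (t - s)) s)"
          using low[OF chC, of s 1] low[OF chC, of s "-1"] s m
          by (auto simp: mult_le_0_iff)
        then have "L * (2 * (m * exp (K * s))) \<le> D"
          using D(2) L mult_left_mono order_trans by blast
        then show ?thesis using K by (simp add: field_simps)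
      qed
      ultimately show "\<exists>y. (h has_real_derivative y) (at s) \<and> 0 \<le> y" by blast
    qed
    moreover have "h t0 \<ge> 0"
    proof -
      have "(x + \<rho> * (t - t0), t0) \<in> C" using chC tt by simp
      then have "0 \<le> E \<rho> (x + \<rho> * (t - t0)) t0" using base[OF \<rho>(1)] by (auto simp: C_def)
      moreover have "m * (2 * L / K) * exp (K * t0) \<le> 0" using m K L
        by (simp add: mult_le_0_iff zero_le_mult_iff divide_le_0_iff)
      ultimately show ?thesis by (simp add: h_def)
    qed
    moreover have "h t < 0"
    proof -
      have "h t = (m * exp (K * t)) * (1 - 2 * L / K)" by (simp add: h_def Em algebra_simps)
      moreover have "1 - 2 * L / K > 0" using K by simp
      moreover have "m * exp (K * t) < 0" using m by (simp add: mult_less_0_iff)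
      ultimately show ?thesis by (metis mult_neg_pos)
    qed
    ultimately show False by simp
  qed
  moreover have "m * exp (K * t1) \<le> E \<sigma> x1 t1" using low[OF ne \<sigma>] .
  ultimately show ?thesis by (meson exp_ge_zero mult_nonneg_nonneg order_trans)
qed

text \<open>The slope bounds concern all pairs of points near \<open>x0\<close>, not only pairs
  containing \<open>x0\<close>. Hence the interval from \<open>m\<close> to \<open>M\<close> also
  contains the derivative at every nearby point, which yields continuity of the derivative along
  with its existence.\<close>

lemma C1_differentiable_on_if_slopes_close:
  fixes T :: "real \<Rightarrow> real"
  assumes slopes: "\<And>x0 \<eta>. x0 \<in> S \<Longrightarrow> \<eta> > 0 \<Longrightarrow> \<exists>\<rho>>0. \<exists>m M. M - m \<le> \<eta> \<and>
      (\<forall>x y. \<bar>x - x0\<bar> < \<rho> \<longrightarrow> \<bar>y - x0\<bar> < \<rho> \<longrightarrow> x \<le> y \<longrightarrow>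
         m * (y - x) \<le> T y - T x \<and> T y - T x \<le> M * (y - x))"
  shows "T C1_differentiable_on S"
proof -
  define sl where "sl x0 \<rho> m M \<longleftrightarrow> \<rho> > 0 \<and> (\<forall>x y. \<bar>x - x0\<bar> < \<rho> \<longrightarrow> \<bar>y - x0\<bar> < \<rho> \<longrightarrow> x \<le> y \<longrightarrow>
         m * (y - x) \<le> T y - T x \<and> T y - T x \<le> M * (y - x))" for x0 \<rho> m M
  have le: "m \<le> M'" if "sl x0 \<rho> m M" "sl x0 \<rho>' m' M'" for x0 \<rho> m M \<rho>' m' M'
  proof -
    define e where "e = min \<rho> \<rho>' / 2"
    have e: "e > 0" "e < \<rho>" "e < \<rho>'" using that by (auto simp: e_def sl_def)
    have "m * e \<le> T (x0 + e) - T x0"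
      using that(1)[unfolded sl_def, THEN conjunct2, rule_format, of x0 "x0 + e"] e by simp
    moreover have "T (x0 + e) - T x0 \<le> M' * e"
      using that(2)[unfolded sl_def, THEN conjunct2, rule_format, of x0 "x0 + e"] e by simp
    ultimately show ?thesis using e by (meson mult_right_le_imp_le order_trans)
  qed
  \<comment> \<open>By \<open>le\<close>, tested on a short segment common to both neighbourhoods,
    every local lower slope bound is below every local upper one; so this supremum lies in all the
    intervals at once.\<close>
  define D where "D x0 = Sup {m. \<exists>\<rho> M. sl x0 \<rho> m M}" for x0
  have Dm: "m \<le> D x0" "D x0 \<le> M" if "sl x0 \<rho> m M" for x0 \<rho> m M
  proof -
    have "bdd_above {m. \<exists>\<rho> M. sl x0 \<rho> m M}" using le that unfolding bdd_above_def by blast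
    then show "m \<le> D x0" unfolding D_def using that by (blast intro: cSup_upper)
    show "D x0 \<le> M" unfolding D_def using that le by (intro cSup_least) blast+
  qed
  have near: "sl x (\<rho> - \<bar>x - x0\<bar>) m M" if "sl x0 \<rho> m M" "\<bar>x - x0\<bar> < \<rho>" for x x0 \<rho> m M
    unfolding sl_def
  proof (intro conjI allI impI)
    show "0 < \<rho> - \<bar>x - x0\<bar>" using that by simp
    fix y z assume yz: "\<bar>y - x\<bar> < \<rho> - \<bar>x - x0\<bar>" "\<bar>z - x\<bar> < \<rho> - \<bar>x - x0\<bar>" "y \<le> z"
    have "\<bar>y - x0\<bar> < \<rho>" "\<bar>z - x0\<bar> < \<rho>" using yz by linarith+
    then show "m * (z - y) \<le> T z - T y" "T z - T y \<le> M * (z - y)"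
      using that(1) yz(3) unfolding sl_def by auto
  qed
  have ex: "\<exists>\<rho> m M. M - m \<le> \<eta> \<and> sl x0 \<rho> m M" if "x0 \<in> S" "\<eta> > 0" for x0 \<eta>
    using slopes[OF that] unfolding sl_def by blast
  have "(T has_real_derivative D x0) (at x0)" if x0: "x0 \<in> S" for x0
    unfolding has_field_derivative_iff
  proof (rule LIM_I)
    fix e :: real assume e: "0 < e"
    obtain \<rho> m M where s: "M - m \<le> e / 2" "sl x0 \<rho> m M" using ex[OF x0, of "e/2"] e by auto
    have "norm ((T y - T x0) / (y - x0) - D x0) < e" if y: "y \<noteq> x0" "norm (y - x0) < \<rho>" for y
    proof -
      have "m \<le> (T y - T x0) / (y - x0) \<and> (T y - T x0) / (y - x0) \<le> M"
      proof (cases "x0 < y")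
        case True
        then have "m * (y - x0) \<le> T y - T x0" "T y - T x0 \<le> M * (y - x0)"
          using s(2) y unfolding sl_def by auto
        then show ?thesis using True by (simp add: field_simps)
      next
        case False
        then have lt: "y < x0" using y by simp
        then have "m * (x0 - y) \<le> T x0 - T y" "T x0 - T y \<le> M * (x0 - y)"
          using s(2) y unfolding sl_def by auto
        moreover have "(T y - T x0) / (y - x0) = (T x0 - T y) / (x0 - y)"
          by (metis minus_diff_eq minus_divide_divide)
        ultimately show ?thesis using lt by (simp add: pos_le_divide_eq pos_divide_le_eq)
      qed
      then show ?thesis using Dm[OF s(2)] s(1) e by (simp add: abs_less_iff)
    qed
    then show "\<exists>s>0. \<forall>x. x \<noteq> x0 \<and> norm (x - x0) < s \<longrightarrow> norm ((T x - T x0) / (x - x0) - D x0) < e"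
      using s(2) unfolding sl_def by blast
  qed
  moreover have "continuous_on S D"
    unfolding continuous_on_iff
  proof (intro ballI allI impI)
    fix x0 e :: real assume x0: "x0 \<in> S" and e: "0 < e"
    obtain \<rho> m M where s: "M - m \<le> e / 2" "sl x0 \<rho> m M" using ex[OF x0, of "e/2"] e by auto
    have "dist (D x) (D x0) < e" if "dist x x0 < \<rho>" for x
      using Dm[OF s(2)] Dm[OF near[OF s(2), of x]] that s(1) e by (auto simp: dist_real_def)
    then show "\<exists>d>0. \<forall>x'\<in>S. dist x' x0 < d \<longrightarrow> dist (D x') (D x0) < e"
      using s(2) unfolding sl_def by blast
  qed
  ultimately show ?thesis
    unfolding C1_differentiable_on_def has_real_derivative_iff_has_vector_derivative by blast
qed

section \<open>The nonlinearity\<close>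

text \<open>For positive \<open>u\<close>, this is the partial derivative of \<open>Nl\<close> in
  \<open>u\<close>; \<open>Ns\<close> below is the one in \<open>s\<close>, nonnegative because the
  damping fades with time.\<close>

definition Nu :: "real \<Rightarrow> real \<Rightarrow> real \<Rightarrow> real \<Rightarrow> real" where
  "Nu p \<mu> u s = 2 powr (-p) * p * u powr (p - 1) - \<mu> / (2 * (1 + s))"

definition Ns :: "real \<Rightarrow> real \<Rightarrow> real \<Rightarrow> real" where
  "Ns \<mu> u s = \<mu> * u / (2 * (1 + s)\<^sup>2)"

lemma has_real_derivative_Nl:
  assumes w: "(w has_real_derivative w') (at s)" and "w s > 0" "s > -1"
  shows "((\<lambda>s. Nl p \<mu> (w s) s) has_real_derivative Nu p \<mu> (w s) s * w' + Ns \<mu> (w s) s) (at s)"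
proof -
  have cw: "isCont w s" using w DERIV_isCont by blast
  have ev: "eventually (\<lambda>x. w x > 0) (nhds s)"
    using cw \<open>w s > 0\<close> by (simp add: isCont_def tendsto_at_iff_tendsto_nhds order_tendstoD(1))
  have "((\<lambda>s. 2 powr (-p) * w s powr p - \<mu> / (1 + s) * (w s / 2)) has_real_derivative
      Nu p \<mu> (w s) s * w' + Ns \<mu> (w s) s) (at s)"
  proof -
    have "((\<lambda>s. w s powr p) has_real_derivative p * w s powr (p - 1) * w') (at s)"
      using DERIV_fun_powr[OF w \<open>w s > 0\<close>, of p] by simp
    then have 1: "((\<lambda>s. 2 powr (-p) * w s powr p) has_real_derivative 2 powr (-p) * (p * w s powr (p - 1) * w')) (at s)"
      by (rule DERIV_cmult)
    have "((\<lambda>s. \<mu> / (1 + s)) has_real_derivative - \<mu> / (1 + s)\<^sup>2) (at s)"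
      using \<open>s > -1\<close> by (auto intro!: derivative_eq_intros simp: power2_eq_square)
    from DERIV_diff[OF 1 DERIV_mult[OF this DERIV_cdivide[OF w, of 2]]]
    show ?thesis
    proof (rule DERIV_cong)
      define c d where "c = \<mu> / (1 + s)" and "d = \<mu> / (1 + s)\<^sup>2"
      have eqs: "Nu p \<mu> (w s) s = 2 powr (-p) * p * w s powr (p - 1) - c / 2" "Ns \<mu> (w s) s = d * w s / 2"
        "- \<mu> / (1 + s)\<^sup>2 = - d"
        by (simp_all add: Nu_def Ns_def c_def d_def)
      show "2 powr (-p) * (p * w s powr (p - 1) * w') - (- \<mu> / (1 + s)\<^sup>2 * (w s / 2) + w' / 2 * (\<mu> / (1 + s)))
          = Nu p \<mu> (w s) s * w' + Ns \<mu> (w s) s"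
        unfolding eqs c_def[symmetric] by (simp add: algebra_simps)
    qed
  qed
  moreover have "eventually (\<lambda>s. Nl p \<mu> (w s) s = 2 powr (-p) * w s powr p - \<mu> / (1 + s) * (w s / 2)) (nhds s)"
    using ev by eventually_elim (simp add: Nl_def)
  ultimately show ?thesis by (simp add: DERIV_cong_ev)
qed

lemma has_real_derivative_Nl_space:
  assumes w: "(w has_real_derivative w') (at x)" and "w x > 0"
  shows "((\<lambda>x. Nl p \<mu> (w x) s) has_real_derivative Nu p \<mu> (w x) s * w') (at x)"
proof -
  have "isCont w x" using w DERIV_isCont by blast
  then have ev: "eventually (\<lambda>x. w x > 0) (nhds x)"
    using \<open>w x > 0\<close> by (simp add: isCont_def tendsto_at_iff_tendsto_nhds order_tendstoD(1))
  have "((\<lambda>x. w x powr p) has_real_derivative p * w x powr (p - 1) * w') (at x)"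
    using DERIV_fun_powr[OF w \<open>w x > 0\<close>, of p] by simp
  then have 1: "((\<lambda>x. 2 powr (-p) * w x powr p) has_real_derivative 2 powr (-p) * (p * w x powr (p - 1) * w')) (at x)"
    by (rule DERIV_cmult)
  from DERIV_diff[OF 1 DERIV_cmult[OF DERIV_cdivide[OF w, of 2], of "\<mu> / (1 + s)"]]
  have "((\<lambda>x. 2 powr (-p) * w x powr p - \<mu> / (1 + s) * (w x / 2)) has_real_derivative Nu p \<mu> (w x) s * w') (at x)"
  proof (rule DERIV_cong)
    define c where "c = \<mu> / (1 + s)"
    have e: "Nu p \<mu> (w x) s = 2 powr (-p) * p * w x powr (p - 1) - c / 2" by (simp add: Nu_def c_def)
    show "2 powr (-p) * (p * w x powr (p - 1) * w') - \<mu> / (1 + s) * (w' / 2) = Nu p \<mu> (w x) s * w'"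
      unfolding e c_def[symmetric] by (simp add: algebra_simps)
  qed
  moreover have "eventually (\<lambda>x. Nl p \<mu> (w x) s = 2 powr (-p) * w x powr p - \<mu> / (1 + s) * (w x / 2)) (nhds x)"
    using ev by eventually_elim (simp add: Nl_def)
  ultimately show ?thesis by (simp add: DERIV_cong_ev)
qed

text \<open>\<open>threshold\<close> is the lower bound on \<gamma>1 + \<gamma>2 raised to the power
  \<open>p - 1\<close>. It persists for all \<open>u\<close> above \<gamma>, where the damping is
  therefore dominated by the power term, so that \<open>Nl\<close> and \<open>Nu\<close> are
  positive and comparable to \<open>u powr p\<close> and \<open>u powr (p - 1)\<close>.\<close>

locale nonlinearity =
  fixes p \<mu> \<gamma> :: real
  assumes p: "p > 1" and \<mu>: "\<mu> > 0" and \<gamma>: "\<gamma> > 0"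
    and threshold: "\<mu> * p * 2 powr p < \<gamma> powr (p - 1)"
begin

lemma damping_le:
  assumes "\<gamma> \<le> u"
  shows "\<mu> * u * p \<le> 2 powr (-p) * u powr p"
proof -
  have u: "u > 0" using assms \<gamma> by simp
  have "\<mu> * p * 2 powr p \<le> u powr (p - 1)"
    using threshold powr_mono2[of "p - 1" \<gamma> u] p \<gamma> assms by linarith
  then have "\<mu> * p * 2 powr p * (2 powr (-p) * u) \<le> u powr (p - 1) * (2 powr (-p) * u)"
    by (rule mult_right_mono) (use u in simp)
  then show ?thesis using u by (simp add: powr_minus powr_diff field_simps)
qed

lemma damping_le':
  assumes "\<gamma> \<le> u" "0 \<le> s"
  shows "0 \<le> \<mu> / (1 + s) * u" "\<mu> / (1 + s) * u \<le> 2 powr (-p) * u powr p"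
proof -
  have u: "u > 0" using assms \<gamma> by simp
  show "0 \<le> \<mu> / (1 + s) * u" using u \<mu> assms by simp
  have "\<mu> / (1 + s) \<le> \<mu> / 1" by (rule divide_left_mono) (use \<mu> assms in auto)
  then have "\<mu> / (1 + s) * u \<le> \<mu> * u" by (intro mult_right_mono) (use u in auto)
  also have "\<dots> \<le> \<mu> * u * p" using u \<mu> p by simp
  also have "\<dots> \<le> 2 powr (-p) * u powr p" by (rule damping_le[OF assms(1)])
  finally show "\<mu> / (1 + s) * u \<le> 2 powr (-p) * u powr p" .
qed

lemma Nl_bounds:
  assumes "\<gamma> \<le> u" "0 \<le> s"
  shows "2 powr (-p) * u powr p / 2 \<le> Nl p \<mu> u s" "Nl p \<mu> u s \<le> 2 powr (-p) * u powr p"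
    "0 < Nl p \<mu> u s"
proof -
  have u: "u > 0" using assms \<gamma> by simp
  show 1: "2 powr (-p) * u powr p / 2 \<le> Nl p \<mu> u s" and "Nl p \<mu> u s \<le> 2 powr (-p) * u powr p"
  proof -
    define d where "d = \<mu> / (1 + s) * u"
    have "Nl p \<mu> u s = 2 powr (-p) * u powr p - d / 2" using u by (simp add: Nl_def d_def)
    moreover have "0 \<le> d" "d \<le> 2 powr (-p) * u powr p" using damping_le'[OF assms] by (simp_all add: d_def)
    ultimately show "2 powr (-p) * u powr p / 2 \<le> Nl p \<mu> u s" "Nl p \<mu> u s \<le> 2 powr (-p) * u powr p"
      by linarith+
  qed
  have "0 < 2 powr (-p) * u powr p / 2" using u by simp
  then show "0 < Nl p \<mu> u s" using 1 by linarith
qed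

lemma Nu_bounds:
  assumes "\<gamma> \<le> u" "0 \<le> s"
  shows "2 powr (-p) * u powr (p - 1) / 2 \<le> Nu p \<mu> u s" "Nu p \<mu> u s \<le> p * 2 powr (-p) * u powr (p - 1)"
    "0 < Nu p \<mu> u s"
proof -
  have u: "u > 0" using assms \<gamma> by simp
  define X where "X = 2 powr (-p) * u powr (p - 1)"
  have "\<mu> / (1 + s) \<le> X"
  proof -
    have "\<mu> / (1 + s) * u / u \<le> 2 powr (-p) * u powr p / u"
      using damping_le'(2)[OF assms] u by (intro divide_right_mono) auto
    then show ?thesis using u by (simp add: powr_diff X_def)
  qed
  moreover have "1 * X \<le> p * X"
    by (rule mult_right_mono) (use p in \<open>auto simp: X_def\<close>)
  moreover have "0 \<le> \<mu> / (1 + s)" using \<mu> assms by simp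
  moreover have "Nu p \<mu> u s = p * X - \<mu> / (1 + s) / 2" by (simp add: Nu_def X_def)
  moreover define d where "d = \<mu> / (1 + s)"
  ultimately have "d \<le> X" "X \<le> p * X" "0 \<le> d" "Nu p \<mu> u s = p * X - d / 2" by simp_all
  then have "X / 2 \<le> Nu p \<mu> u s" "Nu p \<mu> u s \<le> p * X" by linarith+
  then show 1: "2 powr (-p) * u powr (p - 1) / 2 \<le> Nu p \<mu> u s"
    and "Nu p \<mu> u s \<le> p * 2 powr (-p) * u powr (p - 1)"
    by (simp_all add: X_def)
  have "0 < 2 powr (-p) * u powr (p - 1) / 2" using u by simp
  then show "0 < Nu p \<mu> u s" using 1 by linarith
qed

text \<open>The second bound is what allows the drift in \<open>E\<close> to absorb the time
  derivative of the damping.\<close>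

lemma Ns_bounds:
  assumes "\<gamma> \<le> u" "0 \<le> s"
  shows "0 \<le> Ns \<mu> u s" "Ns \<mu> u s \<le> Nl p \<mu> u s"
proof -
  have u: "u > 0" using assms \<gamma> by simp
  show "0 \<le> Ns \<mu> u s" using u \<mu> by (simp add: Ns_def)
  have "1 + s \<le> (1 + s)\<^sup>2" using assms by (simp add: power2_eq_square)
  then have "Ns \<mu> u s \<le> \<mu> * u / (2 * (1 + s))"
    unfolding Ns_def by (intro divide_left_mono) (use u \<mu> assms in auto)
  also have "\<dots> = (\<mu> / (1 + s) * u) / 2" by simp
  also have "\<dots> \<le> 2 powr (-p) * u powr p / 2" by (intro divide_right_mono damping_le'(2)[OF assms]) simp
  also have "\<dots> \<le> Nl p \<mu> u s" by (rule Nl_bounds[OF assms])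
  finally show "Ns \<mu> u s \<le> Nl p \<mu> u s" .
qed

lemma Nl_diff_bounds:
  assumes "\<gamma> \<le> u" "u \<le> w" "w \<le> B" "0 \<le> s"
  shows "0 \<le> Nl p \<mu> w s - Nl p \<mu> u s"
    "Nl p \<mu> w s - Nl p \<mu> u s \<le> p * 2 powr (-p) * B powr (p - 1) * (w - u)"
proof -
  have d: "((\<lambda>u. Nl p \<mu> u s) has_real_derivative Nu p \<mu> x s) (at x)" if "\<gamma> \<le> x" for x
    using has_real_derivative_Nl_space[of "\<lambda>u. u" 1 x p \<mu> s] that \<gamma> by simp
  have "0 \<le> Nl p \<mu> w s - Nl p \<mu> u s \<and>
      Nl p \<mu> w s - Nl p \<mu> u s \<le> p * 2 powr (-p) * B powr (p - 1) * (w - u)"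
  proof (cases "u = w")
    case False
    then have "u < w" using assms by simp
    then obtain z where z: "u < z" "z < w" "Nl p \<mu> w s - Nl p \<mu> u s = (w - u) * Nu p \<mu> z s"
      using MVT2[of u w "\<lambda>u. Nl p \<mu> u s" "\<lambda>u. Nu p \<mu> u s"] d assms by force
    have zg: "\<gamma> \<le> z" using z assms by simp
    have "z powr (p - 1) \<le> B powr (p - 1)"
      by (rule powr_mono2) (use z assms \<gamma> p in auto)
    then have "p * 2 powr (-p) * z powr (p - 1) \<le> p * 2 powr (-p) * B powr (p - 1)"
      by (rule mult_left_mono) (use p in simp)
    then have "Nu p \<mu> z s \<le> p * 2 powr (-p) * B powr (p - 1)"
      using Nu_bounds(2)[OF zg assms(4)] by linarith
    then show ?thesis using z(3) \<open>u < w\<close> Nu_bounds(3)[OF zg assms(4)]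
      by (simp add: mult_left_mono mult.commute)
  qed simp
  then show "0 \<le> Nl p \<mu> w s - Nl p \<mu> u s"
    "Nl p \<mu> w s - Nl p \<mu> u s \<le> p * 2 powr (-p) * B powr (p - 1) * (w - u)" by auto
qed

text \<open>Monotonicity in time comes from the decay of the damping coefficient; it is what allows
  values at different times to be compared in \<open>Phi_cone\<close>.\<close>

lemma Nl_mono:
  assumes "\<gamma> \<le> u" "u \<le> w" "0 \<le> s" "s \<le> s'"
  shows "Nl p \<mu> u s \<le> Nl p \<mu> w s'"
proof -
  have "Nl p \<mu> u s \<le> Nl p \<mu> w s" using Nl_diff_bounds(1)[of u w w s] assms by simp
  also have "Nl p \<mu> w s \<le> Nl p \<mu> w s'"
  proof -
    have "\<mu> / (1 + s') \<le> \<mu> / (1 + s)" by (rule divide_left_mono) (use \<mu> assms in auto)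
    then have "\<mu> / (1 + s') * (w / 2) \<le> \<mu> / (1 + s) * (w / 2)"
      by (rule mult_right_mono) (use assms \<gamma> in auto)
    then show ?thesis by (simp add: Nl_def)
  qed
  finally show ?thesis .
qed

lemma Nl_lipschitz:
  assumes "\<gamma> \<le> u" "u \<le> B" "\<gamma> \<le> w" "w \<le> B" "0 \<le> s"
  shows "\<bar>Nl p \<mu> w s - Nl p \<mu> u s\<bar> \<le> p * 2 powr (-p) * B powr (p - 1) * \<bar>w - u\<bar>"
  using Nl_diff_bounds[of u w B s] Nl_diff_bounds[of w u B s] assms
  by (cases "u \<le> w") auto

lemma Nu_lipschitz:
  "\<exists>L\<ge>0. \<forall>u w s. \<gamma> \<le> u \<and> u \<le> B \<and> \<gamma> \<le> w \<and> w \<le> B \<longrightarrow> \<bar>Nu p \<mu> w s - Nu p \<mu> u s\<bar> \<le> L * \<bar>w - u\<bar>"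
proof -
  \<comment> \<open>The exponent \<open>p - 2\<close> may have either sign, so the largest value of
    \<open>x powr (p - 2)\<close> may sit at either end of the interval; the sum covers both
    cases.\<close>
  define L where "L = 2 powr (-p) * p * ((p - 1) * (\<gamma> powr (p - 2) + B powr (p - 2)))"
  have "\<bar>Nu p \<mu> w s - Nu p \<mu> u s\<bar> \<le> L * \<bar>w - u\<bar>"
    if "\<gamma> \<le> u" "u \<le> B" "\<gamma> \<le> w" "w \<le> B" for u w s
  proof -
    have "norm (w powr (p - 1) - u powr (p - 1)) \<le> (p - 1) * (\<gamma> powr (p - 2) + B powr (p - 2)) * norm (w - u)"
    proof (rule field_differentiable_bound[of "{\<gamma>..B}" _ "\<lambda>x. (p - 1) * x powr (p - 2)"])
      fix x assume x: "x \<in> {\<gamma>..B}"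
      show "((\<lambda>u. u powr (p - 1)) has_real_derivative (p - 1) * x powr (p - 2)) (at x within {\<gamma>..B})"
        by (rule derivative_eq_intros refl | use x \<gamma> in simp)+
      have "x powr (p - 2) \<le> \<gamma> powr (p - 2) + B powr (p - 2)"
      proof (cases "p \<ge> 2")
        case True
        then have "x powr (p - 2) \<le> B powr (p - 2)" using x \<gamma> by (intro powr_mono2) auto
        then show ?thesis by (simp add: add_increasing)
      next
        case False
        then have "x powr (p - 2) \<le> \<gamma> powr (p - 2)" using x \<gamma> by (intro powr_mono2') auto
        then show ?thesis by (simp add: add_increasing2)
      qed
      then show "norm ((p - 1) * x powr (p - 2)) \<le> (p - 1) * (\<gamma> powr (p - 2) + B powr (p - 2))"
        using p by (simp add: abs_mult)
    qed (use that in auto)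
    then have "2 powr (-p) * p * \<bar>w powr (p - 1) - u powr (p - 1)\<bar> \<le> L * \<bar>w - u\<bar>"
      using p by (simp add: L_def mult.assoc mult_left_mono)
    moreover have "\<bar>Nu p \<mu> w s - Nu p \<mu> u s\<bar> = 2 powr (-p) * p * \<bar>w powr (p - 1) - u powr (p - 1)\<bar>"
    proof -
      have "Nu p \<mu> w s - Nu p \<mu> u s = 2 powr (-p) * p * (w powr (p - 1) - u powr (p - 1))"
        by (simp add: Nu_def right_diff_distrib)
      then show ?thesis using p by (simp add: abs_mult)
    qed
    ultimately show ?thesis by simp
  qed
  moreover have "L \<ge> 0" using p by (simp add: L_def)
  ultimately show ?thesis by blast
qed

end

section \<open>Oscillation decay at the blow-up curve\<close>

text \<open>Everything that the oscillation argument uses about the limit of the iterates. Since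
  \<open>v\<close> is only C^1, \<open>a \<sigma>\<close> is merely continuous and differentiable
  along its own characteristic; no second derivatives occur.\<close>

locale blowup_solution = nonlinearity +
  fixes \<theta> Rs :: real and v a :: "real \<Rightarrow> real \<Rightarrow> real \<Rightarrow> real" and T :: "real \<Rightarrow> real"
  assumes \<theta>: "0 < \<theta>" "\<theta> < 1"
    and T_pos: "\<bar>x\<bar> < Rs \<Longrightarrow> 0 < T x"
    and T_lipschitz: "\<bar>x\<bar> < Rs \<Longrightarrow> \<bar>y\<bar> < Rs \<Longrightarrow> \<bar>T x - T y\<bar> \<le> \<theta> * \<bar>x - y\<bar>"
    and v_has_derivative: "\<sigma> \<in> {1, -1} \<Longrightarrow> \<bar>x\<bar> < Rs \<Longrightarrow> 0 < t \<Longrightarrow> t < T x \<Longrightarrow>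
      ((\<lambda>(x, t). v \<sigma> x t) has_derivative
        (\<lambda>(h, k). h * a \<sigma> x t + k * (\<sigma> * a \<sigma> x t + Nl p \<mu> (v 1 x t + v (-1) x t) t))) (at (x, t))"
    and a_isCont: "\<sigma> \<in> {1, -1} \<Longrightarrow> \<bar>x\<bar> < Rs \<Longrightarrow> 0 < t \<Longrightarrow> t < T x \<Longrightarrow>
      isCont (\<lambda>(x, t). a \<sigma> x t) (x, t)"
    and a_has_derivative: "\<sigma> \<in> {1, -1} \<Longrightarrow> \<bar>x\<bar> < Rs \<Longrightarrow> 0 < t \<Longrightarrow> t < T x \<Longrightarrow>
      ((\<lambda>s. a \<sigma> (x + \<sigma> * (t - s)) s) has_real_derivative
        Nu p \<mu> (v 1 x t + v (-1) x t) t * (a 1 x t + a (-1) x t)) (at t)"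
    and a_le: "\<sigma> \<in> {1, -1} \<Longrightarrow> \<bar>x\<bar> < Rs \<Longrightarrow> 0 < t \<Longrightarrow> t < T x \<Longrightarrow>
      \<bar>a \<sigma> x t\<bar> \<le> \<theta> * (\<sigma> * a \<sigma> x t + Nl p \<mu> (v 1 x t + v (-1) x t) t)"
    and v_ge: "\<bar>x\<bar> < Rs \<Longrightarrow> 0 < t \<Longrightarrow> t < T x \<Longrightarrow> \<gamma> \<le> v 1 x t + v (-1) x t"
    and v_blowup: "\<bar>x\<bar> < Rs \<Longrightarrow> filterlim (\<lambda>t. v 1 x t + v (-1) x t) at_top (at_left (T x))"
begin

section \<open>Chain rules and the blow-up rate on vertical lines\<close>

definition u :: "real \<Rightarrow> real \<Rightarrow> real" where "u x t = v 1 x t + v (-1) x t"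
definition W :: "real \<Rightarrow> real \<Rightarrow> real" where "W x t = Nl p \<mu> (u x t) t"
definition vt :: "real \<Rightarrow> real \<Rightarrow> real \<Rightarrow> real" where "vt \<sigma> x t = \<sigma> * a \<sigma> x t + W x t"
definition inside :: "real \<Rightarrow> real \<Rightarrow> bool" where "inside x t \<longleftrightarrow> \<bar>x\<bar> < Rs \<and> 0 < t \<and> t < T x"

lemma u_ge: "inside x t \<Longrightarrow> \<gamma> \<le> u x t"
  using v_ge by (auto simp: inside_def u_def)

lemma u_pos: "inside x t \<Longrightarrow> 0 < u x t"
  using u_ge \<gamma> by fastforce

lemma W_bounds:
  assumes "inside x t"
  shows "2 powr (-p) * u x t powr p / 2 \<le> W x t" "W x t \<le> 2 powr (-p) * u x t powr p" "0 < W x t"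
  using Nl_bounds[OF u_ge[OF assms], of t] assms by (auto simp: W_def inside_def)

text \<open>The inequality \<open>a_le\<close> forces \<open>vt\<close> to be nonnegative, and then
  \<open>W = vt - \<sigma> * a\<close> lies between \<open>(1 - \<theta>) * vt\<close> and
  \<open>2 * vt\<close>.\<close>

lemma vt_bounds:
  assumes "inside x t" "\<sigma> \<in> {1, -1}"
  shows "\<bar>a \<sigma> x t\<bar> \<le> \<theta> * vt \<sigma> x t" "W x t / 2 \<le> vt \<sigma> x t" "vt \<sigma> x t \<le> W x t / (1 - \<theta>)"
    "0 < vt \<sigma> x t"
proof -
  show 1: "\<bar>a \<sigma> x t\<bar> \<le> \<theta> * vt \<sigma> x t"
    using a_le[of \<sigma> x t] assms by (auto simp: inside_def vt_def W_def u_def)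
  have s: "\<bar>\<sigma> * a \<sigma> x t\<bar> = \<bar>a \<sigma> x t\<bar>" using assms(2) by (auto simp: abs_mult)
  have W: "0 < W x t" using W_bounds assms by blast
  have 0: "0 \<le> vt \<sigma> x t"
  proof (rule ccontr)
    assume "\<not> 0 \<le> vt \<sigma> x t"
    then have "\<theta> * vt \<sigma> x t < 0" using \<theta> by (simp add: mult_less_0_iff)
    then show False using 1 by linarith
  qed
  have "\<theta> * vt \<sigma> x t \<le> 1 * vt \<sigma> x t" by (rule mult_right_mono) (use \<theta> 0 in auto)
  moreover have e: "vt \<sigma> x t = \<sigma> * a \<sigma> x t + W x t" by (simp add: vt_def)
  ultimately show 2: "W x t / 2 \<le> vt \<sigma> x t"
    using 1 s by linarith
  then show "0 < vt \<sigma> x t" using W by linarith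
  have "vt \<sigma> x t * (1 - \<theta>) \<le> W x t"
    using 1 s e by (simp add: algebra_simps)
  then show "vt \<sigma> x t \<le> W x t / (1 - \<theta>)" using \<theta> by (simp add: pos_le_divide_eq)
qed

lemma v_chain:
  assumes "\<sigma> \<in> {1, -1}" "inside (X s) (Y s)"
    and X: "(X has_real_derivative X') (at s)" and Y: "(Y has_real_derivative Y') (at s)"
  shows "((\<lambda>s. v \<sigma> (X s) (Y s)) has_real_derivative X' * a \<sigma> (X s) (Y s) + Y' * vt \<sigma> (X s) (Y s)) (at s)"
proof -
  have XY: "((\<lambda>s. (X s, Y s)) has_derivative (\<lambda>h. (X' * h, Y' * h))) (at s)"
    using X Y unfolding has_field_derivative_def by (rule has_derivative_Pair)
  have "((\<lambda>(x, t). v \<sigma> x t) has_derivative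
        (\<lambda>(h, k). h * a \<sigma> (X s) (Y s) + k * vt \<sigma> (X s) (Y s))) (at (X s, Y s))"
    using v_has_derivative[of \<sigma> "X s" "Y s"] assms by (auto simp: inside_def vt_def W_def u_def)
  from has_derivative_compose[OF XY this]
  have "((\<lambda>s. v \<sigma> (X s) (Y s)) has_derivative
      (\<lambda>h. X' * h * a \<sigma> (X s) (Y s) + Y' * h * vt \<sigma> (X s) (Y s))) (at s)"
    by simp
  then show ?thesis
    unfolding has_field_derivative_def
    by (rule has_derivative_eq_rhs) (simp add: fun_eq_iff algebra_simps)
qed

lemma u_chain:
  assumes "inside (X s) (Y s)"
    and "(X has_real_derivative X') (at s)" "(Y has_real_derivative Y') (at s)"
  shows "((\<lambda>s. u (X s) (Y s)) has_real_derivative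
     X' * (a 1 (X s) (Y s) + a (-1) (X s) (Y s)) + Y' * (vt 1 (X s) (Y s) + vt (-1) (X s) (Y s))) (at s)"
  unfolding u_def
  by (rule DERIV_cong[OF DERIV_add[OF v_chain[OF _ assms] v_chain[OF _ assms]]])
    (auto simp: algebra_simps)

lemma isCont_a: "inside x t \<Longrightarrow> \<sigma> \<in> {1, -1} \<Longrightarrow> isCont (\<lambda>z. a \<sigma> (fst z) (snd z)) (x, t)"
  using a_isCont[of \<sigma> x t] by (auto simp: inside_def case_prod_unfold)

lemma isCont_u: "inside x t \<Longrightarrow> isCont (\<lambda>z. u (fst z) (snd z)) (x, t)"
  using has_derivative_continuous[OF v_has_derivative[of 1 x t]]
    has_derivative_continuous[OF v_has_derivative[of "-1" x t]]
  by (auto simp: inside_def u_def case_prod_unfold intro!: continuous_intros)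

lemma isCont_vt:
  assumes "inside x t" "\<sigma> \<in> {1, -1}"
  shows "isCont (\<lambda>z. vt \<sigma> (fst z) (snd z)) (x, t)"
proof -
  have "u x t \<noteq> 0" "1 + t \<noteq> 0" using u_pos[OF assms(1)] assms(1) by (auto simp: inside_def)
  then show ?thesis
    unfolding vt_def W_def Nl_def using isCont_u[OF assms(1)] isCont_a[OF assms]
    by (auto intro!: continuous_intros)
qed

text \<open>Lower and upper bounds for the speed at which \<open>u powr (1 - p)\<close> decreases in
  time. They combine the factor \<open>p - 1\<close> from differentiation, \<open>W\<close> between
  one half and the whole of \<open>2 powr (-p) * u powr p\<close>, and \<open>vt 1 + vt (-1)\<close>
  between \<open>W\<close> and \<open>2 * W / (1 - \<theta>)\<close>.\<close>

definition c_rate :: real where "c_rate = (p - 1) * 2 powr (-p) / 2"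
definition C_rate :: real where "C_rate = (p - 1) * 2 powr (-p) * 2 / (1 - \<theta>)"

lemma c_rate_pos: "c_rate > 0" and C_rate_pos: "C_rate > 0"
  using p \<theta> by (auto simp: c_rate_def C_rate_def)

text \<open>The wave system is comparable to the ordinary differential equation \<open>u' = u\<^sup>p\<close> on each
  vertical line, since the space derivatives are dominated by the time derivatives.\<close>

lemma u_powr_rate:
  assumes "inside x t"
  shows "c_rate * (T x - t) \<le> u x t powr (1 - p)" "u x t powr (1 - p) \<le> C_rate * (T x - t)"
proof -
  define Y where "Y s = u x s powr (1 - p)" for s
  define Y' where "Y' s = (1 - p) * u x s powr (-p) * (vt 1 x s + vt (-1) x s)" for s
  have ins: "inside x s" if "t \<le> s" "s < T x" for s using assms that by (auto simp: inside_def)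
  have dY: "(Y has_real_derivative Y' s) (at s)" if "t \<le> s" "s < T x" for s
  proof -
    have "((\<lambda>s. u x s) has_real_derivative
     0 * (a 1 x s + a (-1) x s) + 1 * (vt 1 x s + vt (-1) x s)) (at s)"
      by (rule u_chain[of "\<lambda>_. x" s "\<lambda>s. s" 0 1]) (use ins[OF that] in auto)
    from DERIV_fun_powr[OF this u_pos[OF ins[OF that]], of "1 - p"]
    show ?thesis by (simp add: Y_def[abs_def] Y'_def)
  qed
  have Y'b: "- C_rate \<le> Y' s" "Y' s \<le> - c_rate" if "t \<le> s" "s < T x" for s
  proof -
    note i = ins[OF that]
    have up: "u x s > 0" using u_pos[OF i] .
    define V where "V = vt 1 x s + vt (-1) x s"
    define Q where "Q = 2 powr (-p) * u x s powr p"
    have V: "W x s \<le> V" "V \<le> 2 * (W x s / (1 - \<theta>))"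
      using vt_bounds[OF i, of 1] vt_bounds[OF i, of "-1"] by (auto simp: V_def)
    have "Q / 2 \<le> V" using V W_bounds[OF i] by (simp add: Q_def)
    then have "u x s powr (-p) * (Q / 2) \<le> u x s powr (-p) * V" by (rule mult_left_mono) simp
    moreover have "u x s powr (-p) * (Q / 2) = 2 powr (-p) / 2"
      using up by (simp add: Q_def powr_minus field_simps)
    ultimately have 1: "2 powr (-p) / 2 \<le> u x s powr (-p) * V" by simp
    have "W x s / (1 - \<theta>) \<le> Q / (1 - \<theta>)"
      using W_bounds[OF i] \<theta> by (intro divide_right_mono) (auto simp: Q_def)
    then have "V \<le> 2 * (Q / (1 - \<theta>))" using V by linarith
    then have "u x s powr (-p) * V \<le> u x s powr (-p) * (2 * (Q / (1 - \<theta>)))" by (rule mult_left_mono) simp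
    also have "\<dots> = 2 powr (-p) * 2 / (1 - \<theta>)"
      using up by (simp add: Q_def powr_minus field_simps)
    finally have 2: "u x s powr (-p) * V \<le> 2 powr (-p) * 2 / (1 - \<theta>)" .
    have e: "Y' s = - ((p - 1) * (u x s powr (-p) * V))" by (simp add: Y'_def V_def algebra_simps)
    have "(p - 1) * (2 powr (-p) / 2) = c_rate" "(p - 1) * (2 powr (-p) * 2 / (1 - \<theta>)) = C_rate"
      by (simp_all add: c_rate_def C_rate_def)
    then show "Y' s \<le> - c_rate" "- C_rate \<le> Y' s"
      using mult_left_mono[OF 1, of "p - 1"] mult_left_mono[OF 2, of "p - 1"] p unfolding e by simp_all
  qed
  have "((\<lambda>s. u x s powr (1 - p)) \<longlongrightarrow> 0) (at_left (T x))"
    using v_blowup[of x] assms p by (intro tendsto_neg_powr) (auto simp: inside_def u_def[abs_def])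
  then have lim: "(Y \<longlongrightarrow> 0) (at_left (T x))" by (simp add: Y_def[abs_def])
  have tT: "t < T x" using assms by (simp add: inside_def)
  have ev: "eventually (\<lambda>s. t < s \<and> s < T x) (at_left (T x))"
    using eventually_at_left_real[OF tT] by (rule eventually_mono) auto
  have m1: "Y s + c_rate * (s - t) \<le> Y t" and m2: "Y t \<le> Y s + C_rate * (s - t)" if "t < s" "s < T x" for s
  proof -
    have "(Y has_real_derivative Y' z) (at z)" if "t \<le> z" "z \<le> s" for z
      using dY[of z] that \<open>s < T x\<close> by simp
    from MVT2[OF \<open>t < s\<close> this]
    obtain z where z: "t < z" "z < s" "Y s - Y t = (s - t) * Y' z" by blast
    have "(s - t) * Y' z \<le> (s - t) * (- c_rate)"
      by (rule mult_left_mono) (use Y'b[of z] z that in auto)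
    moreover have "(s - t) * (- C_rate) \<le> (s - t) * Y' z"
      by (rule mult_left_mono) (use Y'b[of z] z that in auto)
    ultimately show "Y s + c_rate * (s - t) \<le> Y t" "Y t \<le> Y s + C_rate * (s - t)"
      using z(3) by (simp_all add: algebra_simps)
  qed
  have "((\<lambda>s. Y s + c_rate * (s - t)) \<longlongrightarrow> 0 + c_rate * (T x - t)) (at_left (T x))"
    by (intro tendsto_intros lim)
  then have "0 + c_rate * (T x - t) \<le> Y t"
    by (rule tendsto_upperbound) (auto intro!: eventually_mono[OF ev] m1)
  then show "c_rate * (T x - t) \<le> u x t powr (1 - p)" by (simp add: Y_def)
  have "((\<lambda>s. Y s + C_rate * (s - t)) \<longlongrightarrow> 0 + C_rate * (T x - t)) (at_left (T x))"
    by (intro tendsto_intros lim)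
  then have "Y t \<le> 0 + C_rate * (T x - t)"
    by (rule tendsto_lowerbound) (auto intro!: eventually_mono[OF ev] m2)
  then show "u x t powr (1 - p) \<le> C_rate * (T x - t)" by (simp add: Y_def)
qed

lemma u_powr_p_rate:
  assumes "inside x t" "0 < d1" "d1 \<le> T x - t" "T x - t \<le> d2"
  shows "u x t powr (p - 1) \<le> 1 / (c_rate * d1)" "1 / (C_rate * d2) \<le> u x t powr (p - 1)"
    "u x t powr p \<le> (1 / (c_rate * d1)) powr (p / (p - 1))" "(1 / (C_rate * d2)) powr (p / (p - 1)) \<le> u x t powr p"
proof -
  have up: "u x t > 0" using u_pos[OF assms(1)] .
  have e: "u x t powr (p - 1) = 1 / (u x t powr (1 - p))"
    using powr_minus_divide[of "u x t" "1 - p"] by simp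
  have P: "0 < u x t powr (1 - p)" using up by simp
  have "c_rate * d1 \<le> u x t powr (1 - p)"
    using u_powr_rate(1)[OF assms(1)] mult_left_mono[OF assms(3), of c_rate] c_rate_pos by linarith
  then show 1: "u x t powr (p - 1) \<le> 1 / (c_rate * d1)"
    unfolding e using c_rate_pos assms(2) P by (intro divide_left_mono) auto
  have "u x t powr (1 - p) \<le> C_rate * d2"
    using u_powr_rate(2)[OF assms(1)] mult_left_mono[OF assms(4), of C_rate] C_rate_pos by linarith
  then show 2: "1 / (C_rate * d2) \<le> u x t powr (p - 1)"
    unfolding e using C_rate_pos assms P by (intro divide_left_mono) auto
  have f: "u x t powr p = (u x t powr (p - 1)) powr (p / (p - 1))"
    using p by (simp add: powr_powr)
  show "u x t powr p \<le> (1 / (c_rate * d1)) powr (p / (p - 1))"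
    unfolding f using 1 p by (intro powr_mono2) auto
  show "(1 / (C_rate * d2)) powr (p / (p - 1)) \<le> u x t powr p"
    unfolding f using 2 p C_rate_pos assms by (intro powr_mono2) auto
qed

text \<open>The linearised quantity whose sign decides whether the level sets of \<open>u\<close> have slope at
  most \<open>M\<close> (for \<open>\<tau> = 1\<close>) or at least \<open>-M\<close> (for \<open>\<tau> = -1\<close>).  The drift \<open>2 * (t - t0)\<close> absorbs the
  explicit time dependence of the damping.\<close>

definition E :: "real \<Rightarrow> real \<Rightarrow> real \<Rightarrow> real \<Rightarrow> real \<Rightarrow> real \<Rightarrow> real" where
  "E \<tau> M t0 \<sigma> x t = \<tau> * a \<sigma> x t + (M + 2 * (t - t0)) * vt \<sigma> x t"

text \<open>Both \<open>a\<close> and \<open>vt\<close> satisfy the linearised equation along the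
  characteristic, up to the source \<open>Ns\<close> for \<open>vt\<close>. What remains beside the
  coupling is \<open>2 * vt\<close>, from the drift, plus \<open>Ns\<close> times a factor at least
  -1; it is nonnegative because \<open>Ns \<le> W \<le> 2 * vt\<close>. This is where
  \<open>-1 \<le> M\<close> comes from.\<close>

lemma E_has_derivative:
  assumes i: "inside x t" and \<sigma>: "\<sigma> \<in> {1, -1}" and M: "-1 \<le> M" "t0 \<le> t"
  shows "\<exists>D. ((\<lambda>s. E \<tau> M t0 \<sigma> (x + \<sigma> * (t - s)) s) has_real_derivative D) (at t) \<and>
     Nu p \<mu> (u x t) t * (E \<tau> M t0 1 x t + E \<tau> M t0 (-1) x t) \<le> D"
proof -
  define N' where "N' = Nu p \<mu> (u x t) t"
  define A where "A = a 1 x t + a (-1) x t"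
  define V where "V = vt 1 x t + vt (-1) x t"
  define m where "m = M + 2 * (t - t0)"
  define n where "n = Ns \<mu> (u x t) t"
  have da: "((\<lambda>s. a \<sigma> (x + \<sigma> * (t - s)) s) has_real_derivative N' * A) (at t)"
    using a_has_derivative[OF \<sigma>, of x t] i by (simp add: inside_def N'_def A_def u_def)
  have "((\<lambda>s. u (x + \<sigma> * (t - s)) s) has_real_derivative - \<sigma> * A + 1 * V) (at t)"
  proof -
    have "((\<lambda>s. x + \<sigma> * (t - s)) has_real_derivative - \<sigma>) (at t)"
      by (auto intro!: derivative_eq_intros)
    then show ?thesis
      using u_chain[of "\<lambda>s. x + \<sigma> * (t - s)" t "\<lambda>s. s" "- \<sigma>" 1] i
      by (simp add: A_def V_def)
  qed
  from has_real_derivative_Nl[OF this, of p \<mu>] u_pos[OF i] i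
  have dW: "((\<lambda>s. W (x + \<sigma> * (t - s)) s) has_real_derivative N' * (- \<sigma> * A + V) + n) (at t)"
    by (simp add: W_def N'_def inside_def n_def)
  have "((\<lambda>s. vt \<sigma> (x + \<sigma> * (t - s)) s) has_real_derivative \<sigma> * (N' * A) + (N' * (- \<sigma> * A + V) + n)) (at t)"
    unfolding vt_def by (intro DERIV_add DERIV_cmult da dW)
  \<comment> \<open>The space derivative of \<open>u\<close>, picked up by moving along the
    characteristic, cancels the contribution of \<sigma> times the derivative of \<open>a\<close>;
    only the time derivative \<open>V\<close> of \<open>u\<close> remains.\<close>
  then have dvt: "((\<lambda>s. vt \<sigma> (x + \<sigma> * (t - s)) s) has_real_derivative N' * V + n) (at t)"
    by (rule DERIV_cong) (simp add: algebra_simps)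
  have dm: "((\<lambda>s. M + 2 * (s - t0)) has_real_derivative 2) (at t)"
    by (auto intro!: derivative_eq_intros)
  have "((\<lambda>s. E \<tau> M t0 \<sigma> (x + \<sigma> * (t - s)) s) has_real_derivative
      \<tau> * (N' * A) + (2 * vt \<sigma> (x + \<sigma> * (t - t)) t + (N' * V + n) * m)) (at t)"
    unfolding E_def m_def by (intro DERIV_add DERIV_cmult da DERIV_mult dm dvt)
  moreover have "N' * (E \<tau> M t0 1 x t + E \<tau> M t0 (-1) x t) = \<tau> * (N' * A) + N' * V * m"
    by (simp add: E_def A_def V_def m_def algebra_simps)
  moreover have "0 \<le> 2 * vt \<sigma> x t + n * m"
  proof -
    have n: "0 \<le> n" "n \<le> W x t" using Ns_bounds[OF u_ge[OF i], of t] i by (auto simp: n_def W_def inside_def)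
    have "n * (-1) \<le> n * m" by (rule mult_left_mono) (use n M in \<open>auto simp: m_def\<close>)
    moreover have "W x t / 2 \<le> vt \<sigma> x t" using vt_bounds(2)[OF i \<sigma>] .
    ultimately show ?thesis using n by linarith
  qed
  ultimately show ?thesis
    unfolding N'_def[symmetric] by (intro exI conjI) (assumption, simp add: algebra_simps)
qed

lemma isCont_E:
  assumes "inside x t" "\<sigma> \<in> {1, -1}"
  shows "isCont (\<lambda>z. E \<tau> M t0 \<sigma> (fst z) (snd z)) (x, t)"
  unfolding E_def using isCont_a[OF assms] isCont_vt[OF assms]
  by (auto intro!: continuous_intros)

section \<open>Trapezoids below the blow-up curve\<close>

definition \<kappa> :: real where "\<kappa> = (1 - \<theta>) / 2"

lemma \<kappa>: "0 < \<kappa>" "\<kappa> < 1 / 2" "\<theta> * (1 + \<kappa>) \<le> 1 - \<kappa>"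
proof -
  show "0 < \<kappa>" "\<kappa> < 1 / 2" using \<theta> by (auto simp: \<kappa>_def)
  then have "\<theta> * \<kappa> \<le> 1 * \<kappa>" by (intro mult_right_mono) (use \<theta> in auto)
  then show "\<theta> * (1 + \<kappa>) \<le> 1 - \<kappa>" by (simp add: algebra_simps) (simp add: \<kappa>_def field_simps)
qed

text \<open>\<open>\<kappa>\<close> is chosen so that the trapezoid \<open>Dom x0 r\<close> is closed under backward characteristics and its
  base at time \<open>T x0 - r\<close> stays at distance at least \<open>\<kappa> * r\<close> below the blow-up curve.\<close>

definition good :: "real \<Rightarrow> real \<Rightarrow> bool" where
  "good x0 r \<longleftrightarrow> 0 < r \<and> r < T x0 \<and> \<bar>x0\<bar> + 2 * r < Rs"

definition Dom :: "real \<Rightarrow> real \<Rightarrow> real \<Rightarrow> real \<Rightarrow> bool" where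
  "Dom x0 r x t \<longleftrightarrow> T x0 - r \<le> t \<and> t < T x \<and> \<bar>x - x0\<bar> + (t - T x0) \<le> \<kappa> * r"

lemma \<kappa>_r: "good x0 r \<Longrightarrow> 0 < \<kappa> * r \<and> \<kappa> * r < r / 2"
  using \<kappa> mult_strict_right_mono[of \<kappa> "1/2" r] by (auto simp: good_def)

lemma Dom_inside:
  assumes "good x0 r" "Dom x0 r x t"
  shows "inside x t" "\<bar>x - x0\<bar> \<le> (1 + \<kappa>) * r" "T x - t \<le> 2 * r"
proof -
  show 1: "\<bar>x - x0\<bar> \<le> (1 + \<kappa>) * r" using assms(2) by (simp add: Dom_def algebra_simps)
  also have 2: "(1 + \<kappa>) * r < 2 * r" using \<kappa>(2) assms(1) by (simp add: good_def)
  finally have x: "\<bar>x\<bar> < Rs" using assms(1) by (auto simp: good_def)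
  then show "inside x t" using assms by (auto simp: inside_def Dom_def good_def)
  have "T x - T x0 \<le> \<theta> * \<bar>x - x0\<bar>" using T_lipschitz[OF x, of x0] assms(1) by (auto simp: good_def)
  also have "\<dots> \<le> \<theta> * ((1 + \<kappa>) * r)" using 1 \<theta> by (intro mult_left_mono) auto
  also have "\<dots> = \<theta> * (1 + \<kappa>) * r" by simp
  also have "\<dots> \<le> 1 * r" using \<kappa> assms(1) by (intro mult_right_mono) (auto simp: good_def)
  finally show "T x - t \<le> 2 * r" using assms(2) by (simp add: Dom_def)
qed

text \<open>Since \<open>T\<close> is Lipschitz with constant \<theta> < 1, going back in time by
  \<open>t - s\<close> and sideways by at most as much cannot cross the graph of
  \<open>T\<close>.\<close>

lemma Dom_backward:
  assumes "good x0 r" "Dom x0 r x t" "T x0 - r \<le> s" "s \<le> t" "\<bar>y - x\<bar> \<le> t - s"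
  shows "Dom x0 r y s"
proof -
  have "\<bar>y - x0\<bar> \<le> \<bar>x - x0\<bar> + (t - s)" using assms(5) by linarith
  then have 1: "\<bar>y - x0\<bar> + (s - T x0) \<le> \<kappa> * r" using assms(2) by (simp add: Dom_def)
  then have "\<bar>y - x0\<bar> < 2 * r" using \<kappa>_r[OF assms(1)] assms(1,3) by (simp add: good_def)
  then have y: "\<bar>y\<bar> < Rs" using assms(1) by (auto simp: good_def)
  have x: "\<bar>x\<bar> < Rs" using Dom_inside(1)[OF assms(1,2)] by (simp add: inside_def)
  have "T x - T y \<le> \<bar>T y - T x\<bar>" by simp
  also have "\<dots> \<le> \<theta> * \<bar>y - x\<bar>" by (rule T_lipschitz[OF y x])
  also have "\<dots> \<le> 1 * \<bar>y - x\<bar>" by (rule mult_right_mono) (use \<theta> in auto)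
  also have "\<dots> \<le> t - s" using assms(5) by simp
  finally have "T x - T y \<le> t - s" .
  then have "s < T y" using assms(2)[unfolded Dom_def, THEN conjunct2, THEN conjunct1] by linarith
  then show ?thesis using 1 assms(3) by (simp add: Dom_def)
qed

lemma char_le: "\<sigma> \<in> {1, -1} \<Longrightarrow> s \<le> t \<Longrightarrow> \<bar>x + \<sigma> * (t - s) - x\<bar> \<le> t - (s::real)"
  by (auto simp: abs_mult)

lemma Dom_base:
  assumes "good x0 r" "\<bar>x - x0\<bar> \<le> (1 + \<kappa>) * r"
  shows "Dom x0 r x (T x0 - r)" "\<kappa> * r \<le> T x - (T x0 - r)"
proof -
  have "(1 + \<kappa>) * r < 2 * r" using \<kappa>(2) assms(1) by (simp add: good_def)
  then have "\<bar>x - x0\<bar> < 2 * r" using assms(2) by linarith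
  then have x: "\<bar>x\<bar> < Rs" using assms(1) by (auto simp: good_def)
  have "T x0 - T x \<le> \<theta> * \<bar>x - x0\<bar>" using T_lipschitz[OF x, of x0] assms(1) by (auto simp: good_def)
  also have "\<dots> \<le> \<theta> * ((1 + \<kappa>) * r)" using assms(2) \<theta> by (intro mult_left_mono) auto
  also have "\<dots> = \<theta> * (1 + \<kappa>) * r" by simp
  also have "\<dots> \<le> (1 - \<kappa>) * r" using \<kappa> assms(1) by (intro mult_right_mono) (auto simp: good_def)
  finally show "\<kappa> * r \<le> T x - (T x0 - r)" by (simp add: algebra_simps)
  then have "T x0 - r < T x" using \<kappa>_r[OF assms(1)] by linarith
  then show "Dom x0 r x (T x0 - r)" using assms(2) by (simp add: Dom_def algebra_simps)
qed

section \<open>Propagation of sign and spreading of mass along characteristics\<close>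

text \<open>Every point of the backward light cone of \<open>(x, t)\<close> is at least
  \<open>T x - t\<close> below the blow-up curve, so the coupling \<open>Nu\<close> is bounded there
  and \<open>characteristic_positivity\<close> applies. The bound \<open>L\<close> degenerates near
  the curve, which is harmless because only a sign is propagated.\<close>

lemma E_nonneg_propagates:
  assumes g: "good x0 r" and M: "-1 \<le> M" and t0: "t0 = T x0 - r"
    and base: "\<And>\<sigma> x. \<sigma> \<in> {1, -1} \<Longrightarrow> \<bar>x - x0\<bar> \<le> (1 + \<kappa>) * r \<Longrightarrow> 0 \<le> E \<tau> M t0 \<sigma> x t0"
    and D: "Dom x0 r x t" and \<sigma>: "\<sigma> \<in> {1, -1}"
  shows "0 \<le> E \<tau> M t0 \<sigma> x t"
proof -
  define d where "d = T x - t"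
  have d: "0 < d" using D by (simp add: d_def Dom_def)
  define L where "L = p * 2 powr (-p) * (1 / (c_rate * d))"
  have Dy: "Dom x0 r y s" if "t0 \<le> s" "s \<le> t" "\<bar>y - x\<bar> \<le> t - s" for y s
    using Dom_backward[OF g D] that by (simp add: t0)
  have ins: "inside y s" if "t0 \<le> s" "s \<le> t" "\<bar>y - x\<bar> \<le> t - s" for y s
    using Dom_inside(1)[OF g Dy[OF that]] .
  show ?thesis
  proof (rule characteristic_positivity[where ?x1.0 = x and ?t1.0 = t and ?t0.0 = t0 and L = L and E = "E \<tau> M t0"])
    show "t0 \<le> t" using D by (simp add: Dom_def t0)
    show "0 \<le> L" using p d c_rate_pos by (simp add: L_def)
    show "continuous_on {(y, s). t0 \<le> s \<and> s \<le> t \<and> \<bar>y - x\<bar> \<le> t - s} (\<lambda>(x, t). E \<tau> M t0 \<rho> x t)"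
      if "\<rho> \<in> {1, -1}" for \<rho>
      by (rule continuous_at_imp_continuous_on)
        (use isCont_E[OF ins that] in \<open>auto simp: case_prod_unfold\<close>)
    show "0 \<le> E \<tau> M t0 \<rho> y t0" if "\<rho> \<in> {1, -1}" "\<bar>y - x\<bar> \<le> t - t0" for \<rho> y
    proof (rule base[OF that(1)])
      have "t0 \<le> t" using D by (simp add: Dom_def t0)
      from Dom_inside(2)[OF g Dy[OF order_refl this that(2)]] show "\<bar>y - x0\<bar> \<le> (1 + \<kappa>) * r" .
    qed
    show "\<exists>D. ((\<lambda>s'. E \<tau> M t0 \<rho> (y + \<rho> * (s - s')) s') has_real_derivative D) (at s) \<and>
        L * min 0 (E \<tau> M t0 1 y s + E \<tau> M t0 (-1) y s) \<le> D"
      if \<rho>: "\<rho> \<in> {1, -1}" and ys: "(y, s) \<in> {(y, s). t0 \<le> s \<and> s \<le> t \<and> \<bar>y - x\<bar> \<le> t - s}" and "t0 < s" for \<rho> y s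
    proof -
      have i: "inside y s" using ins ys by auto
      have "\<bar>T y - T x\<bar> \<le> \<theta> * \<bar>y - x\<bar>"
        using T_lipschitz[of y x] i Dom_inside(1)[OF g D] by (simp add: inside_def)
      also have "\<dots> \<le> 1 * \<bar>y - x\<bar>" by (rule mult_right_mono) (use \<theta> in auto)
      finally have "d \<le> T y - s" using ys by (auto simp: d_def)
      from u_powr_p_rate(1)[OF i d this order_refl]
      have "p * 2 powr (-p) * u y s powr (p - 1) \<le> L" unfolding L_def
        by (rule mult_left_mono) (use p in auto)
      then have N: "0 \<le> Nu p \<mu> (u y s) s" "Nu p \<mu> (u y s) s \<le> L"
        using Nu_bounds(2,3)[OF u_ge[OF i], of s] i by (auto simp: inside_def)
      define Z where "Z = E \<tau> M t0 1 y s + E \<tau> M t0 (-1) y s"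
      have "L * min 0 Z \<le> Nu p \<mu> (u y s) s * Z"
      proof (cases "Z \<ge> 0")
        case False
        then show ?thesis using N by (auto intro: mult_right_mono_neg)
      qed (use N in auto)
      then show ?thesis
        using E_has_derivative[OF i \<rho> M, of t0 \<tau>] \<open>t0 < s\<close> unfolding Z_def by fastforce
    qed
  qed (use \<sigma> in auto)
qed

definition kN :: real where "kN = 2 powr (-p) / (4 * C_rate)"

lemma kN_pos: "kN > 0" using C_rate_pos by (simp add: kN_def)

text \<open>Points of the trapezoid are at most \<open>2 * r\<close> below the blow-up curve, so the
  rate of \<open>u\<close> makes the coupling at least of order \<open>1 / r\<close>. Over a time of
  order \<open>r\<close> its effect is thus independent of the scale.\<close>

lemma Nu_ge:
  assumes "good x0 r" "Dom x0 r x t"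
  shows "kN / r \<le> Nu p \<mu> (u x t) t"
proof -
  note i = Dom_inside[OF assms]
  have r: "0 < r" using assms by (simp add: good_def)
  have "1 / (C_rate * (2 * r)) \<le> u x t powr (p - 1)"
    by (rule u_powr_p_rate(2)[OF i(1) _ order_refl i(3)]) (use i(1) in \<open>auto simp: inside_def\<close>)
  then have "2 powr (-p) / 2 * (1 / (C_rate * (2 * r))) \<le> 2 powr (-p) / 2 * u x t powr (p - 1)"
    by (rule mult_left_mono) simp
  also have "\<dots> \<le> Nu p \<mu> (u x t) t"
    using Nu_bounds(1)[OF u_ge[OF i(1)], of t] i(1) by (simp add: inside_def)
  finally show ?thesis using r C_rate_pos by (simp add: kN_def field_simps)
qed

text \<open>A comparison function \<open>G\<close> replaces integration of \<open>E\<close> along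
  the characteristic: any \<open>G\<close> growing no faster than the minorised coupling bounds the
  growth of \<open>E\<close> from below. It is used with \<open>G\<close> zero, a primitive of the
  initial mass, and a linear function.\<close>

lemma E_char_growth:
  assumes g: "good x0 r" and M: "-1 \<le> M" and t0: "t0 = T x0 - r"
    and nonneg: "\<And>\<sigma> x t. \<sigma> \<in> {1, -1} \<Longrightarrow> Dom x0 r x t \<Longrightarrow> 0 \<le> E \<tau> M t0 \<sigma> x t"
    and D: "Dom x0 r x t" and \<sigma>: "\<sigma> \<in> {1, -1}" and s0: "t0 \<le> s0" "s0 \<le> t"
    and contG: "continuous_on {s0..t} G"
    and derivG: "\<And>s. s0 < s \<Longrightarrow> s < t \<Longrightarrow> (G has_real_derivative G' s) (at s)"
    and leG: "\<And>s. s0 < s \<Longrightarrow> s < t \<Longrightarrow>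
      G' s \<le> kN / r * (E \<tau> M t0 1 (x + \<sigma> * (t - s)) s + E \<tau> M t0 (-1) (x + \<sigma> * (t - s)) s)"
  shows "G t - G s0 \<le> E \<tau> M t0 \<sigma> x t - E \<tau> M t0 \<sigma> (x + \<sigma> * (t - s0)) s0"
proof -
  define h where "h s = E \<tau> M t0 \<sigma> (x + \<sigma> * (t - s)) s - G s" for s
  have Dy: "Dom x0 r (x + \<sigma> * (t - s)) s" if "s0 \<le> s" "s \<le> t" for s
    using Dom_backward[OF g D _ that(2) char_le[OF \<sigma> that(2)]] that s0 by (simp add: t0)
  note ins = Dom_inside(1)[OF g Dy]
  have "h s0 \<le> h t"
  proof (rule DERIV_nonneg_imp_increasing_open[of s0 t h])
    show "s0 \<le> t" by fact
    have "continuous_on {s0..t} (\<lambda>s. E \<tau> M t0 \<sigma> (x + \<sigma> * (t - s)) s)"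
    proof (rule continuous_at_imp_continuous_on, rule ballI)
      fix s assume "s \<in> {s0..t}"
      then have "isCont (\<lambda>z. E \<tau> M t0 \<sigma> (fst z) (snd z)) (x + \<sigma> * (t - s), s)"
        using isCont_E[OF ins \<sigma>] by simp
      then show "isCont (\<lambda>s. E \<tau> M t0 \<sigma> (x + \<sigma> * (t - s)) s) s"
        using isCont_o2[where f = "\<lambda>s. (x + \<sigma> * (t - s), s)" and a = s and g = "\<lambda>z. E \<tau> M t0 \<sigma> (fst z) (snd z)"]
        by (auto intro!: continuous_intros)
    qed
    then show "continuous_on {s0..t} h"
      unfolding h_def by (intro continuous_intros contG)
    fix s assume s: "s0 < s" "s < t"
    have eq: "x + \<sigma> * (t - s) + \<sigma> * (s - s') = x + \<sigma> * (t - s')" for s'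
      by (simp add: algebra_simps)
    define Z where "Z = E \<tau> M t0 1 (x + \<sigma> * (t - s)) s + E \<tau> M t0 (-1) (x + \<sigma> * (t - s)) s"
    have Ds: "Dom x0 r (x + \<sigma> * (t - s)) s" using Dy s by simp
    obtain D where D: "((\<lambda>s'. E \<tau> M t0 \<sigma> (x + \<sigma> * (t - s')) s') has_real_derivative D) (at s)"
      "Nu p \<mu> (u (x + \<sigma> * (t - s)) s) s * Z \<le> D"
      using E_has_derivative[OF Dom_inside(1)[OF g Ds] \<sigma> M, of t0 \<tau>] s s0 unfolding eq Z_def by auto
    have "0 \<le> Z" unfolding Z_def using nonneg[OF _ Ds] by (simp add: add_nonneg_nonneg)
    then have "kN / r * Z \<le> Nu p \<mu> (u (x + \<sigma> * (t - s)) s) s * Z"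
      by (intro mult_right_mono Nu_ge[OF g Ds])
    then have "G' s \<le> D" using leG[OF s] D(2) unfolding Z_def by linarith
    moreover have "(h has_real_derivative D - G' s) (at s)"
      unfolding h_def by (intro DERIV_diff D(1) derivG s)
    ultimately show "\<exists>y. (h has_real_derivative y) (at s) \<and> 0 \<le> y" by (auto intro!: exI)
  qed
  then show ?thesis by (simp add: h_def)
qed

lemma E_char_mono:
  assumes "good x0 r" "-1 \<le> M" "t0 = T x0 - r"
    and nonneg: "\<And>\<sigma> x t. \<sigma> \<in> {1, -1} \<Longrightarrow> Dom x0 r x t \<Longrightarrow> 0 \<le> E \<tau> M t0 \<sigma> x t"
    and D: "Dom x0 r x t" and \<sigma>: "\<sigma> \<in> {1, -1}" and s0: "t0 \<le> s0" "s0 \<le> t"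
  shows "E \<tau> M t0 \<sigma> (x + \<sigma> * (t - s0)) s0 \<le> E \<tau> M t0 \<sigma> x t"
proof -
  have "(\<lambda>_. 0::real) t - (\<lambda>_. 0) s0 \<le> E \<tau> M t0 \<sigma> x t - E \<tau> M t0 \<sigma> (x + \<sigma> * (t - s0)) s0"
  proof (rule E_char_growth[OF assms(1-3) nonneg D \<sigma> s0, where G' = "\<lambda>_. 0"])
    fix s assume s: "s0 < s" "s < t"
    have Ds: "Dom x0 r (x + \<sigma> * (t - s)) s"
      using Dom_backward[OF assms(1) D _ _ char_le[OF \<sigma>]] s s0 by (simp add: assms(3))
    have "0 < r" using assms(1) by (simp add: good_def)
    then show "0 \<le> kN / r * (E \<tau> M t0 1 (x + \<sigma> * (t - s)) s + E \<tau> M t0 (-1) (x + \<sigma> * (t - s)) s)"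
      using nonneg[OF _ Ds] kN_pos by (simp add: add_nonneg_nonneg)
  qed auto
  then show ?thesis by simp
qed

text \<open>Harnack-type step: each family of characteristics sweeps over the initial segment of the
  other one, so the mass of one component at time \<open>t0\<close> bounds both components later from below.\<close>

lemma E_harnack:
  assumes g: "good x0 r" and M: "-1 \<le> M" and t0: "t0 = T x0 - r"
    and nonneg: "\<And>\<sigma> x t. \<sigma> \<in> {1, -1} \<Longrightarrow> Dom x0 r x t \<Longrightarrow> 0 \<le> E \<tau> M t0 \<sigma> x t"
    and \<sigma>0: "\<sigma>0 \<in> {1, -1}"
    and J: "J = integral {x0 - r / 2..x0 + r / 2} (\<lambda>y. E \<tau> M t0 \<sigma>0 y t0)"
    and D: "Dom x0 r x t" and far: "\<bar>x - x0\<bar> + 3 / 4 * r \<le> t - t0" and \<sigma>: "\<sigma> \<in> {1, -1}"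
  shows "min (kN / 2) (kN\<^sup>2 / 16) / r * J \<le> E \<tau> M t0 \<sigma> x t"
proof -
  define e where "e y = E \<tau> M t0 \<sigma>0 y t0" for y
  have r: "0 < r" using g by (simp add: good_def)
  define A B where "A = x0 - (1 + \<kappa>) * r" and "B = x0 + (1 + \<kappa>) * r"
  have AB: "\<bar>y - x0\<bar> \<le> (1 + \<kappa>) * r" if "y \<in> {A..B}" for y using that by (auto simp: A_def B_def)
  have Db: "Dom x0 r y t0" if "y \<in> {A..B}" for y
    using Dom_base(1)[OF g AB[OF that]] by (simp add: t0)
  have e0: "0 \<le> e y" if "y \<in> {A..B}" for y
    using nonneg[OF \<sigma>0 Db[OF that]] by (simp add: e_def)
  have ce: "continuous_on {A..B} e"
  proof (rule continuous_at_imp_continuous_on, rule ballI)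
    fix y assume "y \<in> {A..B}"
    then have "isCont (\<lambda>z. E \<tau> M t0 \<sigma>0 (fst z) (snd z)) (y, t0)"
      using isCont_E[OF Dom_inside(1)[OF g Db] \<sigma>0] by simp
    then show "isCont e y"
      using isCont_o2[where f = "\<lambda>y. (y, t0)" and a = y and g = "\<lambda>z. E \<tau> M t0 \<sigma>0 (fst z) (snd z)"]
      by (auto intro!: continuous_intros simp: e_def[abs_def])
  qed
  define P where "P y = integral {A..y} e" for y
  have I: "{x0 - r / 2..x0 + r / 2} \<subseteq> {A..B}"
    using mult_nonneg_nonneg[of \<kappa> r] \<kappa> r by (auto simp: A_def B_def algebra_simps)
  have int: "e integrable_on {y..z}" if "A \<le> y" "z \<le> B" for y z
    by (rule integrable_continuous_interval, rule continuous_on_subset[OF ce]) (use that in auto)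
  have J0: "0 \<le> J"
    unfolding J using e0 I by (intro integral_nonneg) (use int[of "x0 - r/2" "x0 + r/2"] I r in \<open>auto simp: e_def[abs_def]\<close>)
  have other: "kN / (2 * r) * J \<le> E \<tau> M t0 (- \<sigma>0) x t"
    if D: "Dom x0 r x t" and far: "\<bar>x - x0\<bar> + r / 2 \<le> t - t0" for x t
  proof -
    have tt: "t0 \<le> t" using far r by linarith
    have \<sigma>1: "- \<sigma>0 \<in> {1, -1}" using \<sigma>0 by auto
    have range: "\<bar>x - x0\<bar> + (t - t0) \<le> (1 + \<kappa>) * r" using D by (simp add: Dom_def t0 algebra_simps)
    \<comment> \<open>The foot at time \<open>t0\<close> of the
      \<open>\<sigma>0\<close>-characteristic through the point reached at time \<open>s\<close> on
      the opposite characteristic ending at \<open>(x, t)\<close>. It moves with speed 2 from one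
      end of the base of the light cone of \<open>(x, t)\<close> to the other, and by
      \<open>far\<close> this base contains the interval of \<open>J\<close>.\<close>
    define Y where "Y s = x + \<sigma>0 * (2 * s - t - t0)" for s
    have Ylt: "Y s \<in> {A<..<B}" if "t0 < s" "s < t" for s
      using \<sigma>0 that range by (auto simp: Y_def A_def B_def)
    have Yle: "Y s \<in> {A..B}" if "t0 \<le> s" "s \<le> t" for s
      using \<sigma>0 that range by (auto simp: Y_def A_def B_def)
    have dP: "(P has_real_derivative e y) (at y within {A..B})" if "y \<in> {A..B}" for y
      unfolding P_def by (rule integral_has_real_derivative[OF ce that])
    \<comment> \<open>The extra 2 in the denominator compensates the speed 2 of \<open>Y\<close>,
      and \<open>\<sigma>0\<close> its direction; \<open>G\<close> thus collects the initial mass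
      over the whole base.\<close>
    define G where "G s = kN / (2 * r) * \<sigma>0 * P (Y s)" for s
    have "G t - G t0 \<le> E \<tau> M t0 (- \<sigma>0) x t - E \<tau> M t0 (- \<sigma>0) (x + (- \<sigma>0) * (t - t0)) t0"
    proof (rule E_char_growth[OF g M t0 nonneg D \<sigma>1 order_refl tt, where G' = "\<lambda>s. kN / r * e (Y s)"])
      have cP: "continuous_on {A..B} P"
        using dP DERIV_continuous_on by blast
      show "continuous_on {t0..t} G"
        unfolding G_def
        by (intro continuous_on_mult continuous_on_const continuous_on_compose2[OF cP])
          (use Yle in \<open>auto simp: Y_def intro!: continuous_intros\<close>)
      fix s assume s: "t0 < s" "s < t"
      have "(P has_real_derivative e (Y s)) (at (Y s))"
        using dP[OF Yle[of s]] s at_within_Icc_at[of A "Y s" B] Ylt[OF s] by auto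
      moreover have dY: "(Y has_real_derivative \<sigma>0 * 2) (at s)"
        unfolding Y_def by (auto intro!: derivative_eq_intros)
      ultimately have "((\<lambda>s. P (Y s)) has_real_derivative e (Y s) * (\<sigma>0 * 2)) (at s)"
        by (rule DERIV_chain2)
      then have "(G has_real_derivative kN / (2 * r) * \<sigma>0 * (e (Y s) * (\<sigma>0 * 2))) (at s)"
        unfolding G_def by (rule DERIV_cmult)
      then show "(G has_real_derivative kN / r * e (Y s)) (at s)"
        by (rule DERIV_cong) (use \<sigma>0 r in \<open>auto simp: field_simps\<close>)
      define z where "z = x + (- \<sigma>0) * (t - s)"
      have Dz: "Dom x0 r z s"
        unfolding z_def using Dom_backward[OF g D _ _ char_le[OF \<sigma>1]] s by (simp add: t0)
      have "E \<tau> M t0 \<sigma>0 (z + \<sigma>0 * (s - t0)) t0 \<le> E \<tau> M t0 \<sigma>0 z s"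
        by (rule E_char_mono[OF g M t0 nonneg Dz \<sigma>0 order_refl]) (use s in auto)
      moreover have "z + \<sigma>0 * (s - t0) = Y s" by (simp add: z_def Y_def algebra_simps)
      ultimately have "e (Y s) \<le> E \<tau> M t0 \<sigma>0 z s" by (simp add: e_def)
      also have "\<dots> \<le> E \<tau> M t0 1 z s + E \<tau> M t0 (-1) z s"
        using nonneg[OF _ Dz] \<sigma>0 by auto
      finally show "kN / r * e (Y s) \<le> kN / r * (E \<tau> M t0 1 (x + (- \<sigma>0) * (t - s)) s + E \<tau> M t0 (-1) (x + (- \<sigma>0) * (t - s)) s)"
        unfolding z_def by (intro mult_left_mono) (use kN_pos r in auto)
    qed
    moreover have "0 \<le> E \<tau> M t0 (- \<sigma>0) (x + (- \<sigma>0) * (t - t0)) t0"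
      by (rule nonneg[OF \<sigma>1]) (use Dom_backward[OF g D _ tt char_le[OF \<sigma>1 tt]] in \<open>simp add: t0\<close>)
    ultimately have "G t - G t0 \<le> E \<tau> M t0 (- \<sigma>0) x t" by linarith
    moreover have "G t - G t0 = kN / (2 * r) * (P (x + (t - t0)) - P (x - (t - t0)))"
      using \<sigma>0 by (auto simp: G_def Y_def algebra_simps)
    moreover have "J \<le> P (x + (t - t0)) - P (x - (t - t0))"
    proof -
      have b: "A \<le> x - (t - t0)" "x + (t - t0) \<le> B" using range by (auto simp: A_def B_def)
      have "P (x - (t - t0)) + integral {x - (t - t0)..x + (t - t0)} e = P (x + (t - t0))"
        unfolding P_def by (rule Henstock_Kurzweil_Integration.integral_combine) (use b tt int in auto)
      moreover have "J \<le> integral {x - (t - t0)..x + (t - t0)} e"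
        unfolding J e_def[symmetric]
        by (rule integral_subset_le) (use far b e0 int I r in auto)
      ultimately show ?thesis by simp
    qed
    then have "kN / (2 * r) * J \<le> kN / (2 * r) * (P (x + (t - t0)) - P (x - (t - t0)))"
      by (rule mult_left_mono) (use kN_pos r in auto)
    ultimately show ?thesis by linarith
  qed
  have same: "kN\<^sup>2 / 16 / r * J \<le> E \<tau> M t0 \<sigma>0 x t"
  proof -
    \<comment> \<open>The component \<open>\<sigma>0\<close> is recovered from the opposite one:
      along the last stretch of duration \<open>r / 8\<close> the latter is bounded below by
      \<open>other\<close>. Going back costs at most \<open>r / 8\<close> in space and
      \<open>r / 8\<close> in time, so the margin \<open>3 / 4 * r\<close> drops to the
      \<open>r / 2\<close> required there, and \<open>c * (r / 8)\<close> is the constant with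
      \<open>kN\<^sup>2 / 16\<close>.\<close>
    define c where "c = kN / r * (kN / (2 * r) * J)"
    have tt: "t0 \<le> t - r / 8" "t - r / 8 \<le> t" using far r by linarith+
    have "(\<lambda>s. c * s) t - (\<lambda>s. c * s) (t - r / 8) \<le>
        E \<tau> M t0 \<sigma>0 x t - E \<tau> M t0 \<sigma>0 (x + \<sigma>0 * (t - (t - r / 8))) (t - r / 8)"
    proof (rule E_char_growth[OF g M t0 nonneg D \<sigma>0 tt, where G' = "\<lambda>_. c"])
      show "continuous_on {t - r / 8..t} (\<lambda>s. c * s)" by (intro continuous_intros)
      fix s assume s: "t - r / 8 < s" "s < t"
      show "((*) c has_real_derivative c) (at s)" by (auto intro!: derivative_eq_intros)
      define z where "z = x + \<sigma>0 * (t - s)"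
      have Dz: "Dom x0 r z s"
        unfolding z_def using Dom_backward[OF g D _ _ char_le[OF \<sigma>0]] s tt by (simp add: t0)
      have "\<bar>z - x\<bar> \<le> t - s" unfolding z_def by (rule char_le[OF \<sigma>0]) (use s in auto)
      then have "\<bar>z - x0\<bar> + r / 2 \<le> s - t0" using far s by linarith
      from other[OF Dz this] have "kN / (2 * r) * J \<le> E \<tau> M t0 (- \<sigma>0) z s" .
      also have "\<dots> \<le> E \<tau> M t0 1 z s + E \<tau> M t0 (-1) z s"
        using nonneg[OF _ Dz] \<sigma>0 by auto
      finally show "c \<le> kN / r * (E \<tau> M t0 1 (x + \<sigma>0 * (t - s)) s + E \<tau> M t0 (-1) (x + \<sigma>0 * (t - s)) s)"
        unfolding z_def c_def by (intro mult_left_mono) (use kN_pos r in auto)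
    qed
    moreover have "0 \<le> E \<tau> M t0 \<sigma>0 (x + \<sigma>0 * (t - (t - r / 8))) (t - r / 8)"
      by (rule nonneg[OF \<sigma>0]) (rule Dom_backward[OF g D _ tt(2) char_le[OF \<sigma>0 tt(2)]], use tt t0 in simp)
    moreover have "c * t - c * (t - r / 8) = kN\<^sup>2 / 16 / r * J"
      using r by (simp add: c_def field_simps power2_eq_square)
    ultimately show ?thesis by linarith
  qed
  define m0 where "m0 = min (kN / 2) (kN\<^sup>2 / 16)"
  have "m0 / r * J \<le> kN / 2 / r * J"
    by (intro mult_right_mono divide_right_mono) (use r J0 in \<open>auto simp: m0_def\<close>)
  moreover have "m0 / r * J \<le> kN\<^sup>2 / 16 / r * J"
    by (intro mult_right_mono divide_right_mono) (use r J0 in \<open>auto simp: m0_def\<close>)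
  moreover have "kN / 2 / r * J \<le> E \<tau> M t0 (- \<sigma>0) x t"
    using other[OF D] far r by simp
  ultimately have "m0 / r * J \<le> E \<tau> M t0 (- \<sigma>0) x t" "m0 / r * J \<le> E \<tau> M t0 \<sigma>0 x t"
    using same by linarith+
  moreover have "\<sigma> = \<sigma>0 \<or> \<sigma> = - \<sigma>0" using \<sigma> \<sigma>0 by auto
  ultimately show ?thesis by (auto simp: m0_def)
qed

section \<open>Scale-invariant constants and one step of oscillation decay\<close>

text \<open>At distance of order \<open>r\<close> from the blow-up curve, \<open>u powr p\<close>
  and hence \<open>W\<close> and \<open>vt\<close> have size \<open>r powr (- q)\<close>.
  \<open>C_vt\<close> is the upper constant for \<open>vt\<close> on the base of the trapezoid of
  size \<open>r / 10\<close>, which lies at least \<open>\<kappa> * r / 10\<close> below the curve;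
  \<open>c_W\<close> is the lower constant for \<open>W\<close> in the trapezoid of size
  \<open>r\<close>.\<close>

definition q :: real where "q = p / (p - 1)"
definition C_vt :: real where "C_vt = 2 powr (-p) / (1 - \<theta>) * (10 / (c_rate * \<kappa>)) powr q"
definition c_W :: real where "c_W = 2 powr (-p) / 2 * (1 / (2 * C_rate)) powr q"
text \<open>The first entry is the constant of \<open>E_harnack\<close> measured in units of
  \<open>vt\<close>; the second makes \<open>\<delta>1\<close>, the relative gain per step, at most
  1.\<close>

definition \<delta>0 :: real where "\<delta>0 = min (min (kN / 2) (kN\<^sup>2 / 16) / C_vt) (4 / c_W)"
definition \<delta>1 :: real where "\<delta>1 = \<delta>0 * c_W / 4"

lemma C_vt_pos: "C_vt > 0" and c_W_pos: "c_W > 0" and \<delta>0_pos: "\<delta>0 > 0"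
proof -
  show 1: "C_vt > 0" using \<theta> c_rate_pos \<kappa> by (simp add: C_vt_def)
  show 2: "c_W > 0" using C_rate_pos by (simp add: c_W_def)
  show "\<delta>0 > 0" using 1 2 kN_pos by (simp add: \<delta>0_def)
qed

lemma \<delta>1: "0 < \<delta>1" "\<delta>1 \<le> 1"
proof -
  show "0 < \<delta>1" using \<delta>0_pos c_W_pos by (simp add: \<delta>1_def)
  have "\<delta>0 * c_W \<le> 4 / c_W * c_W" by (rule mult_right_mono) (use c_W_pos in \<open>auto simp: \<delta>0_def\<close>)
  then show "\<delta>1 \<le> 1" using c_W_pos by (simp add: \<delta>1_def)
qed

lemma good_shrink: "good x0 r \<Longrightarrow> good x0 (r / 10)"
  by (auto simp: good_def)

lemma Dom_shrink: "good x0 r \<Longrightarrow> Dom x0 (r / 10) x t \<Longrightarrow> Dom x0 r x t"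
  using \<kappa>_r[of x0 r] by (auto simp: Dom_def good_def)

lemma vt_le_scale:
  assumes g: "good x0 r" and x: "\<bar>x - x0\<bar> \<le> (1 + \<kappa>) * (r / 10)" and "\<sigma> \<in> {1, -1}"
  shows "vt \<sigma> x (T x0 - r / 10) \<le> C_vt * r powr (- q)"
proof -
  note g' = good_shrink[OF g]
  note D = Dom_base[OF g' x]
  note i = Dom_inside(1)[OF g' D(1)]
  have r: "0 < r" using g by (simp add: good_def)
  have "0 < \<kappa> * (r / 10)" using \<kappa> r by simp
  from u_powr_p_rate(3)[OF i this D(2) order_refl]
  have "u x (T x0 - r / 10) powr p \<le> (1 / (c_rate * (\<kappa> * (r / 10)))) powr q" by (simp add: q_def)
  also have "1 / (c_rate * (\<kappa> * (r / 10))) = 10 / (c_rate * \<kappa>) * (1 / r)" by simp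
  also have "(10 / (c_rate * \<kappa>) * (1 / r)) powr q = (10 / (c_rate * \<kappa>)) powr q * r powr (- q)"
    using c_rate_pos \<kappa> r by (subst powr_mult) (auto simp: powr_divide powr_minus_divide)
  finally have "2 powr (-p) * u x (T x0 - r / 10) powr p \<le> 2 powr (-p) * ((10 / (c_rate * \<kappa>)) powr q * r powr (- q))"
    by (rule mult_left_mono) simp
  then have "W x (T x0 - r / 10) / (1 - \<theta>) \<le> 2 powr (-p) * ((10 / (c_rate * \<kappa>)) powr q * r powr (- q)) / (1 - \<theta>)"
    by (intro divide_right_mono order_trans[OF W_bounds(2)[OF i]]) (use \<theta> in auto)
  also have "\<dots> = C_vt * r powr (- q)" by (simp add: C_vt_def)
  finally show ?thesis using vt_bounds(3)[OF i assms(3)] by linarith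
qed

lemma W_ge_scale:
  assumes g: "good x0 r" and D: "Dom x0 r x t"
  shows "c_W * r powr (- q) \<le> W x t"
proof -
  note i = Dom_inside[OF g D]
  have r: "0 < r" using g by (simp add: good_def)
  have "0 < T x - t" using D by (simp add: Dom_def)
  from u_powr_p_rate(4)[OF i(1) this order_refl i(3)]
  have "(1 / (C_rate * (2 * r))) powr q \<le> u x t powr p" by (simp add: q_def)
  moreover have "1 / (C_rate * (2 * r)) = 1 / (2 * C_rate) * (1 / r)" by simp
  moreover have "(1 / (2 * C_rate) * (1 / r)) powr q = (1 / (2 * C_rate)) powr q * r powr (- q)"
    using C_rate_pos r by (subst powr_mult) (auto simp: powr_divide powr_minus_divide)
  ultimately have "(1 / (2 * C_rate)) powr q * r powr (- q) \<le> u x t powr p" by simp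
  then have "2 powr (-p) / 2 * ((1 / (2 * C_rate)) powr q * r powr (- q)) \<le> 2 powr (-p) / 2 * u x t powr p"
    by (rule mult_left_mono) simp
  moreover have "2 powr (-p) / 2 * ((1 / (2 * C_rate)) powr q * r powr (- q)) = c_W * r powr (- q)"
    by (simp add: c_W_def)
  ultimately show ?thesis using W_bounds(1)[OF i(1)] by linarith
qed

text \<open>Mass of order \<open>\<Delta> * r * r powr (- q)\<close> at the base makes
  \<open>E\<close> at least \<open>\<delta>0 * \<Delta> * vt\<close> on the base of the smaller
  trapezoid, by \<open>E_harnack\<close> and the size of \<open>vt\<close>. There \<open>M\<close>
  may be lowered by \<open>\<delta>0 * \<Delta>\<close>, and positivity with the new constant is
  propagated afresh from the later time \<open>t1\<close>.\<close>

lemma slope_bound_improves: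
  assumes g: "good x0 r" and M: "-1 \<le> M" and t0: "t0 = T x0 - r"
    and nonneg: "\<And>\<sigma> x t. \<sigma> \<in> {1, -1} \<Longrightarrow> Dom x0 r x t \<Longrightarrow> 0 \<le> \<tau> * a \<sigma> x t + M * vt \<sigma> x t"
    and \<sigma>0: "\<sigma>0 \<in> {1, -1}" and \<Delta>: "0 \<le> \<Delta>" "-1 \<le> M - \<delta>0 * \<Delta>"
    and int: "\<Delta> * r * r powr (- q) \<le> integral {x0 - r / 2..x0 + r / 2} (\<lambda>y. \<tau> * a \<sigma>0 y t0 + M * vt \<sigma>0 y t0)"
    and D: "Dom x0 (r / 10) x t" and \<sigma>: "\<sigma> \<in> {1, -1}"
  shows "0 \<le> \<tau> * a \<sigma> x t + (M + 6 * r - \<delta>0 * \<Delta>) * vt \<sigma> x t"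
proof -
  note g' = good_shrink[OF g]
  have r: "0 < r" using g by (simp add: good_def)
  have E0: "0 \<le> E \<tau> M t0 \<sigma> x t" if "\<sigma> \<in> {1, -1}" "Dom x0 r x t" for \<sigma> x t
  proof -
    have "0 \<le> 2 * (t - t0) * vt \<sigma> x t"
      using vt_bounds(4)[OF Dom_inside(1)[OF g that(2)] that(1)] that(2) by (simp add: t0 Dom_def)
    then show ?thesis using nonneg[OF that] by (simp add: E_def algebra_simps)
  qed
  define J where "J = integral {x0 - r / 2..x0 + r / 2} (\<lambda>y. E \<tau> M t0 \<sigma>0 y t0)"
  have J: "\<Delta> * r * r powr (- q) \<le> J" using int by (simp add: J_def E_def)
  define t1 where "t1 = T x0 - r / 10"
  \<comment> \<open>The term \<open>2 * r\<close> covers the drift accumulated between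
    \<open>t0\<close> and \<open>t1\<close>; the drift of the restarted quantity is zero at
    \<open>t1\<close>.\<close>
  define M1 where "M1 = M + 2 * r - \<delta>0 * \<Delta>"
  have base: "0 \<le> E \<tau> M1 t1 \<rho> y t1" if \<rho>: "\<rho> \<in> {1, -1}" and y: "\<bar>y - x0\<bar> \<le> (1 + \<kappa>) * (r / 10)" for \<rho> y
  proof -
    have Dy: "Dom x0 r y t1" using Dom_shrink[OF g Dom_base(1)[OF g' y]] by (simp add: t1_def)
    note iy = Dom_inside(1)[OF g Dy]
    have "(1 + \<kappa>) * (r / 10) \<le> 3 / 2 * (r / 10)" using \<kappa> r by (intro mult_right_mono) auto
    then have "\<bar>y - x0\<bar> + 3 / 4 * r \<le> t1 - t0" using y unfolding t1_def t0 by linarith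
    from E_harnack[OF g M t0 E0 \<sigma>0 J_def Dy this \<rho>]
    have "min (kN / 2) (kN\<^sup>2 / 16) / r * J \<le> E \<tau> M t0 \<rho> y t1" .
    moreover have "\<delta>0 * C_vt \<le> min (kN / 2) (kN\<^sup>2 / 16)"
    proof -
      have "\<delta>0 \<le> min (kN / 2) (kN\<^sup>2 / 16) / C_vt" unfolding \<delta>0_def by simp
      then show ?thesis using C_vt_pos by (simp add: pos_le_divide_eq)
    qed
    then have "\<delta>0 * C_vt / r * (\<Delta> * r * r powr (- q)) \<le> min (kN / 2) (kN\<^sup>2 / 16) / r * J"
      using J r \<Delta> kN_pos by (intro mult_mono divide_right_mono) auto
    moreover have "\<delta>0 * C_vt / r * (\<Delta> * r * r powr (- q)) = \<delta>0 * \<Delta> * (C_vt * r powr (- q))"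
      using r by simp
    moreover have "\<delta>0 * \<Delta> * vt \<rho> y t1 \<le> \<delta>0 * \<Delta> * (C_vt * r powr (- q))"
      using vt_le_scale[OF g y \<rho>] \<delta>0_pos \<Delta> by (intro mult_left_mono) (auto simp: t1_def)
    ultimately have "\<delta>0 * \<Delta> * vt \<rho> y t1 \<le> E \<tau> M t0 \<rho> y t1" by linarith
    moreover have "2 * (t1 - t0) * vt \<rho> y t1 \<le> 2 * r * vt \<rho> y t1"
      using vt_bounds(4)[OF iy \<rho>] r by (intro mult_right_mono) (auto simp: t1_def t0)
    ultimately show ?thesis by (simp add: E_def M1_def algebra_simps)
  qed
  have "0 \<le> E \<tau> M1 t1 \<sigma> x t"
    by (rule E_nonneg_propagates[OF g' _ t1_def base D \<sigma>]) (use \<Delta> r in \<open>auto simp: M1_def\<close>)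
  \<comment> \<open>The second drift, from \<open>t1\<close> on, costs another \<open>4 * r\<close>;
    with the \<open>2 * r\<close> in \<open>M1\<close> this makes the \<open>6 * r\<close> of the
    conclusion.\<close>
  moreover have "2 * (t - t1) * vt \<sigma> x t \<le> 4 * r * vt \<sigma> x t"
  proof (rule mult_right_mono)
    have "T x - t1 \<le> 2 * r"
    proof -
      have "\<bar>x - x0\<bar> \<le> (1 + \<kappa>) * (r / 10)" using Dom_inside(2)[OF g' D] .
      from Dom_inside(3)[OF g' Dom_base(1)[OF g' this]] show ?thesis using r by (simp add: t1_def)
    qed
    then show "2 * (t - t1) \<le> 4 * r" using D by (simp add: Dom_def)
    show "0 \<le> vt \<sigma> x t" using vt_bounds(4)[OF Dom_inside(1)[OF g' D] \<sigma>] by simp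
  qed
  ultimately show ?thesis by (simp add: E_def M1_def algebra_simps)
qed

text \<open>The explicit factors 1 and -1 make the two halves instances of the statements about
  \<open>E\<close> with \<tau> = 1 and \<tau> = -1. The bounds by 1 keep both \<open>M\<close> and
  \<open>- m\<close> at least -1, as \<open>E_has_derivative\<close> demands.\<close>

definition slopes_in :: "real \<Rightarrow> real \<Rightarrow> real \<Rightarrow> real \<Rightarrow> bool" where
  "slopes_in x0 r m M \<longleftrightarrow> -1 \<le> m \<and> m \<le> M \<and> M \<le> 1 \<and>
     (\<forall>\<sigma>\<in>{1, -1}. \<forall>x t. Dom x0 r x t \<longrightarrow> 0 \<le> 1 * a \<sigma> x t + M * vt \<sigma> x t \<and> 0 \<le> (-1) * a \<sigma> x t + (- m) * vt \<sigma> x t)"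

lemma slopes_in_init:
  assumes "good x0 r" "Dom x0 r x t" "\<sigma> \<in> {1, -1}"
  shows "0 \<le> 1 * a \<sigma> x t + 1 * vt \<sigma> x t" "0 \<le> (-1) * a \<sigma> x t + 1 * vt \<sigma> x t"
proof -
  note b = vt_bounds[OF Dom_inside(1)[OF assms(1,2)] assms(3)]
  have "\<theta> * vt \<sigma> x t \<le> 1 * vt \<sigma> x t" by (rule mult_right_mono) (use b \<theta> in auto)
  then show "0 \<le> 1 * a \<sigma> x t + 1 * vt \<sigma> x t" "0 \<le> (-1) * a \<sigma> x t + 1 * vt \<sigma> x t"
    using b(1) by auto
qed

text \<open>The two nonnegative quantities attached to \<open>M\<close> and \<open>m\<close> add up to \<open>(M - m) * vt\<close>, so at the base
  one of them carries a fixed share of the mass, and the corresponding bound improves.\<close>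

lemma slopes_in_step:
  assumes g: "good x0 r" and H: "slopes_in x0 r m M"
  shows "\<exists>m' M'. slopes_in x0 (r / 10) m' M' \<and> M' - m' \<le> (1 - \<delta>1) * (M - m) + 6 * r"
proof -
  define t0 where "t0 = T x0 - r"
  define I where "I = {x0 - r / 2..x0 + r / 2}"
  define eM where "eM \<sigma> y = 1 * a \<sigma> y t0 + M * vt \<sigma> y t0" for \<sigma> y
  define em where "em \<sigma> y = (-1) * a \<sigma> y t0 + (- m) * vt \<sigma> y t0" for \<sigma> y
  \<comment> \<open>Over \<open>I\<close>, of length \<open>r\<close>, the four functions
    \<open>eM \<sigma>\<close> and \<open>em \<sigma>\<close> together have integral at least
    \<open>(M - m) * c_W * r * r powr (- q)\<close>; one of them must carry a quarter of it.\<close>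
  define \<Delta> where "\<Delta> = (M - m) * c_W / 4"
  have r: "0 < r" using g by (simp add: good_def)
  have b: "-1 \<le> m" "m \<le> M" "M \<le> 1" using H by (auto simp: slopes_in_def)
  have HM: "0 \<le> 1 * a \<sigma> x t + M * vt \<sigma> x t" if "\<sigma> \<in> {1, -1}" "Dom x0 r x t" for \<sigma> x t
    using H that unfolding slopes_in_def by blast
  have Hm: "0 \<le> (-1) * a \<sigma> x t + (- m) * vt \<sigma> x t" if "\<sigma> \<in> {1, -1}" "Dom x0 r x t" for \<sigma> x t
    using H that unfolding slopes_in_def by blast
  have DI: "Dom x0 r y t0" if "y \<in> I" for y
    unfolding t0_def
  proof (rule Dom_base(1)[OF g])
    have "0 \<le> \<kappa> * r" using \<kappa> r by simp
    moreover have "\<bar>y - x0\<bar> \<le> r / 2" using that unfolding I_def abs_le_iff by auto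
    ultimately show "\<bar>y - x0\<bar> \<le> (1 + \<kappa>) * r" using r by (simp add: algebra_simps)
  qed
  have cont: "continuous_on I (\<lambda>y. a \<sigma> y t0)" "continuous_on I (\<lambda>y. vt \<sigma> y t0)" if \<sigma>: "\<sigma> \<in> {1, -1}" for \<sigma>
  proof -
    have "isCont (\<lambda>y. a \<sigma> y t0) y \<and> isCont (\<lambda>y. vt \<sigma> y t0) y" if "y \<in> I" for y
      using isCont_o2[where f = "\<lambda>y. (y, t0)" and a = y and g = "\<lambda>z. a \<sigma> (fst z) (snd z)"]
        isCont_o2[where f = "\<lambda>y. (y, t0)" and a = y and g = "\<lambda>z. vt \<sigma> (fst z) (snd z)"]
        isCont_a[OF Dom_inside(1)[OF g DI[OF that]] \<sigma>] isCont_vt[OF Dom_inside(1)[OF g DI[OF that]] \<sigma>]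
      by (auto intro!: continuous_intros)
    then show "continuous_on I (\<lambda>y. a \<sigma> y t0)" "continuous_on I (\<lambda>y. vt \<sigma> y t0)"
      by (auto intro!: continuous_at_imp_continuous_on)
  qed
  have int: "eM \<sigma> integrable_on I" "em \<sigma> integrable_on I" if "\<sigma> \<in> {1, -1}" for \<sigma>
    unfolding I_def eM_def em_def
    by (intro integrable_continuous_interval continuous_intros cont[OF that, unfolded I_def])+
  have "4 * (\<Delta> * r * r powr (- q)) \<le> integral I (\<lambda>y. (eM 1 y + em 1 y) + (eM (-1) y + em (-1) y))"
  proof -
    have "integral I (\<lambda>_. (M - m) * (c_W * r powr (- q))) \<le> integral I (\<lambda>y. (eM 1 y + em 1 y) + (eM (-1) y + em (-1) y))"
    proof (rule integral_le)
      show "(\<lambda>_. (M - m) * (c_W * r powr (- q))) integrable_on I" by (simp add: I_def integrable_const_ivl)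
      show "(\<lambda>y. (eM 1 y + em 1 y) + (eM (-1) y + em (-1) y)) integrable_on I"
        by (intro integrable_add int) auto
      fix y assume y: "y \<in> I"
      note i = Dom_inside(1)[OF g DI[OF y]]
      have "c_W * r powr (- q) \<le> vt 1 y t0 + vt (-1) y t0"
        using W_ge_scale[OF g DI[OF y]] vt_bounds(2)[OF i, of 1] vt_bounds(2)[OF i, of "-1"] by auto
      then have "(M - m) * (c_W * r powr (- q)) \<le> (M - m) * (vt 1 y t0 + vt (-1) y t0)"
        by (rule mult_left_mono) (use b in auto)
      then show "(M - m) * (c_W * r powr (- q)) \<le> eM 1 y + em 1 y + (eM (-1) y + em (-1) y)"
        by (simp add: eM_def em_def algebra_simps)
    qed
    then show ?thesis using r by (simp add: I_def \<Delta>_def mult_ac)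
  qed
  also have "\<dots> = (integral I (eM 1) + integral I (em 1)) + (integral I (eM (-1)) + integral I (em (-1)))"
    using int[of 1] int[of "-1"] by (simp add: integral_add integrable_add)
  finally have "\<exists>\<sigma>0\<in>{1, -1}. \<Delta> * r * r powr (- q) \<le> integral I (eM \<sigma>0) \<or> \<Delta> * r * r powr (- q) \<le> integral I (em \<sigma>0)"
    by (rule_tac ccontr) auto
  then obtain \<sigma>0 where \<sigma>0: "\<sigma>0 \<in> {1, -1}"
    and alt: "\<Delta> * r * r powr (- q) \<le> integral I (eM \<sigma>0) \<or> \<Delta> * r * r powr (- q) \<le> integral I (em \<sigma>0)" by blast
  have \<Delta>0: "0 \<le> \<Delta>" using b c_W_pos by (simp add: \<Delta>_def)
  have \<delta>\<Delta>: "\<delta>0 * \<Delta> = \<delta>1 * (M - m)" by (simp add: \<delta>1_def \<Delta>_def)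
  have le: "\<delta>1 * (M - m) \<le> 1 * (M - m)" by (rule mult_right_mono) (use \<delta>1 b in auto)
  show ?thesis using alt
  proof
    assume A: "\<Delta> * r * r powr (- q) \<le> integral I (eM \<sigma>0)"
    \<comment> \<open>The error \<open>6 * r\<close> could push the bound above 1. Truncation is
      allowed because 1 is always a valid bound, by \<open>slopes_in_init\<close>.\<close>
    define M' where "M' = min 1 (M + 6 * r - \<delta>0 * \<Delta>)"
    have "slopes_in x0 (r / 10) m M'"
      unfolding slopes_in_def
    proof (intro conjI ballI allI impI)
      show "-1 \<le> m" "M' \<le> 1" "m \<le> M'" using b le r by (auto simp: M'_def \<delta>\<Delta>)
      fix \<sigma> x t assume \<sigma>: "\<sigma> \<in> {1, -1::real}" and D: "Dom x0 (r / 10) x t"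
      show "0 \<le> (-1) * a \<sigma> x t + (- m) * vt \<sigma> x t" by (rule Hm[OF \<sigma> Dom_shrink[OF g D]])
      have "0 \<le> 1 * a \<sigma> x t + (M + 6 * r - \<delta>0 * \<Delta>) * vt \<sigma> x t"
        by (rule slope_bound_improves[OF g _ t0_def HM \<sigma>0 \<Delta>0 _ _ D \<sigma>])
          (use b le A \<delta>\<Delta> in \<open>auto simp: I_def eM_def[abs_def]\<close>)
      then show "0 \<le> 1 * a \<sigma> x t + M' * vt \<sigma> x t"
        using slopes_in_init(1)[OF good_shrink[OF g] D \<sigma>] unfolding M'_def min_def by auto
    qed
    moreover have "M' - m \<le> (1 - \<delta>1) * (M - m) + 6 * r"
    proof -
      have "M' \<le> M + 6 * r - \<delta>1 * (M - m)" by (simp add: M'_def \<delta>\<Delta>)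
      then show ?thesis by (simp add: left_diff_distrib)
    qed
    ultimately show ?thesis by blast
  next
    assume A: "\<Delta> * r * r powr (- q) \<le> integral I (em \<sigma>0)"
    define m' where "m' = - min 1 (- m + 6 * r - \<delta>0 * \<Delta>)"
    have "slopes_in x0 (r / 10) m' M"
      unfolding slopes_in_def
    proof (intro conjI ballI allI impI)
      show "-1 \<le> m'" "M \<le> 1" "m' \<le> M" using b le r by (auto simp: m'_def \<delta>\<Delta>)
      fix \<sigma> x t assume \<sigma>: "\<sigma> \<in> {1, -1::real}" and D: "Dom x0 (r / 10) x t"
      show "0 \<le> 1 * a \<sigma> x t + M * vt \<sigma> x t" by (rule HM[OF \<sigma> Dom_shrink[OF g D]])
      have "0 \<le> (-1) * a \<sigma> x t + (- m + 6 * r - \<delta>0 * \<Delta>) * vt \<sigma> x t"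
        by (rule slope_bound_improves[OF g _ t0_def Hm \<sigma>0 \<Delta>0 _ _ D \<sigma>])
          (use b le A \<delta>\<Delta> in \<open>auto simp: I_def em_def[abs_def]\<close>)
      then show "0 \<le> (-1) * a \<sigma> x t + (- m') * vt \<sigma> x t"
        using slopes_in_init(2)[OF good_shrink[OF g] D \<sigma>] unfolding m'_def min_def by auto
    qed
    moreover have "M - m' \<le> (1 - \<delta>1) * (M - m) + 6 * r"
    proof -
      have "- m' \<le> - m + 6 * r - \<delta>1 * (M - m)" by (simp add: m'_def \<delta>\<Delta>)
      then show ?thesis by (simp add: left_diff_distrib)
    qed
    ultimately show ?thesis by blast
  qed
qed

section \<open>From slopes of the level sets to difference quotients of \<open>T\<close>\<close>

text \<open>If the graph of \<open>T\<close> rose above the line of slope \<open>M\<close> through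
  \<open>(x, T x)\<close>, then beyond the last contact the line would run strictly below the graph.
  By \<open>nonneg\<close>, \<open>u\<close> is nondecreasing along the line, so it stays bounded
  when the contact point is approached from the right; but there the distance to the graph tends to
  zero and \<open>u\<close> must blow up.\<close>

lemma T_slope_le:
  assumes g: "good x0 r" and \<tau>: "\<tau> \<in> {1, -1}" and M: "\<bar>M\<bar> \<le> 1"
    and nonneg: "\<And>\<sigma> x t. \<sigma> \<in> {1, -1} \<Longrightarrow> Dom x0 r x t \<Longrightarrow> 0 \<le> \<tau> * a \<sigma> x t + M * vt \<sigma> x t"
    and x: "\<bar>x - x0\<bar> \<le> \<kappa> * r / 4" and h: "0 \<le> h" and xh: "\<bar>x + \<tau> * h - x0\<bar> \<le> \<kappa> * r / 4"
  shows "T (x + \<tau> * h) \<le> T x + M * h"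
proof (rule ccontr)
  assume neg: "\<not> T (x + \<tau> * h) \<le> T x + M * h"
  define G where "G s = T (x + \<tau> * s) - (T x + M * s)" for s
  have \<kappa>r: "0 < \<kappa> * r" "\<kappa> * r < r / 2" using \<kappa>_r[OF g] by auto
  have r: "0 < r" using g by (simp add: good_def)
  define k where "k = \<kappa> * r / 4"
  have xk: "\<bar>x - x0\<bar> \<le> k" "\<bar>x + \<tau> * h - x0\<bar> \<le> k" using x xh by (simp_all add: k_def)
  have near: "\<bar>x + \<tau> * s - x0\<bar> \<le> \<kappa> * r / 4" if "s \<in> {0..h}" for s
    using that \<tau> xk unfolding k_def[symmetric] by (auto simp: abs_le_iff)
  have Rs: "\<bar>x + \<tau> * s\<bar> < Rs" if "s \<in> {0..h}" for s
    using near[OF that] g \<kappa>r unfolding good_def by linarith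
  have "h \<le> 2 * k" using xk \<tau> by (auto simp: abs_le_iff)
  then have hk: "h \<le> \<kappa> * r / 2" by (simp add: k_def mult.commute)
  have contG: "continuous_on {0..h} G"
  proof -
    have "\<theta>-lipschitz_on ((\<lambda>s. x + \<tau> * s) ` {0..h}) T"
    proof (rule lipschitz_onI)
      fix y z assume "y \<in> (\<lambda>s. x + \<tau> * s) ` {0..h}" "z \<in> (\<lambda>s. x + \<tau> * s) ` {0..h}"
      then have "\<bar>y\<bar> < Rs" "\<bar>z\<bar> < Rs" using Rs by blast+
      then show "dist (T y) (T z) \<le> \<theta> * dist y z" using T_lipschitz by (simp add: dist_real_def)
    qed (use \<theta> in simp)
    then have "continuous_on ((\<lambda>s. x + \<tau> * s) ` {0..h}) T"
      by (rule lipschitz_on_continuous_on)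
    then have "continuous_on {0..h} (\<lambda>s. T (x + \<tau> * s))"
      by (rule continuous_on_compose2) (auto intro!: continuous_intros)
    then show ?thesis unfolding G_def by (intro continuous_intros)
  qed
  \<comment> \<open>The parameters where the line is on or above the graph; the largest one,
    \<open>s0\<close>, is the last contact.\<close>
  define S where "S = {s \<in> {0..h}. G s \<le> 0}"
  have "S = {0..h} \<inter> G -` {..0}" by (auto simp: S_def)
  then have "compact S"
    using continuous_closed_preimage[OF contG closed_atLeastAtMost closed_atMost[of 0]]
    by (auto simp: compact_eq_bounded_closed intro: bounded_subset[OF bounded_closed_interval[of 0 h]])
  moreover have "0 \<in> S" using h by (auto simp: S_def G_def)
  ultimately obtain s0 where s0: "s0 \<in> S" "\<And>s. s \<in> S \<Longrightarrow> s \<le> s0"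
    using compact_attains_sup[of S] by blast
  have Gpos: "0 < G s" if "s0 < s" "s \<le> h" for s
    using s0(1) s0(2)[of s] that by (cases "G s \<le> 0") (auto simp: S_def)
  have s0h: "s0 < h"
  proof -
    have "0 < G h" using neg by (simp add: G_def)
    then show ?thesis using s0(1) by (cases "s0 = h") (auto simp: S_def)
  qed
  \<comment> \<open>At height \<open>T x0\<close> the trapezoid still has half-width
    \<open>\<kappa> * r\<close>. The quarter in the hypotheses is chosen so that the horizontal
    offset (one quarter), the variation of \<open>T\<close> (one quarter) and the climb along the
    line (two quarters) fit into it together.\<close>
  have D: "Dom x0 r (x + \<tau> * s) (T x + M * s)" if "s0 < s" "s \<le> h" for s
  proof -
    have s: "s \<in> {0..h}" using that s0(1) by (auto simp: S_def)
    have "\<bar>T x - T x0\<bar> \<le> \<theta> * \<bar>x - x0\<bar>"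
      using T_lipschitz[of x x0] Rs[of 0] h g by (auto simp: good_def)
    also have "\<dots> \<le> 1 * \<bar>x - x0\<bar>" by (rule mult_right_mono) (use \<theta> in auto)
    also have "\<dots> \<le> \<kappa> * r / 4" using x by simp
    finally have 1: "\<bar>T x - T x0\<bar> \<le> \<kappa> * r / 4" .
    have "\<bar>M * s\<bar> \<le> 1 * s" unfolding abs_mult using M s by (intro mult_mono) auto
    then have 2: "\<bar>M * s\<bar> \<le> \<kappa> * r / 2" using s hk by auto
    have k: "\<kappa> * r = 4 * k" "8 * k < r" "0 < k" using \<kappa>r \<kappa>(2) r by (simp_all add: k_def)
    have 3: "T x0 - T x \<le> k" "T x - T x0 \<le> k" "- (M * s) \<le> 2 * k" "M * s \<le> 2 * k"
      using 1 2 unfolding k(1) abs_le_iff by simp_all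
    have "T x + M * s < T (x + \<tau> * s)" using Gpos[OF that] by (simp add: G_def)
    moreover have "T x0 - r \<le> T x + M * s" using 3 k by linarith
    moreover have "\<bar>x + \<tau> * s - x0\<bar> + (T x + M * s - T x0) \<le> \<kappa> * r"
      using 3 near[OF s] unfolding k(1) by simp
    ultimately show ?thesis by (simp add: Dom_def)
  qed
  define U where "U s = u (x + \<tau> * s) (T x + M * s)" for s
  have Ule: "U s \<le> U h" if "s0 < s" "s \<le> h" for s
  proof (rule DERIV_nonneg_imp_nondecreasing[of s h U])
    show "s \<le> h" by fact
    fix z assume z: "s \<le> z" "z \<le> h"
    define X Y where "X = x + \<tau> * z" and "Y = T x + M * z"
    have Dz: "Dom x0 r X Y" unfolding X_def Y_def using D z that by auto
    have "(U has_real_derivative \<tau> * (a 1 X Y + a (-1) X Y) + M * (vt 1 X Y + vt (-1) X Y)) (at z)"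
      unfolding U_def X_def Y_def
      by (rule u_chain) (use Dom_inside(1)[OF g Dz] in \<open>auto simp: X_def Y_def intro!: derivative_eq_intros\<close>)
    moreover have "0 \<le> \<tau> * (a 1 X Y + a (-1) X Y) + M * (vt 1 X Y + vt (-1) X Y)"
      using nonneg[OF _ Dz, of 1] nonneg[OF _ Dz, of "-1"] by (simp add: algebra_simps)
    ultimately show "\<exists>y. (U has_real_derivative y) (at z) \<and> 0 \<le> y" by blast
  qed
  define \<eta> where "\<eta> = U h powr (1 - p) / C_rate"
  have Upos: "0 < U s" if "s0 < s" "s \<le> h" for s
    unfolding U_def by (rule u_pos[OF Dom_inside(1)[OF g D[OF that]]])
  have \<eta>: "0 < \<eta>" using Upos[OF s0h order_refl] C_rate_pos by (simp add: \<eta>_def)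
  have "\<eta> \<le> G s" if "s0 < s" "s \<le> h" for s
  proof -
    have "U h powr (1 - p) \<le> U s powr (1 - p)"
      using Ule[OF that] Upos[OF that] p by (intro powr_mono2') auto
    also have "\<dots> \<le> C_rate * G s"
      using u_powr_rate(2)[OF Dom_inside(1)[OF g D[OF that]]] by (simp add: U_def G_def)
    finally show ?thesis using C_rate_pos by (simp add: \<eta>_def field_simps)
  qed
  then have ev: "eventually (\<lambda>s. \<eta> \<le> G s) (at s0 within {s0<..h})"
    by (auto simp: eventually_at_filter)
  have s0in: "s0 \<in> {0..h}" using s0(1) by (simp add: S_def)
  have "continuous (at s0 within {0..h}) G"
    using contG s0in by (simp add: continuous_on_eq_continuous_within)
  then have "(G \<longlongrightarrow> G s0) (at s0 within {0..h})" by (simp add: continuous_within)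
  then have "(G \<longlongrightarrow> G s0) (at s0 within {s0<..h})"
    by (rule tendsto_within_subset) (use s0in in auto)
  moreover have "at s0 within {s0<..h} \<noteq> bot"
    using s0h by (simp add: at_within_eq_bot_iff)
  ultimately have "\<eta> \<le> G s0"
    using ev by (intro tendsto_lowerbound[of G "G s0"]) auto
  then show False using \<eta> s0(1) by (simp add: S_def)
qed

lemma slopes_in_small:
  assumes g: "good x0 R0" and \<eta>: "0 < \<eta>"
  shows "\<exists>r m M. good x0 r \<and> slopes_in x0 r m M \<and> M - m \<le> \<eta>"
proof -
  \<comment> \<open>The widths obey \<open>w' \<le> (1 - \<delta>1) * w + 6 * R0 / 10 ^ k\<close>.
    Half of the gain \<open>\<delta>1\<close> is kept in \<open>lam\<close> and the other half pays
    for the error, whence \<open>12 * R0 \<le> C * \<delta>1\<close>; the lower bound 1/2 makes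
    \<open>lam ^ k\<close> dominate \<open>1 / 10 ^ k\<close>, and \<open>C \<ge> 2\<close> is the
    initial width.\<close>
  define lam where "lam = max (1 - \<delta>1 / 2) (1 / 2)"
  have lam: "1 - \<delta>1 / 2 \<le> lam" "1 / 2 \<le> lam" "lam < 1" using \<delta>1 by (auto simp: lam_def)
  define C where "C = max 2 (12 * R0 / \<delta>1)"
  have R0: "0 < R0" using g by (simp add: good_def)
  have C: "2 \<le> C" "12 * R0 \<le> C * \<delta>1"
  proof -
    have "12 * R0 / \<delta>1 \<le> C" by (simp add: C_def)
    then show "12 * R0 \<le> C * \<delta>1" using \<delta>1 by (simp add: pos_divide_le_eq)
  qed (simp add: C_def)
  have "\<exists>m M. good x0 (R0 / 10 ^ k) \<and> slopes_in x0 (R0 / 10 ^ k) m M \<and> M - m \<le> C * lam ^ k" for k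
  proof (induction k)
    case 0
    have "slopes_in x0 R0 (-1) 1" using slopes_in_init[OF g] by (auto simp: slopes_in_def)
    then show ?case using g C by (intro exI[of _ "-1"] exI[of _ 1]) auto
  next
    case (Suc k)
    then obtain m M where k: "good x0 (R0 / 10 ^ k)" "slopes_in x0 (R0 / 10 ^ k) m M" "M - m \<le> C * lam ^ k"
      by blast
    obtain m' M' where s: "slopes_in x0 (R0 / 10 ^ k / 10) m' M'"
      "M' - m' \<le> (1 - \<delta>1) * (M - m) + 6 * (R0 / 10 ^ k)"
      using slopes_in_step[OF k(1,2)] by blast
    have "(1 / 10) ^ k \<le> lam ^ k" by (rule power_mono) (use lam in auto)
    then have "6 * (R0 / 10 ^ k) \<le> 6 * R0 * lam ^ k"
      using R0 mult_left_mono[of "(1 / 10) ^ k" "lam ^ k" "6 * R0"] by (simp add: power_one_over divide_simps)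
    moreover have "(1 - \<delta>1) * (M - m) \<le> (1 - \<delta>1) * (C * lam ^ k)"
      using k(3) \<delta>1 by (intro mult_left_mono) auto
    ultimately have "M' - m' \<le> ((1 - \<delta>1) * C + 6 * R0) * lam ^ k" using s(2) by (simp add: algebra_simps)
    also have "\<dots> \<le> (C * lam) * lam ^ k"
    proof (rule mult_right_mono)
      have "C * (1 - \<delta>1 / 2) \<le> C * lam" using lam C by (intro mult_left_mono) auto
      then show "(1 - \<delta>1) * C + 6 * R0 \<le> C * lam" using C by (simp add: algebra_simps)
    qed (use lam in auto)
    finally have "M' - m' \<le> C * lam ^ Suc k" by simp
    moreover have "R0 / 10 ^ k / 10 = R0 / 10 ^ Suc k" by simp
    ultimately show ?case using s(1) good_shrink[OF k(1)] by metis
  qed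
  moreover have "\<exists>k. C * lam ^ k < \<eta>"
  proof -
    obtain k where "lam ^ k < \<eta> / C" using real_arch_pow_inv[of "\<eta> / C" lam] \<eta> C lam by auto
    then show ?thesis using C by (intro exI[of _ k]) (simp add: field_simps)
  qed
  ultimately show ?thesis by (meson less_imp_le order_trans)
qed

lemma T_C1: "T C1_differentiable_on {x. \<bar>x\<bar> < Rs}"
proof (rule C1_differentiable_on_if_slopes_close)
  fix x0 \<eta> :: real assume "x0 \<in> {x. \<bar>x\<bar> < Rs}" and \<eta>: "0 < \<eta>"
  then have x0: "\<bar>x0\<bar> < Rs" by simp
  define d where "d = Rs - \<bar>x0\<bar>"
  define R0 where "R0 = min (T x0 / 2) (d / 4)"
  have "0 < d" "\<bar>x0\<bar> = Rs - d" using x0 by (simp_all add: d_def)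
  moreover have "R0 \<le> T x0 / 2" "R0 \<le> d / 4" "0 < R0"
    using \<open>0 < d\<close> T_pos[OF x0] by (simp_all add: R0_def)
  ultimately have "good x0 R0" using T_pos[OF x0] unfolding good_def by simp
  from slopes_in_small[OF this \<eta>] obtain r m M
    where r: "good x0 r" "slopes_in x0 r m M" "M - m \<le> \<eta>" by blast
  have b: "\<bar>M\<bar> \<le> 1" "\<bar>- m\<bar> \<le> 1" using r(2) by (auto simp: slopes_in_def)
  have "0 < \<kappa> * r / 4" using \<kappa>_r[OF r(1)] by simp
  moreover have "m * (y - x) \<le> T y - T x \<and> T y - T x \<le> M * (y - x)"
    if "\<bar>x - x0\<bar> < \<kappa> * r / 4" "\<bar>y - x0\<bar> < \<kappa> * r / 4" "x \<le> y" for x y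
  proof
    have "T (x + 1 * (y - x)) \<le> T x + M * (y - x)"
      by (rule T_slope_le[OF r(1) _ b(1)]) (use that r(2) in \<open>auto simp: slopes_in_def\<close>)
    then show "T y - T x \<le> M * (y - x)" by simp
    have "T (y + (-1) * (y - x)) \<le> T y + (- m) * (y - x)"
      by (rule T_slope_le[OF r(1) _ b(2)]) (use that r(2) in \<open>auto simp: slopes_in_def\<close>)
    then show "m * (y - x) \<le> T y - T x" by simp
  qed
  ultimately show "\<exists>\<rho>>0. \<exists>m M. M - m \<le> \<eta> \<and>
      (\<forall>x y. \<bar>x - x0\<bar> < \<rho> \<longrightarrow> \<bar>y - x0\<bar> < \<rho> \<longrightarrow> x \<le> y \<longrightarrow>
         m * (y - x) \<le> T y - T x \<and> T y - T x \<le> M * (y - x))"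
    using r(3) by blast
qed

end

section \<open>The iterates and their limit\<close>

text \<open>The domain of dependence of the interval of radius \<open>L\<close>, with the initial
  line included. It is closed under following characteristics backwards, so every iterate is
  determined on it by the data on that interval.\<close>

definition cone_domain :: "real \<Rightarrow> (real \<times> real) set" where
  "cone_domain L = {(x, t). 0 \<le> t \<and> \<bar>x\<bar> + t < L}"

lemma cone_domain_backward:
  assumes "(x, t) \<in> cone_domain L" "\<sigma> \<in> {1, -1}" "0 \<le> s" "s \<le> t"
  shows "(x + \<sigma> * (t - s), s) \<in> cone_domain L"
  using assms by (auto simp: cone_domain_def)

lemma cone_domain_foot:
  assumes "(x, t) \<in> cone_domain L" "\<sigma> \<in> {1, -1}"
  shows "\<bar>x + \<sigma> * t\<bar> < L"
  using assms by (auto simp: cone_domain_def)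

lemma continuous_on_characteristic:
  assumes "continuous_on (cone_domain L) (\<lambda>(x, t). g x t)" "(x, t) \<in> cone_domain L" "\<sigma> \<in> {1, -1}"
  shows "continuous_on {0..t} (\<lambda>s. g (x + \<sigma> * (t - s)) s :: real)"
proof -
  have "continuous_on {0..t} (\<lambda>s. (\<lambda>(x, t). g x t) (x + \<sigma> * (t - s), s))"
    by (rule continuous_on_compose2[OF assms(1)])
      (use cone_domain_backward[OF assms(2,3)] in \<open>auto intro!: continuous_intros\<close>)
  then show ?thesis by simp
qed

text \<open>The interval of integration varies with \<open>t\<close>; the substitution
  \<open>s = t * r\<close> moves it to the unit interval, where continuity of parameter integrals
  applies.\<close>

lemma continuous_on_characteristic_integral:
  assumes g: "continuous_on (cone_domain L) (\<lambda>(x, t). g x t)" and \<sigma>: "\<sigma> \<in> {1, -1}"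
  shows "continuous_on (cone_domain L) (\<lambda>(x, t). integral {0..t} (\<lambda>s. g (x + \<sigma> * (t - s)) s :: real))"
proof -
  have scale: "integral {0..t} (\<lambda>s. g (x + \<sigma> * (t - s)) s) =
      t * integral (cbox 0 1) (\<lambda>r. g (x + \<sigma> * (t - t * r)) (t * r))" if "(x, t) \<in> cone_domain L" for x t
  proof (cases "t = 0")
    case False
    then have t: "0 < t" using that by (auto simp: cone_domain_def)
    have "(\<lambda>x. x / t) ` {0..t} = {0..1}" using t by (simp add: image_divide_atLeastAtMost)
    then show ?thesis
      using integral_stretch_real[OF False, where a = 0 and b = t and f = "\<lambda>s. g (x + \<sigma> * (t - s)) s"] t
      by simp
  qed simp
  have "continuous_on (cone_domain L \<times> cbox 0 1)
      (\<lambda>w. (\<lambda>(x, t). g x t) (fst (fst w) + \<sigma> * (snd (fst w) - snd (fst w) * snd w), snd (fst w) * snd w))"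
  proof (rule continuous_on_compose2[OF g])
    show "(\<lambda>w. (fst (fst w) + \<sigma> * (snd (fst w) - snd (fst w) * snd w), snd (fst w) * snd w)) `
        (cone_domain L \<times> cbox 0 1) \<subseteq> cone_domain L"
    proof (clarsimp)
      fix x t r :: real assume "(x, t) \<in> cone_domain L" "0 \<le> r" "r \<le> 1"
      then show "(x + \<sigma> * (t - t * r), t * r) \<in> cone_domain L"
        using cone_domain_backward[OF _ \<sigma>, of x t L "t * r"] mult_left_mono[of r 1 t]
        by (auto simp: cone_domain_def)
    qed
  qed (intro continuous_intros)
  then have "continuous_on (cone_domain L \<times> cbox 0 1)
      (\<lambda>(z, r). g (fst z + \<sigma> * (snd z - snd z * r)) (snd z * r))"
    by (simp add: case_prod_unfold)
  from integral_continuous_on_param[OF this]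
  have "continuous_on (cone_domain L)
      (\<lambda>z. snd z * integral (cbox 0 1) (\<lambda>r. g (fst z + \<sigma> * (snd z - snd z * r)) (snd z * r)))"
    by (intro continuous_intros)
  then show ?thesis
    by (rule continuous_on_eq) (auto simp: scale)
qed

lemma characteristic_integral_has_derivative:
  assumes g: "continuous_on (cone_domain L) (\<lambda>(x, t). g x t)"
    and gx: "continuous_on (cone_domain L) (\<lambda>(x, t). gx x t)"
    and d: "\<And>x t. (x, t) \<in> cone_domain L \<Longrightarrow> ((\<lambda>x. g x t) has_real_derivative gx x t) (at x)"
    and z: "(x, t) \<in> cone_domain L" and \<sigma>: "\<sigma> \<in> {1, -1}"
  shows "((\<lambda>x. integral {0..t} (\<lambda>s. g (x + \<sigma> * (t - s)) s)) has_real_derivative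
      integral {0..t} (\<lambda>s. gx (x + \<sigma> * (t - s)) s)) (at x)"
proof -
  define U where "U = {- (L - t)<..<L - t}"
  have t: "0 \<le> t" using z by (auto simp: cone_domain_def)
  have U: "(y, t) \<in> cone_domain L" if "y \<in> U" for y
    using that t by (auto simp: U_def cone_domain_def)
  have xU: "x \<in> U" using z by (auto simp: U_def cone_domain_def)
  have "((\<lambda>x. integral (cbox 0 t) (\<lambda>s. g (x + \<sigma> * (t - s)) s)) has_field_derivative
      integral (cbox 0 t) (\<lambda>s. gx (x + \<sigma> * (t - s)) s)) (at x within U)"
  proof (rule leibniz_rule_field_derivative)
    fix y s assume y: "y \<in> U" and s: "s \<in> cbox 0 t"
    have "((\<lambda>x. g x s) has_real_derivative gx (y + \<sigma> * (t - s)) s) (at (y + \<sigma> * (t - s)))"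
      by (rule d, rule cone_domain_backward[OF U[OF y] \<sigma>]) (use s in auto)
    then have "((\<lambda>y. g (y + \<sigma> * (t - s)) s) has_real_derivative gx (y + \<sigma> * (t - s)) s) (at y)"
      by (simp add: DERIV_shift)
    then show "((\<lambda>y. g (y + \<sigma> * (t - s)) s) has_field_derivative gx (y + \<sigma> * (t - s)) s) (at y within U)"
      by (rule has_field_derivative_at_within)
  next
    fix y assume "y \<in> U"
    then show "(\<lambda>s. g (y + \<sigma> * (t - s)) s) integrable_on cbox 0 t"
      using continuous_on_characteristic[OF g U \<sigma>] by (auto intro!: integrable_continuous_interval)
  next
    have "continuous_on (U \<times> cbox 0 t) (\<lambda>w. (\<lambda>(x, t). gx x t) (fst w + \<sigma> * (t - snd w), snd w))"
      by (rule continuous_on_compose2[OF gx])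
        (use cone_domain_backward[OF U \<sigma>] in \<open>auto intro!: continuous_intros\<close>)
    then show "continuous_on (U \<times> cbox 0 t) (\<lambda>(y, s). gx (y + \<sigma> * (t - s)) s)"
      by (simp add: case_prod_unfold)
  qed (use xU in \<open>auto simp: U_def\<close>)
  moreover have "at x within U = at x" using xU by (intro at_within_open) (auto simp: U_def)
  ultimately show ?thesis by simp
qed

text \<open>Integrating against the weight \<open>exp (K * s)\<close> gains a factor
  \<open>1 / K\<close>. With \<open>K\<close> large this makes the iteration contract without any
  restriction on the length of the time interval.\<close>

lemma abs_integral_exp_bound:
  fixes g :: "real \<Rightarrow> real"
  assumes "0 \<le> t" "0 < K" and g: "continuous_on {0..t} g"
    and le: "\<And>s. 0 \<le> s \<Longrightarrow> s \<le> t \<Longrightarrow> \<bar>g s\<bar> \<le> c * exp (K * s)"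
  shows "\<bar>integral {0..t} g\<bar> \<le> c / K * (exp (K * t) - 1)"
proof -
  have I: "((\<lambda>s. c * exp (K * s)) has_integral (c / K * exp (K * t) - c / K * exp (K * 0))) {0..t}"
  proof (rule fundamental_theorem_of_calculus)
    fix s :: real
    have "((\<lambda>s. c / K * exp (K * s)) has_real_derivative c * exp (K * s)) (at s within {0..t})"
      using assms(2) by (auto intro!: derivative_eq_intros)
    then show "((\<lambda>s. c / K * exp (K * s)) has_vector_derivative c * exp (K * s)) (at s within {0..t})"
      by (simp add: has_real_derivative_iff_has_vector_derivative)
  qed (use assms in auto)
  have "norm (integral {0..t} g) \<le> integral {0..t} (\<lambda>s. c * exp (K * s))"
    by (rule Henstock_Kurzweil_Integration.integral_norm_bound_integral)
      (use I le in \<open>auto intro!: integrable_continuous_interval g continuous_intros\<close>)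
  also have "\<dots> = c / K * (exp (K * t) - 1)"
    using integral_unique[OF I] by (simp add: algebra_simps)
  finally show ?thesis by simp
qed

lemma uniform_limit_geometric:
  fixes f :: "nat \<Rightarrow> 'a \<Rightarrow> real"
  assumes "\<And>n z. z \<in> Z \<Longrightarrow> \<bar>f (Suc n) z - f n z\<bar> \<le> C * (1 / 2) ^ n"
  shows "uniform_limit Z f (\<lambda>z. lim (\<lambda>n. f n z)) sequentially"
proof -
  have "uniform_limit Z (\<lambda>n z. \<Sum>i<n. f (Suc i) z - f i z) (\<lambda>z. \<Sum>i. f (Suc i) z - f i z) sequentially"
    by (rule Weierstrass_m_test[where M = "\<lambda>n. C * (1 / 2) ^ n"])
      (use assms in \<open>auto intro!: summable_mult summable_geometric\<close>)
  then have "uniform_limit Z (\<lambda>n z. f 0 z + (\<Sum>i<n. f (Suc i) z - f i z)) (\<lambda>z. f 0 z + (\<Sum>i. f (Suc i) z - f i z)) sequentially"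
    by (intro uniform_limit_intros)
  moreover have "f 0 z + (\<Sum>i<n. f (Suc i) z - f i z) = f n z" for n z
    using sum_lessThan_telescope[of "\<lambda>i. f i z" n] by simp
  ultimately have u: "uniform_limit Z f (\<lambda>z. f 0 z + (\<Sum>i. f (Suc i) z - f i z)) sequentially"
    by simp
  moreover have "lim (\<lambda>n. f n z) = f 0 z + (\<Sum>i. f (Suc i) z - f i z)" if "z \<in> Z" for z
    by (rule limI) (rule tendsto_uniform_limitI[OF u that])
  ultimately show ?thesis
    by (simp cong: uniform_limit_cong')
qed

section \<open>Iterates: positivity, monotonicity and the enlarged cone\<close>

text \<open>The data are indexed by direction like the components: \<open>F 1\<close> is
  \<open>f\<close> and \<open>F (-1)\<close> is \<open>g\<close>. \<open>F'_small\<close> is (A4),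
  with \<open>1 + 1 / \<theta>\<close> in the role of \<open>2 + \<epsilon>0\<close> and
  \<open>M\<close> bounding the derivatives.\<close>

locale iterates = nonlinearity p \<mu> "\<gamma>1 + \<gamma>2" for p \<mu> \<gamma>1 \<gamma>2 :: real +
  fixes \<theta> L M :: real and F F' :: "real \<Rightarrow> real \<Rightarrow> real"
  assumes \<theta>: "0 < \<theta>" "\<theta> < 1" and \<gamma>1: "0 < \<gamma>1" and \<gamma>2: "0 < \<gamma>2" and M: "0 \<le> M"
    and F_ge1: "\<bar>x\<bar> < L \<Longrightarrow> \<gamma>1 \<le> F 1 x" and F_ge2: "\<bar>x\<bar> < L \<Longrightarrow> \<gamma>2 \<le> F (-1) x"
    and F_deriv: "\<sigma> \<in> {1, -1} \<Longrightarrow> \<bar>x\<bar> < L \<Longrightarrow> (F \<sigma> has_real_derivative F' \<sigma> x) (at x)"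
    and F'_cont: "\<sigma> \<in> {1, -1} \<Longrightarrow> continuous_on {x. \<bar>x\<bar> < L} (F' \<sigma>)"
    and F'_le: "\<sigma> \<in> {1, -1} \<Longrightarrow> \<bar>x\<bar> < L \<Longrightarrow> \<bar>F' \<sigma> x\<bar> \<le> M"
    and F'_small: "(1 + 1 / \<theta>) * M \<le> Nl p \<mu> (\<gamma>1 + \<gamma>2) 0"
begin

definition Phi :: "nat \<Rightarrow> real \<Rightarrow> real \<Rightarrow> real \<Rightarrow> real" where
  "Phi n \<sigma> = (if \<sigma> = 1 then fst (iter p \<mu> (F 1) (F (-1)) \<gamma>1 \<gamma>2 n) else snd (iter p \<mu> (F 1) (F (-1)) \<gamma>1 \<gamma>2 n))"

definition Gam :: "real \<Rightarrow> real" where "Gam \<sigma> = (if \<sigma> = 1 then \<gamma>1 else \<gamma>2)"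

definition U :: "nat \<Rightarrow> real \<Rightarrow> real \<Rightarrow> real" where "U n x t = Phi n 1 x t + Phi n (-1) x t"

definition WN :: "nat \<Rightarrow> real \<Rightarrow> real \<Rightarrow> real" where "WN n x t = Nl p \<mu> (U n x t) t"

lemma Phi_0: "Phi 0 \<sigma> x t = Gam \<sigma>"
  by (simp add: Phi_def Gam_def)

lemma Phi_Suc:
  assumes "\<sigma> \<in> {1, -1}"
  shows "Phi (Suc n) \<sigma> x t = F \<sigma> (x + \<sigma> * t) + integral {0..t} (\<lambda>s. WN n (x + \<sigma> * (t - s)) s)"
proof -
  have "x + -1 * (t - s) = x - t + s" "x + 1 * (t - s) = x + t - s" for s by simp_all
  note e = this
  show ?thesis using assms
    by (elim insertE emptyE) (simp_all only: e Phi_def WN_def U_def iter.simps Let_def fst_conv snd_conv if_True if_False, simp_all)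
qed

lemma F_ge: "\<sigma> \<in> {1, -1} \<Longrightarrow> \<bar>x\<bar> < L \<Longrightarrow> Gam \<sigma> \<le> F \<sigma> x"
  using F_ge1 F_ge2 by (auto simp: Gam_def)

lemma Gam: "\<sigma> \<in> {1, -1} \<Longrightarrow> 0 < Gam \<sigma>" "Gam 1 + Gam (-1) = \<gamma>1 + \<gamma>2"
  using \<gamma>1 \<gamma>2 by (auto simp: Gam_def)

lemma continuous_on_Nl:
  assumes "continuous_on S (\<lambda>(x, t). w x t)" "S \<subseteq> cone_domain L" "\<And>x t. (x, t) \<in> S \<Longrightarrow> \<gamma>1 + \<gamma>2 \<le> w x t"
  shows "continuous_on S (\<lambda>(x, t). Nl p \<mu> (w x t) t)"
    "continuous_on S (\<lambda>(x, t). Nu p \<mu> (w x t) t)"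
proof -
  have "w (fst z) (snd z) \<noteq> 0" "1 + snd z \<noteq> 0" "2 + snd z * 2 \<noteq> 0" "2 + 2 * snd z \<noteq> 0" if "z \<in> S" for z
    using assms(2) assms(3)[of "fst z" "snd z"] that \<gamma> by (auto simp: cone_domain_def)
  then show "continuous_on S (\<lambda>(x, t). Nl p \<mu> (w x t) t)"
    "continuous_on S (\<lambda>(x, t). Nu p \<mu> (w x t) t)"
    using assms(1) unfolding Nl_def Nu_def case_prod_unfold by (auto intro!: continuous_intros)
qed

text \<open>One joint induction: continuity of the nonlinearity is obtained from the lower bound on
  the sum, and the lower bound of the next iterate needs integrability, hence continuity.\<close>

lemma Phi_cont_ge:
  assumes "\<sigma> \<in> {1, -1}"
  shows "continuous_on (cone_domain L) (\<lambda>(x, t). Phi n \<sigma> x t) \<and> (\<forall>x t. (x, t) \<in> cone_domain L \<longrightarrow> Gam \<sigma> \<le> Phi n \<sigma> x t)"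
  using assms
proof (induction n arbitrary: \<sigma>)
  case 0
  then show ?case by (simp add: Phi_0)
next
  case (Suc n)
  have Uge: "\<gamma>1 + \<gamma>2 \<le> U n x t" if "(x, t) \<in> cone_domain L" for x t
    using Suc.IH[of 1] Suc.IH[of "-1"] that Gam(2) unfolding U_def by (smt (verit) insertCI)
  have "continuous_on (cone_domain L) (\<lambda>(x, t). U n x t)"
    using Suc.IH[of 1] Suc.IH[of "-1"] unfolding U_def case_prod_unfold by (auto intro!: continuous_intros)
  then have W: "continuous_on (cone_domain L) (\<lambda>(x, t). WN n x t)"
    unfolding WN_def by (rule continuous_on_Nl(1)) (use Uge in auto)
  have Fc: "continuous_on {x. \<bar>x\<bar> < L} (F \<sigma>)"
    by (rule DERIV_continuous_on) (use F_deriv[OF Suc.prems] in \<open>auto intro: has_field_derivative_at_within\<close>)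
  have "continuous_on (cone_domain L) (\<lambda>z. F \<sigma> (fst z + \<sigma> * snd z))"
    by (rule continuous_on_compose2[OF Fc])
      (use cone_domain_foot[OF _ Suc.prems] in \<open>auto intro!: continuous_intros\<close>)
  moreover have "continuous_on (cone_domain L) (\<lambda>(x, t). integral {0..t} (\<lambda>s. WN n (x + \<sigma> * (t - s)) s))"
    by (rule continuous_on_characteristic_integral[OF W Suc.prems])
  ultimately have "continuous_on (cone_domain L) (\<lambda>(x, t). Phi (Suc n) \<sigma> x t)"
    unfolding Phi_Suc[OF Suc.prems] case_prod_unfold by (rule continuous_on_add)
  moreover have "Gam \<sigma> \<le> Phi (Suc n) \<sigma> x t" if z: "(x, t) \<in> cone_domain L" for x t
  proof -
    have "0 \<le> integral {0..t} (\<lambda>s. WN n (x + \<sigma> * (t - s)) s)"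
    proof (rule integral_nonneg)
      show "(\<lambda>s. WN n (x + \<sigma> * (t - s)) s) integrable_on {0..t}"
        by (intro integrable_continuous_interval continuous_on_characteristic[OF W z Suc.prems])
      fix s assume s: "s \<in> {0..t}"
      then show "0 \<le> WN n (x + \<sigma> * (t - s)) s"
        using Nl_bounds(3)[OF Uge[OF cone_domain_backward[OF z Suc.prems]], of s s] by (simp add: WN_def)
    qed
    then show ?thesis
      unfolding Phi_Suc[OF Suc.prems] using F_ge[OF Suc.prems cone_domain_foot[OF z Suc.prems]] by linarith
  qed
  ultimately show ?case by blast
qed

lemmas Phi_cont = Phi_cont_ge[THEN conjunct1]
lemmas Phi_ge = Phi_cont_ge[THEN conjunct2, rule_format]

lemma U_ge: "(x, t) \<in> cone_domain L \<Longrightarrow> \<gamma>1 + \<gamma>2 \<le> U n x t"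
  using Phi_ge[of 1 x t n] Phi_ge[of "-1" x t n] Gam(2) by (simp add: U_def)

lemma U_cont: "continuous_on (cone_domain L) (\<lambda>(x, t). U n x t)"
  using Phi_cont[of 1 n] Phi_cont[of "-1" n] unfolding U_def case_prod_unfold
  by (auto intro!: continuous_intros)

lemma WN_cont: "continuous_on (cone_domain L) (\<lambda>(x, t). WN n x t)"
  unfolding WN_def by (rule continuous_on_Nl(1)[OF U_cont]) (use U_ge in auto)

lemma WN_char_cont:
  "(x, t) \<in> cone_domain L \<Longrightarrow> \<sigma> \<in> {1, -1} \<Longrightarrow> continuous_on {0..t} (\<lambda>s. WN n (x + \<sigma> * (t - s)) s)"
  by (rule continuous_on_characteristic[OF WN_cont])

lemma Phi_mono_Suc:
  assumes "\<sigma> \<in> {1, -1}" "(x, t) \<in> cone_domain L"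
  shows "Phi n \<sigma> x t \<le> Phi (Suc n) \<sigma> x t"
  using assms
proof (induction n arbitrary: \<sigma> x t)
  case 0
  then show ?case using Phi_ge[of \<sigma> x t 1] by (simp add: Phi_0)
next
  case (Suc n)
  have "integral {0..t} (\<lambda>s. WN n (x + \<sigma> * (t - s)) s) \<le> integral {0..t} (\<lambda>s. WN (Suc n) (x + \<sigma> * (t - s)) s)"
  proof (rule integral_le)
    fix s assume s: "s \<in> {0..t}"
    have z: "(x + \<sigma> * (t - s), s) \<in> cone_domain L" using cone_domain_backward[OF Suc.prems(2,1)] s by simp
    have "U n (x + \<sigma> * (t - s)) s \<le> U (Suc n) (x + \<sigma> * (t - s)) s"
      unfolding U_def by (intro add_mono Suc.IH z) auto
    then show "WN n (x + \<sigma> * (t - s)) s \<le> WN (Suc n) (x + \<sigma> * (t - s)) s"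
      unfolding WN_def using U_ge[OF z] s by (intro Nl_mono) auto
  qed (intro integrable_continuous_interval WN_char_cont Suc.prems)+
  then show ?case by (subst (1 2) Phi_Suc[OF Suc.prems(1)]) simp
qed

lemma F_lipschitz:
  assumes "\<sigma> \<in> {1, -1}" "\<bar>x\<bar> < L" "\<bar>y\<bar> < L"
  shows "\<bar>F \<sigma> y - F \<sigma> x\<bar> \<le> M * \<bar>y - x\<bar>"
proof -
  have "norm (F \<sigma> y - F \<sigma> x) \<le> M * norm (y - x)"
    by (rule field_differentiable_bound[of "{-L<..<L}" _ "F' \<sigma>"])
      (use assms F_deriv[OF assms(1)] F'_le[OF assms(1)] in \<open>auto intro: has_field_derivative_at_within\<close>)
  then show ?thesis by simp
qed

text \<open>The cone of admissible directions is strictly wider than the light cone; this is what the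
  smallness of the derivatives of the data buys.\<close>

lemma Phi_cone:
  assumes "\<sigma> \<in> {1, -1}" "(x, t) \<in> cone_domain L" "(x + h, t + k) \<in> cone_domain L" "\<theta> * \<bar>h\<bar> \<le> k"
  shows "Phi n \<sigma> x t \<le> Phi n \<sigma> (x + h) (t + k)"
  using assms(1-3)
proof (induction n arbitrary: \<sigma> x t)
  case 0
  then show ?case by (simp add: Phi_0)
next
  case (Suc n)
  note \<sigma> = Suc.prems(1) and z = Suc.prems(2) and z' = Suc.prems(3)
  have k: "0 \<le> k" using assms(4) \<theta> mult_nonneg_nonneg[of \<theta> "\<bar>h\<bar>"] by linarith
  have t: "0 \<le> t" using z by (auto simp: cone_domain_def)
  define w where "w s = WN n (x + h + \<sigma> * (t + k - s)) s" for s
  have wc: "continuous_on {0..t + k} w"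
    unfolding w_def by (rule WN_char_cont[OF z' \<sigma>])
  \<comment> \<open>The later integral is longer by \<open>k\<close>. Its first stretch yields at
    least \<open>N0 * k\<close>, which pays for the change of the data between the two feet, at most
    \<open>M * (\<bar>h\<bar> + k) \<le> (1 + 1 / \<theta>) * M * k\<close>; the rest is a translate
    of the earlier integral and is compared by induction.\<close>
  define N0 where "N0 = Nl p \<mu> (\<gamma>1 + \<gamma>2) 0"
  have "integral {0..k} w + integral {k..t + k} w = integral {0..t + k} w"
    by (rule Henstock_Kurzweil_Integration.integral_combine) (use k t wc in \<open>auto intro!: integrable_continuous_interval\<close>)
  moreover have "integral {k..t + k} w = integral {0..t} (w \<circ> (+) k)"
    by (subst integral_shift_Icc_real) simp
  moreover have "integral {0..t} (\<lambda>s. WN n (x + \<sigma> * (t - s)) s) \<le> integral {0..t} (w \<circ> (+) k)"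
  proof (rule integral_le)
    show "(\<lambda>s. WN n (x + \<sigma> * (t - s)) s) integrable_on {0..t}"
      by (intro integrable_continuous_interval WN_char_cont z \<sigma>)
    show "(w \<circ> (+) k) integrable_on {0..t}"
      by (intro integrable_continuous_interval continuous_on_compose continuous_intros continuous_on_subset[OF wc])
        (use k in auto)
    fix s assume s: "s \<in> {0..t}"
    have a: "(x + \<sigma> * (t - s), s) \<in> cone_domain L" using cone_domain_backward[OF z \<sigma>] s by simp
    have "x + h + \<sigma> * (t + k - (s + k)) = x + \<sigma> * (t - s) + h" by simp
    then have b: "(x + \<sigma> * (t - s) + h, s + k) \<in> cone_domain L"
      using cone_domain_backward[OF z' \<sigma>, of "s + k"] s k by (metis add_increasing add_right_mono atLeastAtMost_iff)
    have "U n (x + \<sigma> * (t - s)) s \<le> U n (x + \<sigma> * (t - s) + h) (s + k)"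
      unfolding U_def by (intro add_mono Suc.IH a b) auto
    then have "WN n (x + \<sigma> * (t - s)) s \<le> WN n (x + \<sigma> * (t - s) + h) (s + k)"
      unfolding WN_def using U_ge[OF a] s k by (intro Nl_mono) auto
    then show "WN n (x + \<sigma> * (t - s)) s \<le> (w \<circ> (+) k) s"
      by (simp add: w_def add_ac)
  qed
  moreover have "N0 * k \<le> integral {0..k} w"
  proof -
    have "integral {0..k} (\<lambda>_. N0) \<le> integral {0..k} w"
    proof (rule integral_le)
      show "w integrable_on {0..k}"
        by (intro integrable_continuous_interval continuous_on_subset[OF wc]) (use t in auto)
      fix s assume s: "s \<in> {0..k}"
      have "(x + h + \<sigma> * (t + k - s), s) \<in> cone_domain L"
        using cone_domain_backward[OF z' \<sigma>] s t by simp
      then show "N0 \<le> w s" unfolding w_def WN_def N0_def using U_ge s by (intro Nl_mono) auto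
    qed (simp add: integrable_const_ivl)
    then show ?thesis using k by (simp add: mult.commute)
  qed
  moreover have "F \<sigma> (x + \<sigma> * t) - N0 * k \<le> F \<sigma> (x + h + \<sigma> * (t + k))"
  proof -
    have "\<bar>F \<sigma> (x + h + \<sigma> * (t + k)) - F \<sigma> (x + \<sigma> * t)\<bar> \<le> M * \<bar>(x + h + \<sigma> * (t + k)) - (x + \<sigma> * t)\<bar>"
      by (rule F_lipschitz[OF \<sigma> cone_domain_foot[OF z \<sigma>] cone_domain_foot[OF z' \<sigma>]])
    also have "\<dots> \<le> M * ((1 + 1 / \<theta>) * k)"
    proof (rule mult_left_mono[OF _ M])
      have "\<bar>h\<bar> \<le> k / \<theta>" using assms(4) \<theta> by (simp add: pos_le_divide_eq mult.commute)
      moreover have "\<bar>\<sigma> * k\<bar> = k" using \<sigma> k by (auto simp: abs_mult)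
      moreover have "(x + h + \<sigma> * (t + k)) - (x + \<sigma> * t) = h + \<sigma> * k" by (simp add: algebra_simps)
      moreover have "\<bar>h + \<sigma> * k\<bar> \<le> \<bar>h\<bar> + \<bar>\<sigma> * k\<bar>" by (rule abs_triangle_ineq)
      ultimately show "\<bar>(x + h + \<sigma> * (t + k)) - (x + \<sigma> * t)\<bar> \<le> (1 + 1 / \<theta>) * k"
        by (simp add: distrib_right)
    qed
    also have "\<dots> = ((1 + 1 / \<theta>) * M) * k" by simp
    also have "\<dots> \<le> N0 * k" unfolding N0_def by (rule mult_right_mono[OF F'_small k])
    finally show ?thesis by linarith
  qed
  moreover have "Phi (Suc n) \<sigma> (x + h) (t + k) = F \<sigma> (x + h + \<sigma> * (t + k)) + integral {0..t + k} w"
    by (simp add: Phi_Suc[OF \<sigma>] w_def[abs_def])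
  ultimately show ?case
    unfolding Phi_Suc[OF \<sigma>, of n x t] by linarith
qed

section \<open>Space derivatives of the iterates\<close>

text \<open>The space derivative of \<open>Phi n\<close> (see \<open>Phi_has_derivative\<close>),
  given by the differentiated recursion so that continuity and bounds can be obtained by
  induction.\<close>

primrec Da :: "nat \<Rightarrow> real \<Rightarrow> real \<Rightarrow> real \<Rightarrow> real" where
  "Da 0 = (\<lambda>\<sigma> x t. 0)"
| "Da (Suc n) = (\<lambda>\<sigma> x t. F' \<sigma> (x + \<sigma> * t) + integral {0..t} (\<lambda>s.
     Nu p \<mu> (U n (x + \<sigma> * (t - s)) s) s * (Da n 1 (x + \<sigma> * (t - s)) s + Da n (-1) (x + \<sigma> * (t - s)) s)))"

definition VN :: "nat \<Rightarrow> real \<Rightarrow> real \<Rightarrow> real" where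
  "VN n x t = Nu p \<mu> (U n x t) t * (Da n 1 x t + Da n (-1) x t)"

lemma Da_Suc: "Da (Suc n) \<sigma> x t = F' \<sigma> (x + \<sigma> * t) + integral {0..t} (\<lambda>s. VN n (x + \<sigma> * (t - s)) s)"
  by (simp add: VN_def)

lemma Da_cont_aux:
  assumes "\<And>\<sigma>. \<sigma> \<in> {1, -1} \<Longrightarrow> continuous_on (cone_domain L) (\<lambda>(x, t). Da n \<sigma> x t)"
  shows "continuous_on (cone_domain L) (\<lambda>(x, t). VN n x t)"
proof -
  have "continuous_on (cone_domain L) (\<lambda>(x, t). Nu p \<mu> (U n x t) t)"
    by (rule continuous_on_Nl(2)[OF U_cont]) (use U_ge in auto)
  then show ?thesis
    using assms[of 1] assms[of "-1"] unfolding VN_def case_prod_unfold by (auto intro!: continuous_intros)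
qed

lemma Da_cont: "\<sigma> \<in> {1, -1} \<Longrightarrow> continuous_on (cone_domain L) (\<lambda>(x, t). Da n \<sigma> x t)"
proof (induction n arbitrary: \<sigma>)
  case 0
  then show ?case by (simp add: case_prod_unfold)
next
  case (Suc n)
  have "continuous_on (cone_domain L) (\<lambda>z. F' \<sigma> (fst z + \<sigma> * snd z))"
    by (rule continuous_on_compose2[OF F'_cont[OF Suc.prems]])
      (use cone_domain_foot[OF _ Suc.prems] in \<open>auto intro!: continuous_intros\<close>)
  moreover have "continuous_on (cone_domain L) (\<lambda>(x, t). integral {0..t} (\<lambda>s. VN n (x + \<sigma> * (t - s)) s))"
    by (rule continuous_on_characteristic_integral[OF Da_cont_aux[OF Suc.IH] Suc.prems])
  ultimately show ?case
    unfolding Da_Suc case_prod_unfold by (rule continuous_on_add)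
qed

lemma VN_cont: "continuous_on (cone_domain L) (\<lambda>(x, t). VN n x t)"
  by (rule Da_cont_aux) (rule Da_cont)

lemma VN_char_cont:
  "(x, t) \<in> cone_domain L \<Longrightarrow> \<sigma> \<in> {1, -1} \<Longrightarrow> continuous_on {0..t} (\<lambda>s. VN n (x + \<sigma> * (t - s)) s)"
  by (rule continuous_on_characteristic[OF VN_cont])

lemma Phi_has_derivative:
  "\<sigma> \<in> {1, -1} \<Longrightarrow> (x, t) \<in> cone_domain L \<Longrightarrow> ((\<lambda>x. Phi n \<sigma> x t) has_real_derivative Da n \<sigma> x t) (at x)"
proof (induction n arbitrary: \<sigma> x t)
  case 0
  then show ?case by (simp add: Phi_0)
next
  case (Suc n)
  have "((\<lambda>x. integral {0..t} (\<lambda>s. WN n (x + \<sigma> * (t - s)) s)) has_real_derivative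
      integral {0..t} (\<lambda>s. VN n (x + \<sigma> * (t - s)) s)) (at x)"
  proof (rule characteristic_integral_has_derivative[OF WN_cont VN_cont _ Suc.prems(2,1)])
    fix y s assume z: "(y, s) \<in> cone_domain L"
    have "((\<lambda>x. U n x s) has_real_derivative Da n 1 y s + Da n (-1) y s) (at y)"
      unfolding U_def by (intro DERIV_add Suc.IH z) auto
    then show "((\<lambda>x. WN n x s) has_real_derivative VN n y s) (at y)"
      unfolding WN_def VN_def by (rule has_real_derivative_Nl_space) (use U_ge[OF z, of n] \<gamma> in linarith)
  qed
  moreover have "((\<lambda>x. F \<sigma> (x + \<sigma> * t)) has_real_derivative F' \<sigma> (x + \<sigma> * t)) (at x)"
    using F_deriv[OF Suc.prems(1) cone_domain_foot[OF Suc.prems(2,1)]] by (simp add: DERIV_shift)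
  ultimately show ?case
    unfolding Phi_Suc[OF Suc.prems(1)] Da_Suc by (intro DERIV_add)
qed

text \<open>The real-valued form of finiteness of the two suprema; \<open>sup_finite_iff\<close>
  makes the connection.\<close>

definition bounded_at :: "real \<Rightarrow> real \<Rightarrow> bool" where
  "bounded_at x t \<longleftrightarrow> (\<exists>A. \<forall>n. U n x t \<le> A)"

lemma U_cone:
  assumes "(x, t) \<in> cone_domain L" "(y, s) \<in> cone_domain L" "\<theta> * \<bar>y - x\<bar> \<le> s - t"
  shows "U n x t \<le> U n y s"
  using Phi_cone[of 1 x t "y - x" "s - t" n] Phi_cone[of "-1" x t "y - x" "s - t" n] assms
  by (simp add: U_def)

text \<open>\<open>lim\<close> has no useful value where the iterates diverge; \<open>v\<close> and
  \<open>a\<close> are evaluated only in regions below a point of boundedness.\<close>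

definition v :: "real \<Rightarrow> real \<Rightarrow> real \<Rightarrow> real" where "v \<sigma> x t = lim (\<lambda>n. Phi n \<sigma> x t)"
definition a :: "real \<Rightarrow> real \<Rightarrow> real \<Rightarrow> real" where "a \<sigma> x t = lim (\<lambda>n. Da n \<sigma> x t)"

section \<open>Uniform convergence below a point of boundedness\<close>

text \<open>The backward cone of \<open>(y, r)\<close> for the enlarged set of directions. By
  \<open>U_cone\<close> a bound on all \<open>U n y r\<close> holds on the whole of it, and since
  \<theta> < 1 it contains the backward characteristics of its points.\<close>

definition region :: "real \<Rightarrow> real \<Rightarrow> (real \<times> real) set" where
  "region y r = {(x, t) \<in> cone_domain L. \<theta> * \<bar>x - y\<bar> \<le> r - t}"

lemma region_backward:
  assumes "(x, t) \<in> region y r" "\<sigma> \<in> {1, -1}" "0 \<le> s" "s \<le> t"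
  shows "(x + \<sigma> * (t - s), s) \<in> region y r"
proof -
  have "\<bar>x + \<sigma> * (t - s) - y\<bar> \<le> \<bar>x - y\<bar> + (t - s)" using assms by auto
  then have "\<theta> * \<bar>x + \<sigma> * (t - s) - y\<bar> \<le> \<theta> * \<bar>x - y\<bar> + \<theta> * (t - s)"
    using mult_left_mono[of _ _ \<theta>] \<theta> by (fastforce simp: distrib_left)
  moreover have "\<theta> * (t - s) \<le> 1 * (t - s)" by (rule mult_right_mono) (use \<theta> assms in auto)
  ultimately show ?thesis
    using assms cone_domain_backward[OF _ assms(2-4), of x L] by (auto simp: region_def)
qed

lemma region_char:
  assumes "(x, t) \<in> region y r" "\<sigma> \<in> {1, -1}"
  shows "(x, t) \<in> cone_domain L" "0 \<le> t"
    and "\<And>s. 0 \<le> s \<Longrightarrow> s \<le> t \<Longrightarrow> (x + \<sigma> * (t - s), s) \<in> region y r"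
  using assms region_backward by (auto simp: region_def cone_domain_def)

lemma region_time:
  assumes "(x, t) \<in> region y r"
  shows "t \<le> r"
proof -
  have "0 \<le> \<theta> * \<bar>x - y\<bar>" using \<theta> by simp
  then show ?thesis using assms unfolding region_def by auto
qed

context
  fixes y r A :: real
  assumes yr: "(y, r) \<in> cone_domain L" and A: "\<And>n. U n y r \<le> A"
begin

lemma region_le: "(x, t) \<in> region y r \<Longrightarrow> U n x t \<le> A"
  using U_cone[of x t y r n] A[of n] yr by (auto simp: region_def abs_minus_commute)

lemma region_Phi_le: "(x, t) \<in> region y r \<Longrightarrow> \<sigma> \<in> {1, -1} \<Longrightarrow> Phi n \<sigma> x t \<le> A"
  using region_le[of x t n] Phi_ge[of 1 x t n] Phi_ge[of "-1" x t n] Gam(1)[of 1] Gam(1)[of "-1"]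
  by (auto simp: U_def region_def)

lemma A_ge: "\<gamma>1 + \<gamma>2 \<le> A" using U_ge[OF yr, of 0] A[of 0] by linarith

definition LN :: real where "LN = p * 2 powr (-p) * A powr (p - 1)"
text \<open>\<open>LN\<close> is the Lipschitz constant of the nonlinearity for values up to
  \<open>A\<close>. Two components couple, so one iteration multiplies weighted differences by
  \<open>2 * LN / K\<close>, and the 8 makes this at most 1/4; the summand 1 keeps \<open>K\<close>
  positive.\<close>

definition K :: real where "K = 8 * LN + 1"

lemma LN: "0 \<le> LN" "0 < K" "8 * LN \<le> K" "1 \<le> K"
proof -
  show "0 \<le> LN" using p by (simp add: LN_def)
  then show "0 < K" "8 * LN \<le> K" "1 \<le> K" by (simp_all add: K_def)
qed

lemma Nu_U_le:
  assumes "(x, t) \<in> region y r"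
  shows "0 \<le> Nu p \<mu> (U n x t) t" "Nu p \<mu> (U n x t) t \<le> LN"
proof -
  have z: "(x, t) \<in> cone_domain L" "0 \<le> t" using assms by (auto simp: region_def cone_domain_def)
  show "0 \<le> Nu p \<mu> (U n x t) t" using Nu_bounds(3)[OF U_ge[OF z(1), of n] z(2)] by simp
  have "U n x t powr (p - 1) \<le> A powr (p - 1)"
    using region_le[OF assms, of n] U_ge[OF z(1), of n] \<gamma> p by (intro powr_mono2) auto
  then have "p * 2 powr (-p) * U n x t powr (p - 1) \<le> LN"
    unfolding LN_def by (rule mult_left_mono) (use p in auto)
  then show "Nu p \<mu> (U n x t) t \<le> LN" using Nu_bounds(2)[OF U_ge[OF z(1), of n] z(2)] by linarith
qed

lemma WN_diff_le:
  assumes "(x, t) \<in> region y r"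
  shows "\<bar>WN m x t - WN n x t\<bar> \<le> LN * \<bar>U m x t - U n x t\<bar>"
proof -
  have z: "(x, t) \<in> cone_domain L" "0 \<le> t" using assms by (auto simp: region_def cone_domain_def)
  show ?thesis
    unfolding WN_def LN_def by (rule Nl_lipschitz) (use U_ge[OF z(1)] region_le[OF assms] z in auto)
qed

lemma Phi_geometric:
  "\<sigma> \<in> {1, -1} \<Longrightarrow> (x, t) \<in> region y r \<Longrightarrow> \<bar>Phi (Suc n) \<sigma> x t - Phi n \<sigma> x t\<bar> \<le> A * exp (K * t) * (1 / 4) ^ n"
proof (induction n arbitrary: \<sigma> x t)
  case 0
  note z = region_char[OF 0(2,1)]
  have "\<bar>Phi (Suc 0) \<sigma> x t - Phi 0 \<sigma> x t\<bar> \<le> A"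
    using region_Phi_le[OF 0(2,1), of 0] region_Phi_le[OF 0(2,1), of 1]
      Phi_ge[OF 0(1) z(1), of 0] Phi_ge[OF 0(1) z(1), of 1] Gam(1)[OF 0(1)] by auto
  also have "\<dots> \<le> A * exp (K * t)"
    using A_ge \<gamma> LN z by (simp add: mult_le_cancel_left1)
  finally show ?case by simp
next
  case (Suc n)
  note \<sigma> = Suc.prems(1)
  note z = region_char[OF Suc.prems(2,1)]
  define w where "w s = WN (Suc n) (x + \<sigma> * (t - s)) s - WN n (x + \<sigma> * (t - s)) s" for s
  have "Phi (Suc (Suc n)) \<sigma> x t - Phi (Suc n) \<sigma> x t = integral {0..t} w"
    unfolding Phi_Suc[OF \<sigma>] w_def
    by (simp add: Henstock_Kurzweil_Integration.integral_diff integrable_continuous_interval WN_char_cont[OF z(1) \<sigma>])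
  moreover have "\<bar>integral {0..t} w\<bar> \<le> (2 * LN * A * (1 / 4) ^ n) / K * (exp (K * t) - 1)"
  proof (rule abs_integral_exp_bound[OF z(2) LN(2)])
    show "continuous_on {0..t} w"
      unfolding w_def by (intro continuous_intros WN_char_cont[OF z(1) \<sigma>])
    fix s assume s: "0 \<le> s" "s \<le> t"
    note zs = z(3)[OF s]
    have "\<bar>U (Suc n) (x + \<sigma> * (t - s)) s - U n (x + \<sigma> * (t - s)) s\<bar> \<le> 2 * (A * exp (K * s) * (1 / 4) ^ n)"
      using Suc.IH[of 1, OF _ zs] Suc.IH[of "-1", OF _ zs] unfolding U_def by simp
    then have "LN * \<bar>U (Suc n) (x + \<sigma> * (t - s)) s - U n (x + \<sigma> * (t - s)) s\<bar> \<le> LN * (2 * (A * exp (K * s) * (1 / 4) ^ n))"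
      by (rule mult_left_mono[OF _ LN(1)])
    then show "\<bar>w s\<bar> \<le> 2 * LN * A * (1 / 4) ^ n * exp (K * s)"
      using WN_diff_le[OF zs, of "Suc n" n] unfolding w_def by (simp add: mult_ac)
  qed
  moreover have "(2 * LN * A * (1 / 4) ^ n) / K * (exp (K * t) - 1) \<le> A * exp (K * t) * (1 / 4) ^ Suc n"
  proof -
    have "2 * LN / K \<le> 1 / 4" using LN by (simp add: field_simps)
    then have "2 * LN / K * (A * (1 / 4) ^ n * exp (K * t)) \<le> 1 / 4 * (A * (1 / 4) ^ n * exp (K * t))"
      by (rule mult_right_mono) (use A_ge \<gamma> in auto)
    moreover have "2 * LN / K * (A * (1 / 4) ^ n * (exp (K * t) - 1)) \<le> 2 * LN / K * (A * (1 / 4) ^ n * exp (K * t))"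
      by (intro mult_left_mono) (use A_ge \<gamma> LN in auto)
    ultimately have "2 * LN / K * (A * (1 / 4) ^ n * (exp (K * t) - 1)) \<le> 1 / 4 * (A * (1 / 4) ^ n * exp (K * t))"
      by linarith
    then show ?thesis by (simp add: mult_ac)
  qed
  ultimately show ?case by simp
qed

text \<open>A uniform bound is needed before differences can be estimated, because \<open>Da\<close>
  multiplies differences of \<open>Nu\<close> in \<open>Da_geometric\<close>; it also supplies the
  dominating constant in \<open>a_integral\<close>.\<close>

lemma Da_le: "\<sigma> \<in> {1, -1} \<Longrightarrow> (x, t) \<in> region y r \<Longrightarrow> \<bar>Da n \<sigma> x t\<bar> \<le> M * exp (K * t)"
proof (induction n arbitrary: \<sigma> x t)
  case 0
  then show ?case using M by simp
next
  case (Suc n)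
  note \<sigma> = Suc.prems(1)
  note z = region_char[OF Suc.prems(2,1)]
  have "\<bar>integral {0..t} (\<lambda>s. VN n (x + \<sigma> * (t - s)) s)\<bar> \<le> (2 * LN * M) / K * (exp (K * t) - 1)"
  proof (rule abs_integral_exp_bound[OF z(2) LN(2) VN_char_cont[OF z(1) \<sigma>]])
    fix s assume s: "0 \<le> s" "s \<le> t"
    note zs = z(3)[OF s]
    have "\<bar>Da n 1 (x + \<sigma> * (t - s)) s + Da n (-1) (x + \<sigma> * (t - s)) s\<bar> \<le> 2 * (M * exp (K * s))"
      using Suc.IH[of 1, OF _ zs] Suc.IH[of "-1", OF _ zs] by simp
    then have "\<bar>Nu p \<mu> (U n (x + \<sigma> * (t - s)) s) s\<bar> * \<bar>Da n 1 (x + \<sigma> * (t - s)) s + Da n (-1) (x + \<sigma> * (t - s)) s\<bar>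
        \<le> LN * (2 * (M * exp (K * s)))"
      using Nu_U_le[OF zs, of n] LN by (intro mult_mono) auto
    then show "\<bar>VN n (x + \<sigma> * (t - s)) s\<bar> \<le> 2 * LN * M * exp (K * s)"
      by (simp add: VN_def abs_mult mult_ac)
  qed
  also have "\<dots> \<le> M * (exp (K * t) - 1)"
  proof (rule mult_right_mono)
    have "2 * LN / K \<le> 1" using LN by (simp add: field_simps)
    then show "2 * LN * M / K \<le> M" using mult_right_mono[of "2 * LN / K" 1 M] M by simp
  qed (use LN z in auto)
  finally have "\<bar>integral {0..t} (\<lambda>s. VN n (x + \<sigma> * (t - s)) s)\<bar> \<le> M * exp (K * t) - M"
    by (simp add: algebra_simps)
  moreover have "\<bar>F' \<sigma> (x + \<sigma> * t)\<bar> \<le> M" by (rule F'_le[OF \<sigma> cone_domain_foot[OF z(1) \<sigma>]])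
  ultimately show ?case unfolding Da_Suc by linarith
qed

text \<open>The difference of consecutive \<open>VN\<close> splits into \<open>Nu\<close> times a
  difference of \<open>Da\<close>, which contracts, and a difference of \<open>Nu\<close> times
  \<open>Da\<close>, which is a source decaying like the differences of \<open>Phi\<close>. The rate
  1/2 leaves room for both.\<close>

lemma Da_geometric:
  "\<exists>B. \<forall>n \<sigma> x t. \<sigma> \<in> {1, -1} \<longrightarrow> (x, t) \<in> region y r \<longrightarrow>
     \<bar>Da (Suc n) \<sigma> x t - Da n \<sigma> x t\<bar> \<le> B * exp (K * t) * (1 / 2) ^ n"
proof -
  obtain L2 where L2: "0 \<le> L2" "\<And>u w s. (\<gamma>1 + \<gamma>2) \<le> u \<and> u \<le> A \<and> (\<gamma>1 + \<gamma>2) \<le> w \<and> w \<le> A \<Longrightarrow>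
      \<bar>Nu p \<mu> w s - Nu p \<mu> u s\<bar> \<le> L2 * \<bar>w - u\<bar>"
    using Nu_lipschitz[of A] by metis
  define C4 where "C4 = L2 * (2 * A) * (2 * (M * exp (K * r)))"
  have C4: "0 \<le> C4" using L2 A_ge \<gamma> M by (simp add: C4_def)
  \<comment> \<open>\<open>M\<close> covers the first difference. \<open>B \<ge> 4 * C4\<close>
    gives the source one quarter of \<open>B\<close>; the contracting part takes another quarter,
    together \<open>B / 2\<close>.\<close>
  define B where "B = M + 4 * C4"
  have B: "0 \<le> B" using M C4 by (simp add: B_def)
  have "\<sigma> \<in> {1, -1} \<Longrightarrow> (x, t) \<in> region y r \<Longrightarrow>
     \<bar>Da (Suc n) \<sigma> x t - Da n \<sigma> x t\<bar> \<le> B * exp (K * t) * (1 / 2) ^ n" for n \<sigma> x t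
  proof (induction n arbitrary: \<sigma> x t)
    case 0
    have "\<bar>Da (Suc 0) \<sigma> x t\<bar> \<le> M * exp (K * t)" by (rule Da_le[OF 0])
    also have "\<dots> \<le> B * exp (K * t)" using C4 by (intro mult_right_mono) (auto simp: B_def)
    finally show ?case by simp
  next
    case (Suc n)
    note \<sigma> = Suc.prems(1)
    note z = region_char[OF Suc.prems(2,1)]
    define w where "w s = VN (Suc n) (x + \<sigma> * (t - s)) s - VN n (x + \<sigma> * (t - s)) s" for s
    have "Da (Suc (Suc n)) \<sigma> x t - Da (Suc n) \<sigma> x t = integral {0..t} w"
      unfolding Da_Suc w_def
      by (simp add: Henstock_Kurzweil_Integration.integral_diff integrable_continuous_interval VN_char_cont[OF z(1) \<sigma>])
    moreover have "\<bar>integral {0..t} w\<bar> \<le> ((2 * LN * B + C4) * (1 / 2) ^ n) / K * (exp (K * t) - 1)"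
    proof (rule abs_integral_exp_bound[OF z(2) LN(2)])
      show "continuous_on {0..t} w"
        unfolding w_def by (intro continuous_intros VN_char_cont[OF z(1) \<sigma>])
      fix s assume s: "0 \<le> s" "s \<le> t"
      note zs = z(3)[OF s]
      define x' where "x' = x + \<sigma> * (t - s)"
      have zs': "(x', s) \<in> region y r" using zs by (simp add: x'_def)
      define N1 N0 where "N1 = Nu p \<mu> (U (Suc n) x' s) s" and "N0 = Nu p \<mu> (U n x' s) s"
      define S1 S0 where "S1 = Da (Suc n) 1 x' s + Da (Suc n) (-1) x' s" and "S0 = Da n 1 x' s + Da n (-1) x' s"
      define e where "e = exp (K * s)"
      have "\<bar>S1 - S0\<bar> \<le> 2 * (B * e * (1 / 2) ^ n)"
        using Suc.IH[of 1, OF _ zs'] Suc.IH[of "-1", OF _ zs'] unfolding S1_def S0_def e_def by simp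
      then have 1: "\<bar>N1\<bar> * \<bar>S1 - S0\<bar> \<le> LN * (2 * (B * e * (1 / 2) ^ n))"
        using Nu_U_le[OF zs', of "Suc n"] LN unfolding N1_def by (intro mult_mono) auto
      have "\<bar>U (Suc n) x' s - U n x' s\<bar> \<le> 2 * (A * e * (1 / 4) ^ n)"
        using Phi_geometric[of 1, OF _ zs', of n] Phi_geometric[of "-1", OF _ zs', of n]
        unfolding U_def e_def by simp
      also have "\<dots> \<le> 2 * (A * e * (1 / 2) ^ n)"
        using A_ge \<gamma> by (intro mult_left_mono power_mono) (auto simp: e_def)
      finally have "L2 * \<bar>U (Suc n) x' s - U n x' s\<bar> \<le> L2 * (2 * (A * e * (1 / 2) ^ n))"
        by (rule mult_left_mono[OF _ L2(1)])
      moreover have "\<bar>N1 - N0\<bar> \<le> L2 * \<bar>U (Suc n) x' s - U n x' s\<bar>"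
        unfolding N1_def N0_def
        by (rule L2(2)) (use region_le[OF zs'] U_ge zs' in \<open>auto simp: region_def\<close>)
      ultimately have 2: "\<bar>N1 - N0\<bar> \<le> L2 * (2 * (A * e * (1 / 2) ^ n))" by linarith
      have "s \<le> r" by (rule region_time[OF zs'])
      then have "exp (K * s) \<le> exp (K * r)" using LN by simp
      then have "M * exp (K * s) \<le> M * exp (K * r)" using M by (intro mult_left_mono)
      then have 3: "\<bar>S0\<bar> \<le> 2 * (M * exp (K * r))"
        using Da_le[of 1, OF _ zs', of n] Da_le[of "-1", OF _ zs', of n] unfolding S0_def by simp
      have "\<bar>N1 - N0\<bar> * \<bar>S0\<bar> \<le> L2 * (2 * (A * e * (1 / 2) ^ n)) * (2 * (M * exp (K * r)))"
        by (rule mult_mono[OF 2 3]) (use L2 A_ge \<gamma> in \<open>auto simp: e_def\<close>)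
      also have "\<dots> = C4 * e * (1 / 2) ^ n" by (simp add: C4_def)
      finally have 4: "\<bar>N1 - N0\<bar> * \<bar>S0\<bar> \<le> C4 * e * (1 / 2) ^ n" .
      have "w s = N1 * (S1 - S0) + (N1 - N0) * S0"
        by (simp add: w_def VN_def N1_def N0_def S1_def S0_def x'_def algebra_simps)
      then have "\<bar>w s\<bar> \<le> \<bar>N1\<bar> * \<bar>S1 - S0\<bar> + \<bar>N1 - N0\<bar> * \<bar>S0\<bar>"
        by (metis abs_mult abs_triangle_ineq)
      also have "\<dots> \<le> LN * (2 * (B * e * (1 / 2) ^ n)) + C4 * e * (1 / 2) ^ n" using 1 4 by linarith
      also have "\<dots> = (2 * LN * B + C4) * (1 / 2) ^ n * e" by (simp add: algebra_simps)
      finally show "\<bar>w s\<bar> \<le> (2 * LN * B + C4) * (1 / 2) ^ n * exp (K * s)" by (simp add: e_def)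
    qed
    moreover have "((2 * LN * B + C4) * (1 / 2) ^ n) / K * (exp (K * t) - 1) \<le> B * exp (K * t) * (1 / 2) ^ Suc n"
    proof -
      have "2 * LN * B + C4 \<le> B / 2 * K"
      proof -
        have "B * (8 * LN) \<le> B * K" "B * 1 \<le> B * K"
          using LN B by (auto intro!: mult_left_mono simp del: mult_1_right)
        moreover have "4 * C4 \<le> B" using M by (simp add: B_def)
        ultimately show ?thesis by (simp add: algebra_simps)
      qed
      then have le: "(2 * LN * B + C4) / K \<le> B / 2" using LN by (simp add: pos_divide_le_eq)
      have "(2 * LN * B + C4) / K * ((1 / 2) ^ n * (exp (K * t) - 1)) \<le> B / 2 * ((1 / 2) ^ n * exp (K * t))"
        by (rule mult_mono[OF le]) (use LN B z in auto)
      then show ?thesis by (simp add: mult_ac)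
    qed
    ultimately show ?case by linarith
  qed
  then show ?thesis by blast
qed

lemma Phi_uniform:
  assumes \<sigma>: "\<sigma> \<in> {1, -1}"
  shows "uniform_limit (region y r) (\<lambda>n z. Phi n \<sigma> (fst z) (snd z)) (\<lambda>z. v \<sigma> (fst z) (snd z)) sequentially"
  unfolding v_def
proof (rule uniform_limit_geometric[where C = "A * exp (K * r)"])
  fix n z assume "z \<in> region y r"
  then obtain x t where z: "z = (x, t)" "(x, t) \<in> region y r" by (cases z) auto
  have "exp (K * t) \<le> exp (K * r)" using region_time[OF z(2)] LN by simp
  then have "A * exp (K * t) * (1 / 4) ^ n \<le> A * exp (K * r) * (1 / 2) ^ n"
    using A_ge \<gamma> by (intro mult_mono power_mono) auto
  then show "\<bar>Phi (Suc n) \<sigma> (fst z) (snd z) - Phi n \<sigma> (fst z) (snd z)\<bar> \<le> A * exp (K * r) * (1 / 2) ^ n"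
    using Phi_geometric[OF \<sigma> z(2), of n] by (simp add: z)
qed

lemma Da_uniform:
  assumes \<sigma>: "\<sigma> \<in> {1, -1}"
  shows "uniform_limit (region y r) (\<lambda>n z. Da n \<sigma> (fst z) (snd z)) (\<lambda>z. a \<sigma> (fst z) (snd z)) sequentially"
proof -
  obtain B where B: "\<And>n \<sigma> x t. \<sigma> \<in> {1, -1} \<Longrightarrow> (x, t) \<in> region y r \<Longrightarrow>
     \<bar>Da (Suc n) \<sigma> x t - Da n \<sigma> x t\<bar> \<le> B * exp (K * t) * (1 / 2) ^ n"
    using Da_geometric by blast
  show ?thesis
    unfolding a_def
  proof (rule uniform_limit_geometric[where C = "\<bar>B\<bar> * exp (K * r)"])
    fix n z assume "z \<in> region y r"
    then obtain x t where z: "z = (x, t)" "(x, t) \<in> region y r" by (cases z) auto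
    have "exp (K * t) \<le> exp (K * r)" using region_time[OF z(2)] LN by simp
    then have "B * exp (K * t) * (1 / 2) ^ n \<le> \<bar>B\<bar> * exp (K * r) * (1 / 2) ^ n"
      by (intro mult_mono) auto
    then show "\<bar>Da (Suc n) \<sigma> (fst z) (snd z) - Da n \<sigma> (fst z) (snd z)\<bar> \<le> \<bar>B\<bar> * exp (K * r) * (1 / 2) ^ n"
      using B[OF \<sigma> z(2), of n] by (simp only: z fst_conv snd_conv)
  qed
qed

lemma region_tendsto:
  assumes "\<sigma> \<in> {1, -1}" "(x, t) \<in> region y r"
  shows "(\<lambda>n. Phi n \<sigma> x t) \<longlonglongrightarrow> v \<sigma> x t" "(\<lambda>n. Da n \<sigma> x t) \<longlonglongrightarrow> a \<sigma> x t"
  using tendsto_uniform_limitI[OF Phi_uniform[OF assms(1)] assms(2)]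
    tendsto_uniform_limitI[OF Da_uniform[OF assms(1)] assms(2)] by simp_all

lemma region_cont:
  assumes "\<sigma> \<in> {1, -1}"
  shows "continuous_on (region y r) (\<lambda>(x, t). v \<sigma> x t)" "continuous_on (region y r) (\<lambda>(x, t). a \<sigma> x t)"
proof -
  have sub: "region y r \<subseteq> cone_domain L" by (auto simp: region_def)
  show "continuous_on (region y r) (\<lambda>(x, t). v \<sigma> x t)"
    unfolding case_prod_unfold
    by (rule uniform_limit_theorem[OF _ Phi_uniform[OF assms]])
      (use continuous_on_subset[OF Phi_cont[OF assms] sub] in \<open>auto simp: case_prod_unfold\<close>)
  show "continuous_on (region y r) (\<lambda>(x, t). a \<sigma> x t)"
    unfolding case_prod_unfold
    by (rule uniform_limit_theorem[OF _ Da_uniform[OF assms]])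
      (use continuous_on_subset[OF Da_cont[OF assms] sub] in \<open>auto simp: case_prod_unfold\<close>)
qed

end

section \<open>The integral equations for the limit\<close>

definition u :: "real \<Rightarrow> real \<Rightarrow> real" where "u x t = v 1 x t + v (-1) x t"
definition W :: "real \<Rightarrow> real \<Rightarrow> real" where "W x t = Nl p \<mu> (u x t) t"
definition V :: "real \<Rightarrow> real \<Rightarrow> real" where "V x t = Nu p \<mu> (u x t) t * (a 1 x t + a (-1) x t)"

context
  fixes y r A :: real
  assumes yr: "(y, r) \<in> cone_domain L" and A: "\<And>n. U n y r \<le> A"
begin

lemma U_tendsto: "(x, t) \<in> region y r \<Longrightarrow> (\<lambda>n. U n x t) \<longlonglongrightarrow> u x t"
  unfolding U_def u_def by (intro tendsto_add region_tendsto(1)[OF yr A]) auto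

lemma u_bounds:
  assumes "(x, t) \<in> region y r"
  shows "\<gamma>1 + \<gamma>2 \<le> u x t" "u x t \<le> A"
proof -
  have "(x, t) \<in> cone_domain L" using assms by (auto simp: region_def)
  then show "\<gamma>1 + \<gamma>2 \<le> u x t"
    by (intro LIMSEQ_le_const[OF U_tendsto[OF assms]]) (use U_ge in auto)
  show "u x t \<le> A"
    by (intro LIMSEQ_le_const2[OF U_tendsto[OF assms]]) (use region_le[OF yr A assms] in auto)
qed

lemma W_tendsto:
  assumes "(x, t) \<in> region y r"
  shows "(\<lambda>n. WN n x t) \<longlonglongrightarrow> W x t" "(\<lambda>n. VN n x t) \<longlonglongrightarrow> V x t"
proof -
  have nz: "u x t \<noteq> 0" using u_bounds(1)[OF assms] \<gamma> by linarith
  show "(\<lambda>n. WN n x t) \<longlonglongrightarrow> W x t"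
    unfolding WN_def W_def Nl_def by (intro tendsto_intros U_tendsto[OF assms]) (use nz in auto)
  show "(\<lambda>n. VN n x t) \<longlonglongrightarrow> V x t"
    unfolding VN_def V_def Nu_def
    by (intro tendsto_intros U_tendsto[OF assms] region_tendsto(2)[OF yr A _ assms]) (use nz in auto)
qed

lemma WV_cont: "continuous_on (region y r) (\<lambda>(x, t). W x t)" "continuous_on (region y r) (\<lambda>(x, t). V x t)"
proof -
  have sub: "region y r \<subseteq> cone_domain L" by (auto simp: region_def)
  have u: "continuous_on (region y r) (\<lambda>(x, t). u x t)"
    using region_cont(1)[OF yr A, of 1] region_cont(1)[OF yr A, of "-1"]
    unfolding u_def case_prod_unfold by (auto intro!: continuous_intros)
  show "continuous_on (region y r) (\<lambda>(x, t). W x t)"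
    unfolding W_def by (rule continuous_on_Nl(1)[OF u sub u_bounds(1)])
  have "continuous_on (region y r) (\<lambda>(x, t). Nu p \<mu> (u x t) t)"
    by (rule continuous_on_Nl(2)[OF u sub u_bounds(1)])
  then show "continuous_on (region y r) (\<lambda>(x, t). V x t)"
    using region_cont(2)[OF yr A, of 1] region_cont(2)[OF yr A, of "-1"]
    unfolding V_def case_prod_unfold by (auto intro!: continuous_intros)
qed

lemma v_integral:
  assumes \<sigma>: "\<sigma> \<in> {1, -1}" and z: "(x, t) \<in> region y r"
  shows "v \<sigma> x t = F \<sigma> (x + \<sigma> * t) + integral {0..t} (\<lambda>s. W (x + \<sigma> * (t - s)) s)"
proof -
  note c = region_char[OF z \<sigma>]
  have "(\<lambda>n. integral {0..t} (\<lambda>s. WN n (x + \<sigma> * (t - s)) s)) \<longlonglongrightarrow> integral {0..t} (\<lambda>s. W (x + \<sigma> * (t - s)) s)"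
  proof (rule dominated_convergence(2)[where h = "\<lambda>_. 2 powr (-p) * A powr p"])
    show "(\<lambda>s. WN n (x + \<sigma> * (t - s)) s) integrable_on {0..t}" for n
      by (intro integrable_continuous_interval WN_char_cont[OF c(1) \<sigma>])
    show "norm (WN n (x + \<sigma> * (t - s)) s) \<le> 2 powr (-p) * A powr p" if s: "s \<in> {0..t}" for n s
    proof -
      have zs: "(x + \<sigma> * (t - s), s) \<in> region y r" using c(3) s by simp
      then have k: "(x + \<sigma> * (t - s), s) \<in> cone_domain L" by (simp add: region_def)
      define w where "w = U n (x + \<sigma> * (t - s)) s"
      have w: "\<gamma>1 + \<gamma>2 \<le> w" "w \<le> A" using U_ge[OF k] region_le[OF yr A zs] by (auto simp: w_def)
      have "w powr p \<le> A powr p" using w \<gamma> p by (intro powr_mono2) auto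
      then have "2 powr (-p) * w powr p \<le> 2 powr (-p) * A powr p" by (intro mult_left_mono) auto
      moreover have "Nl p \<mu> w s \<le> 2 powr (-p) * w powr p" "0 < Nl p \<mu> w s"
        using Nl_bounds(2,3)[OF w(1), of s] s by auto
      ultimately have "norm (Nl p \<mu> w s) \<le> 2 powr (-p) * A powr p" unfolding real_norm_def by linarith
      then show ?thesis by (simp only: WN_def w_def)
    qed
    show "(\<lambda>n. WN n (x + \<sigma> * (t - s)) s) \<longlonglongrightarrow> W (x + \<sigma> * (t - s)) s" if "s \<in> {0..t}" for s
      by (rule W_tendsto(1)) (use c(3) that in auto)
  qed (simp add: integrable_const_ivl)
  then have "(\<lambda>n. Phi (Suc n) \<sigma> x t) \<longlonglongrightarrow> F \<sigma> (x + \<sigma> * t) + integral {0..t} (\<lambda>s. W (x + \<sigma> * (t - s)) s)"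
    unfolding Phi_Suc[OF \<sigma>] by (intro tendsto_intros)
  then show ?thesis
    using LIMSEQ_unique[OF LIMSEQ_Suc[OF region_tendsto(1)[OF yr A \<sigma> z]]] by simp
qed

lemma a_integral:
  assumes \<sigma>: "\<sigma> \<in> {1, -1}" and z: "(x, t) \<in> region y r"
  shows "a \<sigma> x t = F' \<sigma> (x + \<sigma> * t) + integral {0..t} (\<lambda>s. V (x + \<sigma> * (t - s)) s)"
proof -
  note c = region_char[OF z \<sigma>]
  define C where "C = LN A * (2 * (M * exp (K A * r)))"
  have "(\<lambda>n. integral {0..t} (\<lambda>s. VN n (x + \<sigma> * (t - s)) s)) \<longlonglongrightarrow> integral {0..t} (\<lambda>s. V (x + \<sigma> * (t - s)) s)"
  proof (rule dominated_convergence(2)[where h = "\<lambda>_. C"])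
    show "(\<lambda>s. VN n (x + \<sigma> * (t - s)) s) integrable_on {0..t}" for n
      by (intro integrable_continuous_interval VN_char_cont[OF c(1) \<sigma>])
    show "norm (VN n (x + \<sigma> * (t - s)) s) \<le> C" if s: "s \<in> {0..t}" for n s
    proof -
      have zs: "(x + \<sigma> * (t - s), s) \<in> region y r" using c(3) s by simp
      have "exp (K A * s) \<le> exp (K A * r)" using region_time[OF zs] LN[OF yr A] by simp
      then have "M * exp (K A * s) \<le> M * exp (K A * r)" using M by (intro mult_left_mono)
      then have "\<bar>Da n 1 (x + \<sigma> * (t - s)) s + Da n (-1) (x + \<sigma> * (t - s)) s\<bar> \<le> 2 * (M * exp (K A * r))"
        using Da_le[OF yr A _ zs, of 1 n] Da_le[OF yr A _ zs, of "-1" n] by simp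
      then have "\<bar>Nu p \<mu> (U n (x + \<sigma> * (t - s)) s) s\<bar> * \<bar>Da n 1 (x + \<sigma> * (t - s)) s + Da n (-1) (x + \<sigma> * (t - s)) s\<bar> \<le> C"
        unfolding C_def using Nu_U_le[OF yr A zs, of n] LN[OF yr A] by (intro mult_mono) auto
      then show ?thesis by (simp add: VN_def abs_mult)
    qed
    show "(\<lambda>n. VN n (x + \<sigma> * (t - s)) s) \<longlonglongrightarrow> V (x + \<sigma> * (t - s)) s" if "s \<in> {0..t}" for s
      by (rule W_tendsto(2)) (use c(3) that in auto)
  qed (simp add: integrable_const_ivl)
  then have "(\<lambda>n. Da (Suc n) \<sigma> x t) \<longlonglongrightarrow> F' \<sigma> (x + \<sigma> * t) + integral {0..t} (\<lambda>s. V (x + \<sigma> * (t - s)) s)"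
    unfolding Da_Suc by (intro tendsto_intros)
  then show ?thesis
    using LIMSEQ_unique[OF LIMSEQ_Suc[OF region_tendsto(2)[OF yr A \<sigma> z]]] by simp
qed

section \<open>Differentiability of the limit\<close>

text \<open>An open subset of \<open>region y r\<close> away from the initial line, where two-sided
  derivatives make sense; it contains every earlier positive time on the column of
  \<open>y\<close>.\<close>

definition inner :: "(real \<times> real) set" where
  "inner = {z. 0 < snd z \<and> \<bar>fst z\<bar> + snd z < L \<and> \<theta> * \<bar>fst z - y\<bar> < r - snd z}"

lemma inner_open: "open inner"
  unfolding inner_def by (intro open_Collect_conj open_Collect_less continuous_intros)

lemma inner_region: "inner \<subseteq> region y r"
  by (auto simp: inner_def region_def cone_domain_def)

lemma inner_nbhd:
  assumes "(x, t) \<in> inner"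
  shows "\<exists>e>0. \<forall>x' t'. \<bar>x' - x\<bar> < e \<longrightarrow> \<bar>t' - t\<bar> < e \<longrightarrow> (x', t') \<in> inner"
proof -
  obtain e where e: "e > 0" "ball (x, t) e \<subseteq> inner"
    using inner_open assms open_contains_ball by blast
  have "(x', t') \<in> inner" if "\<bar>x' - x\<bar> < e / 2" "\<bar>t' - t\<bar> < e / 2" for x' t'
  proof -
    have "dist (x, t) (x', t') \<le> dist x x' + dist t t'"
      unfolding dist_Pair_Pair by (rule sqrt_sum_squares_le_sum) auto
    also have "\<dots> < e" using that by (simp add: dist_real_def abs_minus_commute)
    finally show ?thesis using e by auto
  qed
  then show ?thesis using e by (intro exI[of _ "e / 2"]) auto
qed

text \<open>Along the characteristic the foot and the path of integration stay fixed and only the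
  upper limit moves, so this is the fundamental theorem of calculus. It is stated for an abstract
  integrand to serve both \<open>v\<close> and \<open>a\<close>.\<close>

lemma characteristic_derivative:
  assumes k: "continuous_on (region y r) (\<lambda>(x, t). k x t)" and \<sigma>: "\<sigma> \<in> {1, -1}"
    and w: "\<And>x t. (x, t) \<in> region y r \<Longrightarrow> w x t = f0 (x + \<sigma> * t) + integral {0..t} (\<lambda>s. k (x + \<sigma> * (t - s)) s)"
    and z: "(x, t) \<in> inner"
  shows "((\<lambda>s. w (x + \<sigma> * (t - s)) s) has_real_derivative k x t) (at t)"
proof -
  obtain e where e: "e > 0" "\<And>x' t'. \<bar>x' - x\<bar> < e \<Longrightarrow> \<bar>t' - t\<bar> < e \<Longrightarrow> (x', t') \<in> inner"
    using inner_nbhd[OF z] by blast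
  \<comment> \<open>A time slightly after \<open>t\<close> on the same characteristic, so that
    \<open>t\<close> is interior to the interval of integration and the derivative is
    two-sided.\<close>
  define s1 where "s1 = t + e / 2"
  have "(x + \<sigma> * (t - s1), s1) \<in> inner"
    by (rule e(2)) (use e(1) \<sigma> in \<open>auto simp: s1_def\<close>)
  then have z1: "(x + \<sigma> * (t - s1), s1) \<in> region y r" using inner_region by blast
  have eq: "x + \<sigma> * (t - s1) + \<sigma> * (s1 - s) = x + \<sigma> * (t - s)" for s by (simp add: algebra_simps)
  have zs: "(x + \<sigma> * (t - s), s) \<in> region y r" if "0 \<le> s" "s \<le> s1" for s
    using region_backward[OF z1 \<sigma> that] by (simp add: eq)
  have t: "0 < t" "t < s1" using z e by (auto simp: inner_def s1_def)
  have "continuous_on {0..s1} (\<lambda>s. (\<lambda>(x, t). k x t) (x + \<sigma> * (t - s), s))"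
    by (rule continuous_on_compose2[OF k]) (use zs in \<open>auto intro!: continuous_intros\<close>)
  then have kc: "continuous_on {0..s1} (\<lambda>s. k (x + \<sigma> * (t - s)) s)" by simp
  have "((\<lambda>s. integral {0..s} (\<lambda>s. k (x + \<sigma> * (t - s)) s)) has_real_derivative k (x + \<sigma> * (t - t)) t) (at t within {0..s1})"
    by (rule integral_has_real_derivative[OF kc]) (use t in auto)
  then have "((\<lambda>s. integral {0..s} (\<lambda>s. k (x + \<sigma> * (t - s)) s)) has_real_derivative k x t) (at t)"
    using t by (simp add: at_within_Icc_at)
  then have "((\<lambda>s. f0 (x + \<sigma> * t) + integral {0..s} (\<lambda>s. k (x + \<sigma> * (t - s)) s)) has_real_derivative k x t) (at t)"
    by (auto intro!: derivative_eq_intros)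
  then show ?thesis
  proof (rule has_field_derivative_transform_within_open[of _ _ _ "{0<..<s1}"])
    fix s assume s: "s \<in> {0<..<s1}"
    have e1: "x + \<sigma> * (t - s) + \<sigma> * s = x + \<sigma> * t" by (simp add: algebra_simps)
    have e2: "x + \<sigma> * (t - s) + \<sigma> * (s - s') = x + \<sigma> * (t - s')" for s'
      by (simp add: algebra_simps)
    have "0 \<le> s" "s \<le> s1" using s by auto
    from w[OF zs[OF this]] show "f0 (x + \<sigma> * t) + integral {0..s} (\<lambda>s. k (x + \<sigma> * (t - s)) s) = w (x + \<sigma> * (t - s)) s"
      unfolding e1 e2 by (rule sym)
  qed (use t in auto)
qed

lemma v_characteristic_derivative:
  "\<sigma> \<in> {1, -1} \<Longrightarrow> (x, t) \<in> inner \<Longrightarrow> ((\<lambda>s. v \<sigma> (x + \<sigma> * (t - s)) s) has_real_derivative W x t) (at t)"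
  by (rule characteristic_derivative[OF WV_cont(1) _ v_integral])

lemma a_characteristic_derivative:
  "\<sigma> \<in> {1, -1} \<Longrightarrow> (x, t) \<in> inner \<Longrightarrow> ((\<lambda>s. a \<sigma> (x + \<sigma> * (t - s)) s) has_real_derivative V x t) (at t)"
  by (rule characteristic_derivative[OF WV_cont(2) _ a_integral])

lemma v_space_derivative:
  assumes \<sigma>: "\<sigma> \<in> {1, -1}" and z: "(x, t) \<in> inner"
  shows "((\<lambda>x. v \<sigma> x t) has_real_derivative a \<sigma> x t) (at x)"
proof -
  obtain e where e: "e > 0" "\<And>x' t'. \<bar>x' - x\<bar> < e \<Longrightarrow> \<bar>t' - t\<bar> < e \<Longrightarrow> (x', t') \<in> inner"
    using inner_nbhd[OF z] by blast
  define S where "S = ball x e"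
  have S: "(x', t) \<in> region y r" if "x' \<in> S" for x'
    using e that inner_region by (auto simp: S_def dist_real_def abs_minus_commute)
  have xS: "x \<in> S" using e by (simp add: S_def)
  have "\<exists>g. \<forall>x'\<in>S. (\<lambda>n. Phi n \<sigma> x' t) \<longlonglongrightarrow> g x' \<and> (g has_derivative (*) (a \<sigma> x' t)) (at x' within S)"
  proof (rule has_derivative_sequence[where f = "\<lambda>n x. Phi n \<sigma> x t" and f' = "\<lambda>n x. (*) (Da n \<sigma> x t)" and ?x0.0 = x])
    show "convex S" by (simp add: S_def)
    show "((\<lambda>x. Phi n \<sigma> x t) has_derivative (*) (Da n \<sigma> x' t)) (at x' within S)" if "x' \<in> S" for n x'
      using Phi_has_derivative[OF \<sigma>, of x' t n] S[OF that]
      by (auto simp: region_def has_field_derivative_def intro: has_derivative_at_withinI)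
    show "\<forall>\<^sub>F n in sequentially. \<forall>x'\<in>S. \<forall>h. norm (Da n \<sigma> x' t * h - a \<sigma> x' t * h) \<le> \<epsilon> * norm h"
      if "\<epsilon> > 0" for \<epsilon> :: real
      using uniform_limitD[OF Da_uniform[OF yr A \<sigma>] that]
    proof eventually_elim
      case (elim n)
      show ?case
      proof (intro ballI allI)
        fix x' h assume "x' \<in> S"
        then have "\<bar>Da n \<sigma> x' t - a \<sigma> x' t\<bar> \<le> \<epsilon>"
          using elim S by (force simp: dist_real_def)
        then have "\<bar>Da n \<sigma> x' t - a \<sigma> x' t\<bar> * \<bar>h\<bar> \<le> \<epsilon> * \<bar>h\<bar>" by (rule mult_right_mono) simp
        then show "norm (Da n \<sigma> x' t * h - a \<sigma> x' t * h) \<le> \<epsilon> * norm h"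
          by (simp add: left_diff_distrib[symmetric] abs_mult)
      qed
    qed
    show "(\<lambda>n. Phi n \<sigma> x t) \<longlonglongrightarrow> v \<sigma> x t" by (rule region_tendsto(1)[OF yr A \<sigma> S[OF xS]])
  qed (rule xS)
  then obtain g where g: "\<And>x'. x' \<in> S \<Longrightarrow> (\<lambda>n. Phi n \<sigma> x' t) \<longlonglongrightarrow> g x'"
    "\<And>x'. x' \<in> S \<Longrightarrow> (g has_derivative (*) (a \<sigma> x' t)) (at x' within S)" by blast
  have gv: "g x' = v \<sigma> x' t" if "x' \<in> S" for x'
    using LIMSEQ_unique[OF g(1)[OF that] region_tendsto(1)[OF yr A \<sigma> S[OF that]]] .
  have "(g has_derivative (*) (a \<sigma> x t)) (at x)"
    using g(2)[OF xS] at_within_open[OF xS] by (simp add: S_def)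
  then have "(g has_real_derivative a \<sigma> x t) (at x)" by (simp add: has_field_derivative_def)
  then show ?thesis
    by (rule has_field_derivative_transform_within_open[of _ _ _ S]) (use gv xS in \<open>auto simp: S_def\<close>)
qed

text \<open>Total differentiability follows from one partial derivative and one continuous partial
  derivative. The known ones are the space derivative and the derivative along characteristics, so
  the argument runs in the coordinates \<open>\<xi> = x + \<sigma> * t\<close> and
  \<open>\<tau> = t\<close>, whose second partial derivative is \<open>W\<close>, and is then
  transformed back.\<close>

lemma v_total_derivative:
  assumes \<sigma>: "\<sigma> \<in> {1, -1}" and z: "(x, t) \<in> inner"
  shows "((\<lambda>(x, t). v \<sigma> x t) has_derivative (\<lambda>(h, k). h * a \<sigma> x t + k * (\<sigma> * a \<sigma> x t + W x t))) (at (x, t))"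
proof -
  obtain e where e: "e > 0" "\<And>x' t'. \<bar>x' - x\<bar> < e \<Longrightarrow> \<bar>t' - t\<bar> < e \<Longrightarrow> (x', t') \<in> inner"
    using inner_nbhd[OF z] by blast
  define \<xi>0 where "\<xi>0 = x + \<sigma> * t"
  define X Y where "X = ball \<xi>0 (e / 2)" and "Y = ball t (e / 2)"
  have in1: "(\<xi> - \<sigma> * \<tau>, \<tau>) \<in> inner" if "\<xi> \<in> X" "\<tau> \<in> Y" for \<xi> \<tau>
  proof (rule e(2))
    have 1: "\<bar>\<xi> - \<xi>0\<bar> < e / 2" "\<bar>\<tau> - t\<bar> < e / 2"
      using that by (auto simp: X_def Y_def dist_real_def abs_minus_commute)
    have "\<xi> - \<sigma> * \<tau> - x = (\<xi> - \<xi>0) - \<sigma> * (\<tau> - t)" by (simp add: \<xi>0_def algebra_simps)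
    moreover have "\<bar>\<sigma> * (\<tau> - t)\<bar> = \<bar>\<tau> - t\<bar>" using \<sigma> by (auto simp: abs_mult)
    ultimately show "\<bar>\<xi> - \<sigma> * \<tau> - x\<bar> < e" using 1 by linarith
    show "\<bar>\<tau> - t\<bar> < e" using 1 e by linarith
  qed
  define G where "G \<xi> \<tau> = v \<sigma> (\<xi> - \<sigma> * \<tau>) \<tau>" for \<xi> \<tau>
  have x0: "\<xi>0 - \<sigma> * t = x" by (simp add: \<xi>0_def)
  have tY: "t \<in> Y" and \<xi>X: "\<xi>0 \<in> X" using e by (auto simp: X_def Y_def)
  have "((\<lambda>(\<xi>, \<tau>). G \<xi> \<tau>) has_derivative (\<lambda>(h, k). a \<sigma> x t * h + blinfun_mult_right (W (\<xi>0 - \<sigma> * t) t) k)) (at (\<xi>0, t) within X \<times> Y)"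
  proof (rule has_derivative_partialsI[where fy = "\<lambda>\<xi> \<tau>. blinfun_mult_right (W (\<xi> - \<sigma> * \<tau>) \<tau>)"])
    have "((\<lambda>\<xi>. v \<sigma> (\<xi> + (- \<sigma> * t)) t) has_real_derivative a \<sigma> x t) (at \<xi>0)"
      using DERIV_shift[of "\<lambda>x. v \<sigma> x t" "a \<sigma> x t" \<xi>0 "- \<sigma> * t"] v_space_derivative[OF \<sigma> z] x0 by simp
    then show "((\<lambda>\<xi>. G \<xi> t) has_derivative (*) (a \<sigma> x t)) (at \<xi>0 within X)"
      unfolding G_def has_field_derivative_def by (auto intro: has_derivative_at_withinI)
    show "((\<lambda>\<tau>. G \<xi> \<tau>) has_derivative blinfun_apply (blinfun_mult_right (W (\<xi> - \<sigma> * \<tau>) \<tau>))) (at \<tau> within Y)"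
      if "\<xi> \<in> X" "\<tau> \<in> Y" for \<xi> \<tau>
    proof -
      have "((\<lambda>s. v \<sigma> (\<xi> - \<sigma> * \<tau> + \<sigma> * (\<tau> - s)) s) has_real_derivative W (\<xi> - \<sigma> * \<tau>) \<tau>) (at \<tau>)"
        by (rule v_characteristic_derivative[OF \<sigma> in1[OF that]])
      moreover have "\<xi> - \<sigma> * \<tau> + \<sigma> * (\<tau> - s) = \<xi> - \<sigma> * s" for s by (simp add: algebra_simps)
      ultimately show ?thesis
        unfolding G_def has_field_derivative_def by (auto intro: has_derivative_at_withinI)
    qed
    have "continuous_on (X \<times> Y) (\<lambda>z. (\<lambda>(x, t). W x t) (fst z - \<sigma> * snd z, snd z))"
      by (rule continuous_on_compose2[OF continuous_on_subset[OF WV_cont(1) inner_region]])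
        (use in1 in \<open>auto intro!: continuous_intros\<close>)
    then have "continuous_on (X \<times> Y) (\<lambda>(\<xi>, \<tau>). W (\<xi> - \<sigma> * \<tau>) \<tau>)" by (simp add: case_prod_unfold)
    then have "continuous_on (X \<times> Y) (\<lambda>(\<xi>, \<tau>). blinfun_mult_right (W (\<xi> - \<sigma> * \<tau>) \<tau>))"
      unfolding case_prod_unfold by (rule bounded_linear.continuous_on[OF bounded_linear_blinfun_mult_right])
    then show "continuous (at (\<xi>0, t) within X \<times> Y) (\<lambda>(\<xi>, \<tau>). blinfun_mult_right (W (\<xi> - \<sigma> * \<tau>) \<tau>))"
      using tY \<xi>X by (simp add: continuous_on_eq_continuous_within)
  qed (use tY in \<open>auto simp: Y_def\<close>)
  moreover have "at (\<xi>0, t) within X \<times> Y = at (\<xi>0, t)"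
    by (rule at_within_open) (use tY \<xi>X in \<open>auto simp: X_def Y_def intro!: open_Times\<close>)
  ultimately have G: "((\<lambda>(\<xi>, \<tau>). G \<xi> \<tau>) has_derivative (\<lambda>(h, k). a \<sigma> x t * h + W x t * k)) (at (\<xi>0, t))"
    by (simp add: x0)
  have lin: "((\<lambda>z. (fst z + \<sigma> * snd z, snd z)) has_derivative (\<lambda>z. (fst z + \<sigma> * snd z, snd z))) (at (x, t))"
    by (auto intro!: derivative_eq_intros)
  have "((\<lambda>z. (\<lambda>(\<xi>, \<tau>). G \<xi> \<tau>) (fst z + \<sigma> * snd z, snd z)) has_derivative
      (\<lambda>z. (\<lambda>(h, k). a \<sigma> x t * h + W x t * k) (fst z + \<sigma> * snd z, snd z))) (at (x, t))"
    by (rule has_derivative_compose[OF lin]) (use G in \<open>simp add: \<xi>0_def\<close>)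
  then show ?thesis
    by (simp add: G_def case_prod_unfold algebra_simps)
qed

lemma a_isCont: "\<sigma> \<in> {1, -1} \<Longrightarrow> (x, t) \<in> inner \<Longrightarrow> isCont (\<lambda>(x, t). a \<sigma> x t) (x, t)"
  using continuous_on_subset[OF region_cont(2)[OF yr A] inner_region] inner_open
  by (simp add: continuous_on_eq_continuous_at)

lemma v_cone:
  assumes "\<sigma> \<in> {1, -1}" "(x, t) \<in> region y r" "(x + h, t + k) \<in> region y r" "\<theta> * \<bar>h\<bar> \<le> k"
  shows "v \<sigma> x t \<le> v \<sigma> (x + h) (t + k)"
  by (rule LIMSEQ_le[OF region_tendsto(1)[OF yr A assms(1,2)] region_tendsto(1)[OF yr A assms(1,3)]])
    (use Phi_cone[OF assms(1) _ _ assms(4)] assms(2,3) in \<open>auto simp: region_def\<close>)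

text \<open>By \<open>v_cone\<close> the directional derivatives of \<open>v \<sigma>\<close> along
  the two extreme directions \<open>(1, \<theta>)\<close> and \<open>(-1, \<theta>)\<close> are
  nonnegative; together they are the claim.\<close>

lemma a_le:
  assumes \<sigma>: "\<sigma> \<in> {1, -1}" and z: "(x, t) \<in> inner"
  shows "\<bar>a \<sigma> x t\<bar> \<le> \<theta> * (\<sigma> * a \<sigma> x t + W x t)"
proof -
  obtain e where e: "e > 0" "\<And>x' t'. \<bar>x' - x\<bar> < e \<Longrightarrow> \<bar>t' - t\<bar> < e \<Longrightarrow> (x', t') \<in> inner"
    using inner_nbhd[OF z] by blast
  have "0 \<le> h * a \<sigma> x t + \<theta> * (\<sigma> * a \<sigma> x t + W x t)" if h: "h \<in> {1, -1}" for h
  proof (rule ccontr)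
    define D where "D = h * a \<sigma> x t + \<theta> * (\<sigma> * a \<sigma> x t + W x t)"
    assume "\<not> 0 \<le> h * a \<sigma> x t + \<theta> * (\<sigma> * a \<sigma> x t + W x t)"
    then have neg: "D < 0" by (simp add: D_def)
    have lin: "((\<lambda>s. (x + h * s, t + \<theta> * s)) has_derivative (\<lambda>s. (h * s, \<theta> * s))) (at 0)"
      by (auto intro!: derivative_eq_intros)
    have "((\<lambda>s. (\<lambda>(x, t). v \<sigma> x t) (x + h * s, t + \<theta> * s)) has_derivative
       (\<lambda>s. (\<lambda>(h, k). h * a \<sigma> x t + k * (\<sigma> * a \<sigma> x t + W x t)) (h * s, \<theta> * s))) (at 0)"
      by (rule has_derivative_compose[OF lin]) (use v_total_derivative[OF \<sigma> z] in simp)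
    then have "((\<lambda>s. v \<sigma> (x + h * s) (t + \<theta> * s)) has_derivative
       (\<lambda>s. h * s * a \<sigma> x t + \<theta> * s * (\<sigma> * a \<sigma> x t + W x t))) (at 0)"
      by simp
    moreover have "(\<lambda>s. h * s * a \<sigma> x t + \<theta> * s * (\<sigma> * a \<sigma> x t + W x t)) = (*) D"
      by (auto simp: D_def algebra_simps)
    ultimately have "((\<lambda>s. v \<sigma> (x + h * s) (t + \<theta> * s)) has_real_derivative D) (at 0)"
      unfolding has_field_derivative_def by simp
    from DERIV_neg_dec_right[OF this neg]
    obtain d where d: "d > 0" "\<And>s. s > 0 \<Longrightarrow> s < d \<Longrightarrow> v \<sigma> (x + h * s) (t + \<theta> * s) < v \<sigma> x t" by auto
    define s where "s = min d e / 2"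
    have s: "0 < s" "s < d" "s < e" using d e by (auto simp: s_def)
    have "\<theta> * s < 1 * e" using \<theta> s by (intro mult_strict_mono) auto
    then have "(x + h * s, t + \<theta> * s) \<in> inner"
      by (intro e(2)) (use s h \<theta> in \<open>auto simp: abs_mult\<close>)
    then have "(x, t) \<in> region y r" "(x + h * s, t + \<theta> * s) \<in> region y r"
      using z inner_region by blast+
    then have "v \<sigma> x t \<le> v \<sigma> (x + h * s) (t + \<theta> * s)"
      by (rule v_cone[OF \<sigma>]) (use h s in \<open>auto simp: abs_mult\<close>)
    then show False using d(2)[OF s(1,2)] by simp
  qed
  from this[of 1] this[of "-1"] show ?thesis by auto
qed

end

end

section \<open>The blow-up time\<close>

context iterates
begin

lemma bounded_at_cone:
  assumes "bounded_at y s" "(x, t) \<in> cone_domain L" "(y, s) \<in> cone_domain L" "\<theta> * \<bar>y - x\<bar> \<le> s - t"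
  shows "bounded_at x t"
  using assms(1) U_cone[OF assms(2-4)] unfolding bounded_at_def by (meson order_trans)

lemma bounded_at_if_Phi_le:
  assumes "\<And>n \<sigma>. \<sigma> \<in> {1, -1} \<Longrightarrow> Phi n \<sigma> x t \<le> B"
  shows "bounded_at x t"
  unfolding bounded_at_def U_def using add_mono[OF assms[of 1] assms[of "-1"]] by blast

text \<open>Both suprema are positive, which excludes cancellation of infinities: their sum in
  \<open>ereal\<close> is finite only if each of them is.\<close>

lemma sup_finite_iff:
  assumes "(x, t) \<in> cone_domain L"
  shows "phi_sup p \<mu> (F 1) (F (-1)) \<gamma>1 \<gamma>2 x t + psi_sup p \<mu> (F 1) (F (-1)) \<gamma>1 \<gamma>2 x t < \<infinity> \<longleftrightarrow> bounded_at x t"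
proof -
  define P Q where "P = (SUP n. ereal (Phi n 1 x t))" and "Q = (SUP n. ereal (Phi n (-1) x t))"
  have PQ: "phi_sup p \<mu> (F 1) (F (-1)) \<gamma>1 \<gamma>2 x t = P" "psi_sup p \<mu> (F 1) (F (-1)) \<gamma>1 \<gamma>2 x t = Q"
    by (simp_all add: phi_sup_def psi_sup_def P_def Q_def Phi_def)
  have up: "ereal (Phi n 1 x t) \<le> P" "ereal (Phi n (-1) x t) \<le> Q" for n
    unfolding P_def Q_def by (auto intro: SUP_upper)
  have pos: "0 < Phi n \<sigma> x t" if "\<sigma> \<in> {1, -1}" for n \<sigma>
    using Phi_ge[OF that assms, of n] Gam(1)[OF that] by linarith
  show ?thesis unfolding PQ
  proof
    assume fin: "P + Q < \<infinity>"
    have "0 < P" "0 < Q" using up[of 0] pos[of 1 0] pos[of "-1" 0]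
      by (auto intro: less_le_trans[of 0 "ereal (Phi 0 _ x t)"])
    then obtain P' Q' where "P = ereal P'" "Q = ereal Q'" using fin by (cases P; cases Q) auto
    then show "bounded_at x t"
      using up unfolding bounded_at_def U_def by (auto intro!: exI[of _ "P' + Q'"] add_mono)
  next
    assume "bounded_at x t"
    then obtain A where A: "\<And>n. U n x t \<le> A" unfolding bounded_at_def by blast
    have "Phi n 1 x t \<le> A" "Phi n (-1) x t \<le> A" for n
      using A[of n] pos[of 1 n] pos[of "-1" n] by (auto simp: U_def)
    then have "P \<le> ereal A" "Q \<le> ereal A" unfolding P_def Q_def by (auto intro!: SUP_least)
    then have "P + Q \<le> ereal A + ereal A" by (rule add_mono)
    then show "P + Q < \<infinity>" by (auto intro: le_less_trans)
  qed
qed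

text \<open>As long as both components stay below \<open>2 * A\<close>, the nonlinearity is at most
  the constant in the last premise, so over the allowed time it adds at most \<open>A\<close> to the
  initial bound \<open>A\<close>. The estimate is uniform in \<open>n\<close>; it gives positivity
  of \<open>T\<close> from \<open>t0 = 0\<close>, and continuation past a time without
  blow-up.\<close>

lemma local_existence:
  assumes t0: "0 \<le> t0" and dom: "(x, t0 + \<rho>) \<in> cone_domain L" and A: "0 < A"
    and base: "\<And>n \<sigma> y. \<sigma> \<in> {1, -1} \<Longrightarrow> \<bar>y - x\<bar> \<le> \<rho> \<Longrightarrow> Phi n \<sigma> y t0 \<le> A"
  shows "\<sigma> \<in> {1, -1} \<Longrightarrow> t0 \<le> t \<Longrightarrow> \<bar>y - x\<bar> + (t - t0) \<le> \<rho> \<Longrightarrow>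
    (t - t0) * (2 powr (-p) * (4 * A) powr p) \<le> A \<Longrightarrow> Phi n \<sigma> y t \<le> 2 * A"
proof (induction n arbitrary: \<sigma> y t)
  case 0
  have "0 \<le> \<rho>" using 0 by linarith
  then show ?case using base[OF 0(1), of x 0] A by (simp add: Phi_0)
next
  case (Suc n)
  note \<sigma> = Suc.prems(1)
  have z: "(y, t) \<in> cone_domain L" using dom Suc.prems t0 by (auto simp: cone_domain_def)
  define w where "w s = WN n (y + \<sigma> * (t - s)) s" for s
  have wc: "continuous_on {0..t} w" unfolding w_def by (rule WN_char_cont[OF z \<sigma>])
  define y0 where "y0 = y + \<sigma> * (t - t0)"
  have "\<bar>\<sigma> * (t - t0)\<bar> = t - t0" using \<sigma> Suc.prems(2) by (auto simp: abs_mult)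
  then have y0: "\<bar>y0 - x\<bar> \<le> \<rho>" using Suc.prems(3) unfolding y0_def by linarith
  have "integral {0..t0} w + integral {t0..t} w = integral {0..t} w"
    by (rule Henstock_Kurzweil_Integration.integral_combine)
      (use t0 Suc.prems wc in \<open>auto intro!: integrable_continuous_interval\<close>)
  moreover have "Phi (Suc n) \<sigma> y0 t0 = F \<sigma> (y + \<sigma> * t) + integral {0..t0} w"
  proof -
    have "y0 + \<sigma> * t0 = y + \<sigma> * t" "y0 + \<sigma> * (t0 - s) = y + \<sigma> * (t - s)" for s
      by (simp_all add: y0_def algebra_simps)
    then show ?thesis unfolding Phi_Suc[OF \<sigma>] w_def by simp
  qed
  moreover have "Phi (Suc n) \<sigma> y0 t0 \<le> A" by (rule base[OF \<sigma> y0])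
  moreover have "integral {t0..t} w \<le> A"
  proof -
    have "integral {t0..t} w \<le> integral {t0..t} (\<lambda>_. 2 powr (-p) * (4 * A) powr p)"
    proof (rule integral_le)
      show "w integrable_on {t0..t}"
        by (intro integrable_continuous_interval continuous_on_subset[OF wc]) (use t0 in auto)
      fix s assume s: "s \<in> {t0..t}"
      define y1 where "y1 = y + \<sigma> * (t - s)"
      have z1: "(y1, s) \<in> cone_domain L"
        unfolding y1_def by (rule cone_domain_backward[OF z \<sigma>]) (use s t0 in auto)
      have "\<bar>\<sigma> * (t - s)\<bar> = t - s" using \<sigma> s by (auto simp: abs_mult)
      then have y1: "\<bar>y1 - x\<bar> + (s - t0) \<le> \<rho>" using Suc.prems(3) unfolding y1_def by linarith
      have "(s - t0) * (2 powr (-p) * (4 * A) powr p) \<le> (t - t0) * (2 powr (-p) * (4 * A) powr p)"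
        by (rule mult_right_mono) (use s in auto)
      then have c: "(s - t0) * (2 powr (-p) * (4 * A) powr p) \<le> A" using Suc.prems(4) by linarith
      have "Phi n \<rho>' y1 s \<le> 2 * A" if "\<rho>' \<in> {1, -1}" for \<rho>'
        by (rule Suc.IH[OF that _ y1 c]) (use s in auto)
      from this[of 1] this[of "-1"] have "U n y1 s \<le> 4 * A" by (simp add: U_def)
      then have "U n y1 s powr p \<le> (4 * A) powr p"
        using U_ge[OF z1, of n] \<gamma> p by (intro powr_mono2) auto
      then have "2 powr (-p) * U n y1 s powr p \<le> 2 powr (-p) * (4 * A) powr p" by (rule mult_left_mono) simp
      moreover have "WN n y1 s \<le> 2 powr (-p) * U n y1 s powr p"
        unfolding WN_def by (rule Nl_bounds(2)[OF U_ge[OF z1]]) (use s t0 in auto)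
      ultimately show "w s \<le> 2 powr (-p) * (4 * A) powr p" unfolding w_def y1_def by linarith
    qed (simp add: integrable_const_ivl)
    also have "\<dots> = (t - t0) * (2 powr (-p) * (4 * A) powr p)" using Suc.prems by simp
    finally show ?thesis using Suc.prems(4) by linarith
  qed
  moreover have "Phi (Suc n) \<sigma> y t = F \<sigma> (y + \<sigma> * t) + integral {0..t} w"
    unfolding Phi_Suc[OF \<sigma>] w_def ..
  ultimately show ?case by linarith
qed

end

section \<open>Bounds on \<open>T\<close> and blow-up at time \<open>T x\<close>\<close>

locale blowup_problem = iterates p \<mu> \<gamma>1 \<gamma>2 \<theta> "Rs + Ts" M F F'
  for p \<mu> \<gamma>1 \<gamma>2 \<theta> Rs Ts M :: real and F F' +
  assumes Rs: "0 < Rs" and Ts: "0 < Ts"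
    and early: "1 / ((p - 1) * \<mu>) * ln ((2 powr (1 - p) / \<mu>) / (2 powr (1 - p) / \<mu> - (\<gamma>1 + \<gamma>2) powr (1 - p))) < Ts"
begin

definition T :: "real \<Rightarrow> real" where
  "T = blowup_time p \<mu> (F 1) (F (-1)) \<gamma>1 \<gamma>2 Ts"

lemma column_dom: "\<bar>x\<bar> < Rs \<Longrightarrow> 0 \<le> t \<Longrightarrow> t \<le> Ts \<Longrightarrow> (x, t) \<in> cone_domain (Rs + Ts)"
  by (auto simp: cone_domain_def)

lemma T_eq: "\<bar>x\<bar> < Rs \<Longrightarrow> T x = Sup {t. 0 < t \<and> t < Ts \<and> bounded_at x t}"
  unfolding T_def blowup_time_def
  by (rule arg_cong[where f = Sup], rule Collect_cong, intro conj_cong refl sup_finite_iff column_dom) auto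

lemma le_T: "\<bar>x\<bar> < Rs \<Longrightarrow> 0 < t \<Longrightarrow> t < Ts \<Longrightarrow> bounded_at x t \<Longrightarrow> t \<le> T x"
  unfolding T_eq by (rule cSup_upper) (auto intro!: bdd_aboveI[of _ Ts])

lemma ex_bounded: "\<bar>x\<bar> < Rs \<Longrightarrow> \<exists>t>0. t < Ts \<and> bounded_at x t"
proof -
  assume x: "\<bar>x\<bar> < Rs"
  define \<rho> where "\<rho> = Ts / 2"
  have \<rho>: "0 < \<rho>" "\<rho> < Ts" using Ts by (auto simp: \<rho>_def)
  define A where "A = \<bar>F 1 x\<bar> + \<bar>F (-1) x\<bar> + M * \<rho> + \<gamma>1 + \<gamma>2"
  have "0 \<le> M * \<rho>" using M \<rho> by simp
  then have A: "0 < A" using \<gamma>1 \<gamma>2 by (simp add: A_def add_nonneg_pos)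
  have base: "Phi n \<sigma> y 0 \<le> A" if \<sigma>: "\<sigma> \<in> {1, -1}" and y: "\<bar>y - x\<bar> \<le> \<rho>" for n \<sigma> y
  proof (cases n)
    case 0
    then show ?thesis using \<sigma> \<gamma>1 \<gamma>2 \<open>0 \<le> M * \<rho>\<close> by (auto simp: Phi_0 Gam_def A_def)
  next
    case (Suc m)
    have "\<bar>y\<bar> < Rs + Ts" "\<bar>x\<bar> < Rs + Ts" using x y \<rho> by auto
    then have "\<bar>F \<sigma> y - F \<sigma> x\<bar> \<le> M * \<bar>y - x\<bar>" using F_lipschitz[OF \<sigma>] by blast
    also have "\<dots> \<le> M * \<rho>" by (rule mult_left_mono[OF y M])
    finally have "F \<sigma> y \<le> A" using \<sigma> \<gamma>1 \<gamma>2 by (auto simp: A_def)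
    then show ?thesis by (simp add: Suc Phi_Suc[OF \<sigma>])
  qed
  define c where "c = 2 powr (-p) * (4 * A) powr p"
  have c: "0 < c" using A by (simp add: c_def)
  define t where "t = min \<rho> (A / c)"
  have t: "0 < t" "t \<le> \<rho>" "t * c \<le> A"
  proof -
    show "0 < t" "t \<le> \<rho>" using \<rho> A c by (auto simp: t_def)
    have "t \<le> A / c" by (simp add: t_def)
    then show "t * c \<le> A" using c by (simp add: pos_le_divide_eq)
  qed
  have "Phi n \<sigma> x t \<le> 2 * A" if "\<sigma> \<in> {1, -1}" for n \<sigma>
    by (rule local_existence[where ?t0.0 = 0 and \<rho> = \<rho> and x = x])
      (use base A t \<rho> that column_dom[OF x, of \<rho>] in \<open>auto simp: c_def\<close>)
  then have "bounded_at x t" by (rule bounded_at_if_Phi_le)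
  then show ?thesis using t \<rho> by (intro exI[of _ t]) auto
qed

lemma T_pos: "\<bar>x\<bar> < Rs \<Longrightarrow> 0 < T x"
  using ex_bounded[of x] le_T[of x] by force

lemma bounded_below_T:
  assumes "\<bar>x\<bar> < Rs" "0 \<le> t" "t < T x"
  shows "\<exists>r. t < r \<and> r < T x \<and> r < Ts \<and> bounded_at x r"
proof -
  define m where "m = (t + T x) / 2"
  have m: "t < m" "m < T x" using assms by (auto simp: m_def)
  have "m < Sup {t. 0 < t \<and> t < Ts \<and> bounded_at x t}" using m T_eq[OF assms(1)] by simp
  then obtain s where s: "0 < s" "s < Ts" "bounded_at x s" "m < s"
    using less_cSupD[of "{t. 0 < t \<and> t < Ts \<and> bounded_at x t}" m] ex_bounded[OF assms(1)] by blast
  have "bounded_at x m"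
    by (rule bounded_at_cone[OF s(3)]) (use s m assms column_dom in auto)
  then show ?thesis using m s by (intro exI[of _ m]) auto
qed

text \<open>This brings every point below the graph into the scope of the local results, through a
  point of boundedness later on the same column.\<close>

lemma inner_below_T:
  assumes "\<bar>x\<bar> < Rs" "0 < t" "t < T x"
  shows "\<exists>r A. (x, r) \<in> cone_domain (Rs + Ts) \<and> (\<forall>n. U n x r \<le> A) \<and> (x, t) \<in> inner x r"
proof -
  obtain r where r: "t < r" "r < Ts" "bounded_at x r" using bounded_below_T[of x t] assms by auto
  then obtain A where A: "\<And>n. U n x r \<le> A" unfolding bounded_at_def by blast
  have dom: "(x, r) \<in> cone_domain (Rs + Ts)" using column_dom[OF assms(1)] r assms by simp
  have "(x, t) \<in> inner x r"
    using r assms dom by (auto simp: inner_def[OF dom A] cone_domain_def)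
  then show ?thesis using A dom by blast
qed

text \<open>A bound on the iterates at \<open>(x, r)\<close> carries over to
  \<open>(y, r - \<theta> * \<bar>x - y\<bar>)\<close>, which lies in the backward cone.\<close>

lemma T_lipschitz_le:
  assumes "\<bar>x\<bar> < Rs" "\<bar>y\<bar> < Rs"
  shows "T x \<le> T y + \<theta> * \<bar>x - y\<bar>"
proof (rule ccontr)
  define d where "d = \<theta> * \<bar>x - y\<bar>"
  assume "\<not> T x \<le> T y + \<theta> * \<bar>x - y\<bar>"
  then have lt: "T y + d < T x" by (simp add: d_def)
  have d: "0 \<le> d" using \<theta> by (simp add: d_def)
  obtain r where r: "T y + d < r" "r < Ts" "bounded_at x r"
    using bounded_below_T[OF assms(1) _ lt] T_pos[OF assms(2)] d by auto
  have p: "0 < r - d" using r T_pos[OF assms(2)] by linarith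
  have "bounded_at y (r - d)"
    by (rule bounded_at_cone[OF r(3)]) (use column_dom assms r p d in \<open>auto simp: d_def\<close>)
  then have "r - d \<le> T y" by (intro le_T) (use assms p r d in auto)
  then show False using r by linarith
qed

text \<open>Comparison with the spatially constant solution \<alpha> of the equation with
  undiminished damping \<mu>, which is a subsolution because
  \<open>\<mu> / (1 + t) \<le> \<mu>\<close>. It starts at \<gamma>1 + \<gamma>2 and blows up at
  \<open>T1\<close>. If \<open>T x\<close> exceeded \<open>T1\<close>, then \<open>u\<close> would
  be bounded on the column up to \<open>T1\<close> and yet lie above \<alpha>.\<close>

lemma T_le_early:
  assumes x: "\<bar>x\<bar> < Rs"
  shows "T x \<le> 1 / ((p - 1) * \<mu>) * ln ((2 powr (1 - p) / \<mu>) / (2 powr (1 - p) / \<mu> - (\<gamma>1 + \<gamma>2) powr (1 - p)))"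
proof (rule ccontr)
  define B0 g0 where "B0 = 2 powr (1 - p) / \<mu>" and "g0 = (\<gamma>1 + \<gamma>2) powr (1 - p)"
  define T1 where "T1 = 1 / ((p - 1) * \<mu>) * ln (B0 / (B0 - g0))"
  assume "\<not> ?thesis"
  then have T1T: "T1 < T x" by (simp add: T1_def B0_def g0_def)
  have g0: "0 < g0" using \<gamma> by (simp add: g0_def)
  have "g0 < B0"
  proof -
    have "g0 = 1 / ((\<gamma>1 + \<gamma>2) powr (p - 1))"
      using powr_minus_divide[of "\<gamma>1 + \<gamma>2" "p - 1"] by (simp add: g0_def)
    also have "\<dots> < 1 / (\<mu> * p * 2 powr p)"
      using threshold p \<mu> \<gamma> by (intro divide_strict_left_mono mult_pos_pos) auto
    also have "\<dots> \<le> 1 / (\<mu> * 2 powr p)"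
      using p \<mu> by (intro divide_left_mono) auto
    also have "\<dots> \<le> B0"
      using \<mu> by (simp add: B0_def powr_diff field_simps)
    finally show ?thesis .
  qed
  then have Bg: "0 < B0 - g0" "0 < B0" using g0 by auto
  have pm: "0 < (p - 1) * \<mu>" using p \<mu> by simp
  \<comment> \<open>Bernoulli substitution: \<beta> stands for \<open>\<alpha> powr (1 - p)\<close>,
    which satisfies a linear equation with this explicit solution. \<alpha> blows up where \<beta>
    reaches zero.\<close>
  define \<beta> where "\<beta> t = B0 - (B0 - g0) * exp ((p - 1) * \<mu> * t)" for t
  have T1: "0 < T1" "\<beta> T1 = 0"
  proof -
    have "1 < B0 / (B0 - g0)" using Bg g0 by simp
    then show "0 < T1" unfolding T1_def using pm by simp
    have "(p - 1) * \<mu> * T1 = ln (B0 / (B0 - g0))" using p \<mu> by (simp add: T1_def)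
    then have "exp ((p - 1) * \<mu> * T1) = B0 / (B0 - g0)" using Bg by simp
    then show "\<beta> T1 = 0" unfolding \<beta>_def using Bg by simp
  qed
  have \<beta>mono: "\<beta> t < \<beta> s" if "s < t" for s t
    unfolding \<beta>_def using mult_strict_left_mono[OF that pm] Bg by simp
  have \<beta>0: "\<beta> 0 = g0" by (simp add: \<beta>_def)
  have \<beta>d: "(\<beta> has_real_derivative (p - 1) * (\<mu> * \<beta> t - 2 powr (1 - p))) (at t)" for t
  proof -
    have "(\<beta> has_real_derivative - ((B0 - g0) * (exp ((p - 1) * \<mu> * t) * ((p - 1) * \<mu>)))) (at t)"
      unfolding \<beta>_def by (auto intro!: derivative_eq_intros)
    moreover have "2 powr (1 - p) = \<mu> * B0" using \<mu> by (simp add: B0_def)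
    ultimately show ?thesis by (simp add: \<beta>_def algebra_simps)
  qed
  define \<alpha> where "\<alpha> t = \<beta> t powr (- 1 / (p - 1))" for t
  have \<alpha>d: "(\<alpha> has_real_derivative 2 powr (1 - p) * \<alpha> t powr p - \<mu> * \<alpha> t) (at t)" if "t < T1" for t
  proof -
    have b: "0 < \<beta> t" using \<beta>mono[OF that] T1 by simp
    have e0: "- 1 / (p - 1) - 1 = - (p / (p - 1))" using p by (simp add: field_simps)
    have e1: "\<beta> t powr (- 1 / (p - 1) - 1) = \<alpha> t powr p"
      unfolding \<alpha>_def powr_powr e0 by simp
    have e2: "\<alpha> t powr p * \<beta> t = \<alpha> t"
    proof -
      have "\<beta> t powr (- 1 / (p - 1) - 1) * \<beta> t powr 1 = \<beta> t powr (- 1 / (p - 1))"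
        unfolding powr_add[symmetric] by simp
      then have "\<alpha> t powr p * \<beta> t powr 1 = \<alpha> t" by (simp only: e1 \<alpha>_def[of t, symmetric])
      then show ?thesis using b by simp
    qed
    have "(\<alpha> has_real_derivative - 1 / (p - 1) * \<beta> t powr (- 1 / (p - 1) - 1) * ((p - 1) * (\<mu> * \<beta> t - 2 powr (1 - p)))) (at t)"
      unfolding \<alpha>_def using DERIV_fun_powr[OF \<beta>d b, of "- 1 / (p - 1)"] by simp
    then show ?thesis
    proof (rule DERIV_cong)
      have c: "- 1 / (p - 1) * X * ((p - 1) * Y) = - (X * Y)" for X Y using p by simp
      have "\<alpha> t powr p * (\<mu> * \<beta> t) = \<mu> * (\<alpha> t powr p * \<beta> t)" by simp
      then have "- (\<alpha> t powr p * (\<mu> * \<beta> t - 2 powr (1 - p))) = 2 powr (1 - p) * \<alpha> t powr p - \<mu> * \<alpha> t"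
        unfolding e2 by (simp add: right_diff_distrib)
      then show "- 1 / (p - 1) * \<beta> t powr (- 1 / (p - 1) - 1) * ((p - 1) * (\<mu> * \<beta> t - 2 powr (1 - p)))
          = 2 powr (1 - p) * \<alpha> t powr p - \<mu> * \<alpha> t"
        unfolding e1 c .
    qed
  qed
  have \<alpha>0: "\<alpha> 0 = \<gamma>1 + \<gamma>2"
  proof -
    have "(1 - p) * (- 1 / (p - 1)) = 1" using p by (simp add: field_simps)
    then show ?thesis unfolding \<alpha>_def \<beta>0 g0_def powr_powr using \<gamma> by simp
  qed
  have \<alpha>mono: "\<alpha> s \<le> \<alpha> t" if "s \<le> t" "t < T1" for s t
  proof -
    have b: "0 < \<beta> t" using \<beta>mono[OF that(2)] T1 by simp
    moreover have "\<beta> t \<le> \<beta> s" using \<beta>mono[of s t] that by (cases "s = t") auto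
    ultimately show ?thesis unfolding \<alpha>_def using p by (intro powr_mono2') auto
  qed
  obtain r A where r: "T1 < r" "(x, r) \<in> cone_domain (Rs + Ts)" and A: "\<And>n. U n x r \<le> A"
  proof -
    obtain r where r: "T1 < r" "r < Ts" "bounded_at x r" using bounded_below_T[OF x _ T1T] T1 by auto
    from r(3) obtain A where A: "\<And>n. U n x r \<le> A" unfolding bounded_at_def by blast
    have "(x, r) \<in> cone_domain (Rs + Ts)" using r T1 by (intro column_dom[OF x]) auto
    then show ?thesis using that[OF r(1) _ A] by blast
  qed
  have A0: "0 < A" using A_ge[OF r(2) A] \<gamma> by linarith
  obtain t where t: "0 < t" "t < T1" "A < \<alpha> t"
  proof -
    have "isCont \<beta> T1" using DERIV_isCont[OF \<beta>d] .
    moreover have "\<beta> T1 < A powr (1 - p)" using T1 A0 by simp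
    ultimately have "eventually (\<lambda>t. \<beta> t < A powr (1 - p)) (at_left T1)"
      by (intro order_tendstoD(2)) (auto simp: isCont_def filterlim_at_split)
    moreover have "eventually (\<lambda>t. t \<in> {0<..<T1}) (at_left T1)"
      by (rule eventually_at_left_real[OF T1(1)])
    ultimately have "eventually (\<lambda>t. \<beta> t < A powr (1 - p) \<and> t \<in> {0<..<T1}) (at_left T1)"
      by (rule eventually_conj)
    then obtain t where t: "\<beta> t < A powr (1 - p)" "0 < t" "t < T1"
      using eventually_happens'[of "at_left T1"] by force
    have "0 < \<beta> t" using \<beta>mono[OF t(3)] T1 by simp
    then have "(A powr (1 - p)) powr (- 1 / (p - 1)) < \<alpha> t"
      unfolding \<alpha>_def using t p by (intro powr_less_mono2_neg) auto
    moreover have "(1 - p) * (- 1 / (p - 1)) = 1" using p by (simp add: field_simps)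
    ultimately have "A < \<alpha> t" using A0 unfolding powr_powr by simp
    then show ?thesis using that t by blast
  qed
  \<comment> \<open>Each component is compared with its own initial bound plus half of the growth of
    \<alpha>; the two differences then add up to \<open>u - \<alpha>\<close>, as the coupled
    positivity lemma requires.\<close>
  define E where "E \<sigma> y s = v \<sigma> y s - Gam \<sigma> - (\<alpha> s - (\<gamma>1 + \<gamma>2)) / 2" for \<sigma> y s
  define LA where "LA = p * 2 powr (-p) * \<alpha> t powr (p - 1)"
  have sumE: "E 1 y s + E (-1) y s = u y s - \<alpha> s" for y s
    using Gam(2) unfolding E_def u_def by (simp add: field_simps)
  have reg: "(y, s) \<in> region x r" if "0 \<le> s" "s \<le> t" "\<bar>y - x\<bar> \<le> t - s" for y s
  proof -
    have "\<theta> * \<bar>y - x\<bar> \<le> 1 * \<bar>y - x\<bar>" by (rule mult_right_mono) (use \<theta> in auto)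
    then show ?thesis using that t r by (auto simp: region_def cone_domain_def)
  qed
  have inn: "(y, s) \<in> inner x r" if "0 < s" "s \<le> t" "\<bar>y - x\<bar> \<le> t - s" for y s
  proof -
    have "\<theta> * \<bar>y - x\<bar> \<le> 1 * \<bar>y - x\<bar>" by (rule mult_right_mono) (use \<theta> in auto)
    then show ?thesis using that t r by (auto simp: inner_def[OF r(2) A] cone_domain_def)
  qed
  have "0 \<le> E \<sigma> x t" if \<sigma>: "\<sigma> \<in> {1, -1}" for \<sigma>
  proof (rule characteristic_positivity[where ?x1.0 = x and ?t1.0 = t and ?t0.0 = 0 and L = LA and E = E])
    show "0 \<le> t" using t by simp
    show "0 \<le> LA" using p by (simp add: LA_def)
    show "continuous_on {(y, s). 0 \<le> s \<and> s \<le> t \<and> \<bar>y - x\<bar> \<le> t - s} (\<lambda>(y, s). E \<rho> y s)"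
      if \<rho>: "\<rho> \<in> {1, -1}" for \<rho>
    proof -
      have "continuous_on {..<T1} \<alpha>"
        by (rule DERIV_continuous_on) (use \<alpha>d in \<open>auto intro: has_field_derivative_at_within\<close>)
      then have "continuous_on {(y, s). 0 \<le> s \<and> s \<le> t \<and> \<bar>y - x\<bar> \<le> t - s} (\<lambda>z. \<alpha> (snd z))"
        by (rule continuous_on_compose2) (use t in \<open>auto intro!: continuous_intros\<close>)
      moreover have "continuous_on {(y, s). 0 \<le> s \<and> s \<le> t \<and> \<bar>y - x\<bar> \<le> t - s} (\<lambda>(x, t). v \<rho> x t)"
        by (rule continuous_on_subset[OF region_cont(1)[OF r(2) A \<rho>]]) (use reg in auto)
      ultimately show ?thesis
        unfolding E_def case_prod_unfold by (intro continuous_intros) auto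
    qed
    show "0 \<le> E \<rho> y 0" if \<rho>: "\<rho> \<in> {1, -1}" and y: "\<bar>y - x\<bar> \<le> t - 0" for \<rho> y
    proof -
      have z: "(y, 0) \<in> region x r" by (rule reg) (use t y in auto)
      have "v \<rho> y 0 = F \<rho> y" using v_integral[OF r(2) A \<rho> z] by simp
      moreover have "Gam \<rho> \<le> F \<rho> y" by (rule F_ge[OF \<rho>]) (use z in \<open>auto simp: region_def cone_domain_def\<close>)
      ultimately show ?thesis by (simp add: E_def \<alpha>0)
    qed
    show "\<exists>D. ((\<lambda>s'. E \<rho> (y + \<rho> * (s - s')) s') has_real_derivative D) (at s) \<and>
        LA * min 0 (E 1 y s + E (-1) y s) \<le> D"
      if \<rho>: "\<rho> \<in> {1, -1}" and ys: "(y, s) \<in> {(y, s). 0 \<le> s \<and> s \<le> t \<and> \<bar>y - x\<bar> \<le> t - s}" and s0: "0 < s" for \<rho> y s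
    proof -
      define \<alpha>' where "\<alpha>' = 2 powr (1 - p) * \<alpha> s powr p - \<mu> * \<alpha> s"
      have s: "0 < s" "s \<le> t" "s < T1" "\<bar>y - x\<bar> \<le> t - s" using ys s0 t by auto
      have zi: "(y, s) \<in> inner x r" and zr: "(y, s) \<in> region x r" using inn reg s by auto
      have "((\<lambda>s'. E \<rho> (y + \<rho> * (s - s')) s') has_real_derivative W y s - 0 - (\<alpha>' - 0) / 2) (at s)"
        unfolding E_def \<alpha>'_def
        by (intro DERIV_diff DERIV_cdivide v_characteristic_derivative[OF r(2) A \<rho> zi] \<alpha>d[OF s(3)] DERIV_const)
      moreover have "LA * min 0 (u y s - \<alpha> s) \<le> W y s - 0 - (\<alpha>' - 0) / 2"
      proof -
        have ag: "\<gamma>1 + \<gamma>2 \<le> \<alpha> s" using \<alpha>mono[of 0 s] \<alpha>0 s by simp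
        have ut: "\<alpha> s \<le> \<alpha> t" using \<alpha>mono[of s t] s t by simp
        have ug: "\<gamma>1 + \<gamma>2 \<le> u y s" by (rule u_bounds(1)[OF r(2) A zr])
        have half: "\<alpha>' / 2 \<le> Nl p \<mu> (\<alpha> s) s"
        proof -
          have h: "2 powr (1 - p) = 2 * 2 powr (-p)" by (simp add: powr_diff powr_minus field_simps)
          have "\<mu> / (1 + s) \<le> \<mu> / 1" by (rule divide_left_mono) (use \<mu> s in auto)
          then have "\<mu> / (1 + s) * (\<alpha> s / 2) \<le> \<mu> * (\<alpha> s / 2)"
            using mult_right_mono[of "\<mu> / (1 + s)" \<mu> "\<alpha> s / 2"] ag \<gamma> by simp
          then show ?thesis using ag \<gamma> by (simp add: \<alpha>'_def Nl_def h)
        qed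
        have "LA * min 0 (u y s - \<alpha> s) \<le> Nl p \<mu> (u y s) s - Nl p \<mu> (\<alpha> s) s"
        proof (cases "\<alpha> s \<le> u y s")
          case True
          then show ?thesis using Nl_diff_bounds(1)[OF ag True order_refl, of s] s by simp
        next
          case False
          then have "Nl p \<mu> (\<alpha> s) s - Nl p \<mu> (u y s) s \<le> LA * (\<alpha> s - u y s)"
            unfolding LA_def using Nl_diff_bounds(2)[OF ug _ ut, of s] s by simp
          then show ?thesis using False by (simp add: min_def algebra_simps)
        qed
        also have "\<dots> \<le> W y s - 0 - (\<alpha>' - 0) / 2"
          unfolding W_def diff_0_right by (rule diff_left_mono[OF half])
        finally show ?thesis .
      qed
      ultimately show ?thesis unfolding sumE by blast
    qed
  qed (rule \<sigma>)
  from this[of 1] this[of "-1"] have "\<alpha> t \<le> u x t" using sumE[of x t] by simp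
  moreover have "u x t \<le> A" by (rule u_bounds(2)[OF r(2) A reg]) (use t in auto)
  ultimately show False using t by linarith
qed

text \<open>This excludes that \<open>T x\<close> is merely the cut-off \<open>Ts\<close> in the
  definition of the blow-up time; only then can continuation past \<open>T x\<close> be a
  contradiction in \<open>u_blowup\<close>.\<close>

lemma T_less: "\<bar>x\<bar> < Rs \<Longrightarrow> T x < Ts"
  using T_le_early early by fastforce

lemma u_mono_time:
  assumes "\<bar>x\<bar> < Rs" "0 < s" "s \<le> t" "t < T x"
  shows "u x s \<le> u x t"
proof -
  obtain r A where r: "(x, r) \<in> cone_domain (Rs + Ts)" "(x, t) \<in> inner x r" and A: "\<And>n. U n x r \<le> A"
    using inner_below_T[of x t] assms by force
  have zt: "(x, t) \<in> region x r" using inner_region[OF r(1) A] r(2) by blast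
  have zs: "(x, s) \<in> region x r" using zt assms by (auto simp: region_def cone_domain_def)
  have "v \<sigma> x s \<le> v \<sigma> (x + 0) (s + (t - s))" if "\<sigma> \<in> {1, -1}" for \<sigma>
    by (rule v_cone[OF r(1) A that zs]) (use zt assms in auto)
  from this[of 1] this[of "-1"] show ?thesis by (simp add: u_def)
qed

text \<open>If \<open>u\<close> stayed bounded on the column, cone monotonicity would bound the
  iterates at time \<open>T x - \<eta>\<close> on an interval of radius larger than \<eta>. Local
  existence from there reaches beyond \<open>T x\<close> on the column and contradicts the
  definition of \<open>T\<close>.\<close>

lemma u_blowup:
  assumes x: "\<bar>x\<bar> < Rs"
  shows "filterlim (\<lambda>t. u x t) at_top (at_left (T x))"
proof -
  define T0 where "T0 = T x"
  have T0: "0 < T0" "T0 < Ts" using T_pos[OF x] T_less[OF x] by (auto simp: T0_def)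
  have "\<exists>t. 0 < t \<and> t < T0 \<and> A < u x t" for A
  proof (rule ccontr)
    assume "\<not> ?thesis"
    then have le: "u x t \<le> A" if "0 < t" "t < T0" for t using that by force
    define B where "B = max A 1"
    have B: "0 < B" "A \<le> B" by (auto simp: B_def)
    define c where "c = 2 powr (-p) * (4 * B) powr p"
    have c: "0 < c" using B by (simp add: c_def)
    \<comment> \<open>The midpoint of 1 and \<open>1 / \<theta>\<close>: above 1, so that the light
      cone over the interval reaches past \<open>T x\<close>, and below \<open>1 / \<theta>\<close>,
      so that the cone bound covers this interval.\<close>
    define \<theta>' where "\<theta>' = (1 + \<theta>) / (2 * \<theta>)"
    have \<theta>': "1 < \<theta>'" "\<theta> * \<theta>' < 1" using \<theta> by (auto simp: \<theta>'_def field_simps)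
    \<comment> \<open>The three entries keep the restart time positive, the end time below
      \<open>Ts\<close>, and the duration \<open>\<theta>' * \<eta>\<close> within the time granted
      by \<open>local_existence\<close>. Half of \<open>m0\<close> is taken for strictness.\<close>
    define m0 where "m0 = min (T0 / 2) (min ((Ts - T0) / \<theta>') (B / (c * \<theta>')))"
    define \<eta> where "\<eta> = m0 / 2"
    have \<eta>: "0 < \<eta>" "\<eta> < T0" "\<theta>' * \<eta> < Ts - T0" "\<theta>' * \<eta> * c \<le> B"
    proof -
      have pos: "0 < m0" using T0 \<theta>' B c by (simp add: m0_def)
      have "m0 \<le> T0 / 2" "m0 \<le> (Ts - T0) / \<theta>'" "m0 \<le> B / (c * \<theta>')"
        unfolding m0_def by (rule min.cobounded1, rule min.coboundedI2[OF min.cobounded1], rule min.coboundedI2[OF min.cobounded2])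
      then have l: "\<eta> < T0 / 2" "\<eta> < (Ts - T0) / \<theta>'" "\<eta> < B / (c * \<theta>')"
        unfolding \<eta>_def using pos by linarith+
      show "0 < \<eta>" using pos by (simp add: \<eta>_def)
      show "\<eta> < T0" using l T0 by linarith
      show "\<theta>' * \<eta> < Ts - T0" using l \<theta>' by (simp add: field_simps)
      show "\<theta>' * \<eta> * c \<le> B" using l(3) \<theta>' c by (simp add: field_simps)
    qed
    define t0 \<rho> where "t0 = T0 - \<eta>" and "\<rho> = \<theta>' * \<eta>"
    have \<rho>: "\<eta> < \<rho>" using \<theta>' \<eta> by (simp add: \<rho>_def)
    have base: "Phi n \<sigma> y t0 \<le> B" if \<sigma>: "\<sigma> \<in> {1, -1}" and y: "\<bar>y - x\<bar> \<le> \<rho>" for n \<sigma> y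
    proof -
      have "\<theta> * \<bar>y - x\<bar> \<le> \<theta> * \<rho>" using y \<theta> by (intro mult_left_mono) auto
      also have "\<dots> < 1 * \<eta>" unfolding \<rho>_def using \<theta>' \<eta> by (simp add: mult.assoc[symmetric])
      finally have lt: "t0 + \<theta> * \<bar>y - x\<bar> < T0" by (simp add: t0_def)
      \<comment> \<open>The earliest time on the column of \<open>x\<close> whose enlarged backward
        cone contains \<open>(y, t0)\<close>; it is still before blow-up because
        \<open>\<theta> * \<rho> < \<eta>\<close>.\<close>
      define s where "s = t0 + \<theta> * \<bar>y - x\<bar>"
      have s: "0 < s" "s < T0" using lt \<theta> \<eta> by (auto simp: s_def t0_def intro: add_pos_nonneg)
      obtain r A' where r: "(x, r) \<in> cone_domain (Rs + Ts)" "(x, s) \<in> inner x r" and A': "\<And>n. U n x r \<le> A'"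
        using inner_below_T[of x s] x s by (force simp: T0_def)
      have zs: "(x, s) \<in> region x r" using inner_region[OF r(1) A'] r(2) by blast
      have zy: "(y, t0) \<in> cone_domain (Rs + Ts)"
        using x y \<eta> T0 by (auto simp: cone_domain_def t0_def \<rho>_def)
      have zx: "(x, s) \<in> cone_domain (Rs + Ts)" using column_dom[OF x] s T0 by simp
      have "Phi n \<sigma> y t0 \<le> Phi n \<sigma> (y + (x - y)) (t0 + (s - t0))"
        by (rule Phi_cone[OF \<sigma> zy]) (use zx in \<open>auto simp: s_def abs_minus_commute\<close>)
      also have "\<dots> = Phi n \<sigma> x s" by simp
      also have "\<dots> \<le> U n x s"
        using Phi_ge[OF _ zx, of 1 n] Phi_ge[OF _ zx, of "-1" n] Gam(1)[of 1] Gam(1)[of "-1"] \<sigma>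
        by (auto simp: U_def)
      also have "\<dots> \<le> u x s"
      proof (rule incseq_le[OF _ U_tendsto[OF r(1) A' zs]])
        show "incseq (\<lambda>n. U n x s)"
          unfolding U_def using Phi_mono_Suc[OF _ zx] by (intro incseq_SucI add_mono) auto
      qed
      also have "\<dots> \<le> B" using le[OF s] B by linarith
      finally show ?thesis .
    qed
    have "Phi n \<sigma> x (t0 + \<rho>) \<le> 2 * B" if "\<sigma> \<in> {1, -1}" for n \<sigma>
    proof (rule local_existence[where ?t0.0 = t0 and \<rho> = \<rho> and x = x])
      show "0 \<le> t0" using \<eta> by (simp add: t0_def)
      show "(x, t0 + \<rho>) \<in> cone_domain (Rs + Ts)"
        using \<eta> \<rho> T0 by (intro column_dom[OF x]) (auto simp: t0_def \<rho>_def)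
      show "(t0 + \<rho> - t0) * (2 powr (-p) * (4 * B) powr p) \<le> B"
        using \<eta>(4) by (simp add: \<rho>_def c_def)
    qed (use B base that \<rho> \<eta> in auto)
    then have "bounded_at x (t0 + \<rho>)" by (rule bounded_at_if_Phi_le)
    moreover have "0 < t0 + \<rho>" "t0 + \<rho> < Ts" using \<eta> \<rho> T0 by (simp_all add: t0_def \<rho>_def[symmetric])
    ultimately have "t0 + \<rho> \<le> T0" unfolding T0_def by (intro le_T[OF x])
    then show False using \<rho> by (simp add: t0_def)
  qed
  note unb = this
  show ?thesis
    unfolding filterlim_at_top_dense
  proof
    fix Z
    obtain t where t: "0 < t" "t < T0" "Z < u x t" using unb by blast
    have "Z < u x s" if "s \<in> {t<..<T x}" for s
      using u_mono_time[OF x t(1), of s] that t by (simp add: T0_def)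
    then show "eventually (\<lambda>s. Z < u x s) (at_left (T x))"
      using eventually_at_left_real[of t "T x"] t unfolding T0_def by (auto elim: eventually_mono)
  qed
qed

lemma T_C1: "T C1_differentiable_on {x. \<bar>x\<bar> < Rs}"
proof -
  interpret S: blowup_solution p \<mu> "\<gamma>1 + \<gamma>2" \<theta> Rs v a T
  proof unfold_locales
    show "0 < \<theta>" "\<theta> < 1" by (fact \<theta>)+
    show "0 < T x" if "\<bar>x\<bar> < Rs" for x by (rule T_pos[OF that])
    show "\<bar>T x - T y\<bar> \<le> \<theta> * \<bar>x - y\<bar>" if "\<bar>x\<bar> < Rs" "\<bar>y\<bar> < Rs" for x y
      using T_lipschitz_le[OF that] T_lipschitz_le[OF that(2,1)] by (simp add: abs_le_iff abs_minus_commute)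
    show "filterlim (\<lambda>t. v 1 x t + v (-1) x t) at_top (at_left (T x))" if "\<bar>x\<bar> < Rs" for x
      using u_blowup[OF that] by (simp add: u_def)
    fix \<sigma> x t :: real assume x: "\<bar>x\<bar> < Rs" and t: "0 < t" "t < T x"
    obtain r A where r: "(x, r) \<in> cone_domain (Rs + Ts)" "(x, t) \<in> inner x r" and A: "\<And>n. U n x r \<le> A"
      using inner_below_T[OF x t] by blast
    have "(x, t) \<in> region x r" using inner_region[OF r(1) A] r(2) by blast
    then show "\<gamma>1 + \<gamma>2 \<le> v 1 x t + v (-1) x t"
      using u_bounds(1)[OF r(1) A] by (simp add: u_def)
    assume \<sigma>: "\<sigma> \<in> {1, -1}"
    show "((\<lambda>(x, t). v \<sigma> x t) has_derivative
        (\<lambda>(h, k). h * a \<sigma> x t + k * (\<sigma> * a \<sigma> x t + Nl p \<mu> (v 1 x t + v (-1) x t) t))) (at (x, t))"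
      using v_total_derivative[OF r(1) A \<sigma> r(2)] by (simp only: W_def u_def)
    show "isCont (\<lambda>(x, t). a \<sigma> x t) (x, t)" by (rule a_isCont[OF r(1) A \<sigma> r(2)])
    show "((\<lambda>s. a \<sigma> (x + \<sigma> * (t - s)) s) has_real_derivative
        Nu p \<mu> (v 1 x t + v (-1) x t) t * (a 1 x t + a (-1) x t)) (at t)"
      using a_characteristic_derivative[OF r(1) A \<sigma> r(2)] by (simp only: V_def u_def)
    show "\<bar>a \<sigma> x t\<bar> \<le> \<theta> * (\<sigma> * a \<sigma> x t + Nl p \<mu> (v 1 x t + v (-1) x t) t)"
      using a_le[OF r(1) A \<sigma> r(2)] by (simp only: W_def u_def)
  qed
  show ?thesis by (rule S.T_C1)
qed

end

section \<open>Translation of the data hypotheses\<close>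

lemma Ck_on_interval_derivative:
  assumes "Ck_on k f {-L..L}" "1 \<le> k"
  shows "\<exists>f'. continuous_on {-L..L} f' \<and> (\<forall>x. \<bar>x\<bar> < L \<longrightarrow> (f has_real_derivative f' x) (at x))"
proof -
  obtain D where D: "\<And>x. x \<in> {-L..L} \<Longrightarrow> D 0 x = f x" "\<And>j. j \<le> k \<Longrightarrow> continuous_on {-L..L} (D j)"
    "\<And>j x. j < k \<Longrightarrow> x \<in> {-L..L} \<Longrightarrow> (D j has_real_derivative D (Suc j) x) (at x within {-L..L})"
    using assms(1) unfolding Ck_on_def by blast
  have "(f has_real_derivative D 1 x) (at x)" if x: "\<bar>x\<bar> < L" for x
  proof -
    have xi: "x \<in> {-L<..<L}" using x by auto
    have "(D 0 has_real_derivative D (Suc 0) x) (at x within {-L..L})"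
      by (rule D(3)) (use x assms(2) in auto)
    then have "(D 0 has_real_derivative D 1 x) (at x)"
      using xi by (simp add: at_within_Icc_at)
    then show ?thesis
      by (rule has_field_derivative_transform_within_open[of _ _ _ "{-L<..<L}"]) (use xi D(1) in auto)
  qed
  then show ?thesis using D(2)[of 1] assms(2) by blast
qed

theorem theorem3p5:
  fixes p \<mu> Rs Ts \<gamma>1 \<gamma>2 :: real and f g :: "real \<Rightarrow> real"
  assumes hp: "p > 1" and hmu: "\<mu> > 0" and hpmu: "p < 1 + 2 / \<mu>"
    and hR: "Rs > 0" and hT: "Ts > 0"
    and hg1: "\<gamma>1 > 0" and hg2: "\<gamma>2 > 0"
    and hgam: "\<gamma>1 + \<gamma>2 > max 1 ((\<mu> * p * 2 powr p) powr (1 / (p - 1)))"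
    and A1: "1 / ((p - 1) * \<mu>) *
               ln ((2 powr (1 - p) / \<mu>) / (2 powr (1 - p) / \<mu> - (\<gamma>1 + \<gamma>2) powr (1 - p)))
             < Ts"
    and A2: "\<forall>x. \<bar>x\<bar> < Rs + Ts \<longrightarrow> f x \<ge> \<gamma>1 \<and> g x \<ge> \<gamma>2"
    and A3: "Ck_on 4 f {-(Rs + Ts)..Rs + Ts}" "Ck_on 4 g {-(Rs + Ts)..Rs + Ts}"
    and A4: "\<exists>\<epsilon>0>0. 2 powr (-p) * (\<gamma>1 + \<gamma>2) powr p - \<mu> / 2 * (\<gamma>1 + \<gamma>2)
               \<ge> (2 + \<epsilon>0) * Sup ((\<lambda>x. \<bar>deriv f x\<bar> + \<bar>deriv g x\<bar>) ` {x. \<bar>x\<bar> < Rs + Ts})"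
    and A5: "\<exists>\<epsilon>1. \<epsilon>1 \<noteq> -1 \<and>
               2 powr (-p) * (2 * p - 1) * (1 + \<epsilon>1 / (2 * (1 + \<epsilon>1))) * (1 - 1 / (2 * p))
                 - 2 powr (-p + 1) * p - \<mu> > 0 \<and>
               2 powr (-p) * (\<gamma>1 + \<gamma>2) powr p - \<mu> / 2 * (\<gamma>1 + \<gamma>2)
                 \<ge> (2 + \<epsilon>1) * Sup ((\<lambda>x. \<bar>deriv f x\<bar> + \<bar>deriv g x\<bar>) ` {x. \<bar>x\<bar> < Rs + Ts})"
  shows "blowup_time p \<mu> f g \<gamma>1 \<gamma>2 Ts C1_differentiable_on {x. \<bar>x\<bar> < Rs}"
proof -
  define L where "L = Rs + Ts"
  have L: "0 < L" using hR hT by (simp add: L_def)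
  obtain f' where f': "continuous_on {-L..L} f'" "\<And>x. \<bar>x\<bar> < L \<Longrightarrow> (f has_real_derivative f' x) (at x)"
    using Ck_on_interval_derivative[OF A3(1)] by (auto simp: L_def)
  obtain g' where g': "continuous_on {-L..L} g'" "\<And>x. \<bar>x\<bar> < L \<Longrightarrow> (g has_real_derivative g' x) (at x)"
    using Ck_on_interval_derivative[OF A3(2)] by (auto simp: L_def)
  define h where "h x = \<bar>deriv f x\<bar> + \<bar>deriv g x\<bar>" for x
  define M where "M = Sup (h ` {x. \<bar>x\<bar> < L})"
  have heq: "h x = \<bar>f' x\<bar> + \<bar>g' x\<bar>" if "\<bar>x\<bar> < L" for x
    using DERIV_imp_deriv[OF f'(2)[OF that]] DERIV_imp_deriv[OF g'(2)[OF that]] by (simp add: h_def)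
  have hM: "h x \<le> M" if "\<bar>x\<bar> < L" for x
    unfolding M_def
  proof (rule cSup_upper)
    \<comment> \<open>A real \<open>Sup\<close> bounds its set only if the set is bounded above.
      This holds because the derivatives extend continuously to the closed interval;
      \<open>deriv\<close> itself is identified with them only in the interior.\<close>
    have "compact ((\<lambda>x. \<bar>f' x\<bar> + \<bar>g' x\<bar>) ` {-L..L})"
      by (intro compact_continuous_image continuous_intros f'(1) g'(1)) auto
    then have "bdd_above ((\<lambda>x. \<bar>f' x\<bar> + \<bar>g' x\<bar>) ` {-L..L})"
      by (intro bounded_imp_bdd_above compact_imp_bounded)
    then obtain C where C: "\<And>x. x \<in> {-L..L} \<Longrightarrow> \<bar>f' x\<bar> + \<bar>g' x\<bar> \<le> C"
      unfolding bdd_above_def by blast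
    have "h x \<le> C" if "\<bar>x\<bar> < L" for x
    proof -
      have "x \<in> {-L..L}" using that by auto
      from C[OF this] show ?thesis using heq[OF that] by simp
    qed
    then show "bdd_above (h ` {x. \<bar>x\<bar> < L})"
      by (intro bdd_aboveI[of _ C]) auto
  qed (use that in auto)
  have M0: "0 \<le> M" using hM[of 0] heq[of 0] L by simp
  obtain \<epsilon> where \<epsilon>: "\<epsilon> > 0"
    "2 powr (-p) * (\<gamma>1 + \<gamma>2) powr p - \<mu> / 2 * (\<gamma>1 + \<gamma>2) \<ge> (2 + \<epsilon>) * M"
    using A4 unfolding M_def L_def h_def by blast
  define F where "F \<sigma> = (if \<sigma> = 1 then f else g)" for \<sigma> :: real
  define F' where "F' \<sigma> = (if \<sigma> = 1 then f' else g')" for \<sigma> :: real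
  \<comment> \<open>With this value of \<theta>, \<open>1 + 1 / \<theta>\<close> is
    \<open>2 + \<epsilon>\<close>, so (A4) becomes \<open>F'_small\<close>.\<close>
  interpret blowup_problem p \<mu> \<gamma>1 \<gamma>2 "1 / (1 + \<epsilon>)" Rs Ts M F F'
  proof
    show "1 < p" "0 < \<mu>" "0 < \<gamma>1 + \<gamma>2" "0 < \<gamma>1" "0 < \<gamma>2" "0 < Rs" "0 < Ts" "0 \<le> M"
      "0 < 1 / (1 + \<epsilon>)" "1 / (1 + \<epsilon>) < 1"
      using hp hmu hg1 hg2 hR hT M0 \<epsilon>(1) by (auto simp: field_simps)
    show "\<mu> * p * 2 powr p < (\<gamma>1 + \<gamma>2) powr (p - 1)"
    proof -
      have "((\<mu> * p * 2 powr p) powr (1 / (p - 1))) powr (p - 1) < (\<gamma>1 + \<gamma>2) powr (p - 1)"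
        using hgam hp by (intro powr_less_mono2) auto
      then show ?thesis using hp hmu by (simp add: powr_powr)
    qed
    show "\<gamma>1 \<le> F 1 x" "\<gamma>2 \<le> F (-1) x" if "\<bar>x\<bar> < Rs + Ts" for x
      using A2 that by (auto simp: F_def)
    show "1 / ((p - 1) * \<mu>) * ln ((2 powr (1 - p) / \<mu>) / (2 powr (1 - p) / \<mu> - (\<gamma>1 + \<gamma>2) powr (1 - p))) < Ts"
      by (fact A1)
    show "(1 + 1 / (1 / (1 + \<epsilon>))) * M \<le> Nl p \<mu> (\<gamma>1 + \<gamma>2) 0"
      using \<epsilon> hg1 hg2 by (simp add: Nl_def)
    fix \<sigma> :: real assume \<sigma>: "\<sigma> \<in> {1, -1}"
    have "{x. \<bar>x\<bar> < Rs + Ts} \<subseteq> {-L..L}" by (auto simp: L_def)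
    then show "continuous_on {x. \<bar>x\<bar> < Rs + Ts} (F' \<sigma>)"
      using continuous_on_subset[OF f'(1)] continuous_on_subset[OF g'(1)] by (auto simp: F'_def)
    fix x assume x: "\<bar>x\<bar> < Rs + Ts"
    then have xL: "\<bar>x\<bar> < L" by (simp add: L_def)
    show "(F \<sigma> has_real_derivative F' \<sigma> x) (at x)"
      using f'(2)[OF xL] g'(2)[OF xL] by (simp add: F_def F'_def)
    show "\<bar>F' \<sigma> x\<bar> \<le> M" using hM[OF xL] heq[OF xL] by (auto simp: F'_def)
  qed
  show ?thesis using T_C1 by (simp add: T_def F_def)
qed

end
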